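(* Let $\{X(i): i\in\mathbb{Z}^d\}$ be a Markov random field with finite state space $A$, $|A|\ge 2$, strictly positive finite-dimensional marginals and basic neighborhood $\Gamma_0$. Let $\Lambda_1\subset\Lambda_2\subset\cdots$ be sample regions with $|\Lambda_n|/|\bar\Lambda_n|\to 1$. Let $r_n\to\infty$ with $r_n = o(\log^{1/(2d)}|\Lambda_n|)$. Then the PIC estimator $$\widehat{\Gamma}_{\mathrm{PIC}}(x(\Lambda_n)) = \underset{\Gamma\,:\, r(\Gamma)\le r_n}{\arg\min}\ \mathrm{PIC}_\Gamma(x(\Lambda_n))$$ (minimum over neighborhoods $\Gamma$ with radius at most $r_n$) satisfies $$\widehat{\Gamma}_{\mathrm{PIC}}(x(\Lambda_n)) = \Gamma_0$$ eventually almost surely as $n\to\infty$.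
   Context: Field. $\|i\|$ is the maximum norm on $\mathbb{Z}^d$; $\log$ is natural; $\subset$ is strict inclusion, $\subseteq$ is inclusion. $\{X(i):i\in\mathbb{Z}^d\}$ are random variables with values in a finite set $A$, with joint distribution $Q$; for $\Delta\subseteq\mathbb{Z}^d$, $X(\Delta)=\{X(i):i\in\Delta\}$ and $a(\Delta)=\{a(i)\in A: i\in\Delta\}$ denotes an element of $A^\Delta$ (a "block" if $\Delta$ is finite). It is assumed that $Q(a(\Delta))=\mathrm{Prob}\{X(\Delta)=a(\Delta)\}>0$ for all finite $\Delta$ and $a(\Delta)\in A^\Delta$; $Q(a(\Delta)|a(\Phi))=\mathrm{Prob}\{X(\Delta)=a(\Delta)\mid X(\Phi)=a(\Phi)\}$ for disjoint finite $\Delta,\Phi$. A neighborhood is a finite (possibly empty) set $\Gamma\subset\mathbb{Z}^d$ with $\Gamma=-\Gamma$, $0\notin\Gamma$; its radius is $r(\Gamma)=\max_{i\in\Gamma}\|i\|$ ($r(\emptyset)=0$). $\Delta^i=\{i+j:j\in\Delta\}$. The field is a Markov random field if there is a neighborhood $\Gamma$, called a Markov neighborhood, such that for every $i\in\mathbb{Z}^d$, $Q(a(i)|a(\Delta^i))=Q(a(i)|a(\Gamma^i))$ for all finite $\Delta\supset\Gamma$ with $0\notin\Delta$ and all configurations, where the right-hand conditional probability is translation invariant (it does not depend on $i$ when blocks are identified by translation). $Q$ itself need not be translation invariant. It is known that there is a smallest Markov neighborhood $\Gamma_0$ (the basic neighborhood), and the Markov neighborhoods are exactly the neighborhoods containing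 $\Gamma_0$. Sampling. $\Lambda_n\subset\mathbb{Z}^d$ are finite regions; the sample $x(\Lambda_n)$ is the restriction of a realization $x$ of the field to $\Lambda_n$. $\bar\Lambda_n=\{i\in\Lambda_n:\{j\in\mathbb{Z}^d:\|i-j\|\le\log^{1/(2d)}|\Lambda_n|\}\subseteq\Lambda_n\}$. For a neighborhood $\Gamma$ and block $a(\Gamma)\in A^\Gamma$, $N_n(a(\Gamma))=|\{i\in\bar\Lambda_n:\Gamma^i\subseteq\Lambda_n,\ x(\Gamma^i)=a(\Gamma)\}|$; for a block $a(\Gamma,0)\in A^{\Gamma\cup\{0\}}$, $N_n(a(\Gamma,0))=|\{i\in\bar\Lambda_n:\Gamma^i\subseteq\Lambda_n,\ x(\Gamma^i\cup\{i\})=a(\Gamma,0)\}|$ (blocks identified by translation). PIC. $\log\mathrm{MPL}_\Gamma(x(\Lambda_n))=\sum_{a(\Gamma,0):\,N_n(a(\Gamma,0))\ge1}N_n(a(\Gamma,0))\log\frac{N_n(a(\Gamma,0))}{N_n(a(\Gamma))}$, where $a(\Gamma)$ is the restriction of $a(\Gamma,0)$ to $\Gamma$, and $\mathrm{PIC}_\Gamma(x(\Lambda_n))=-\log\mathrm{MPL}_\Gamma(x(\Lambda_n))+|A|^{|\Gamma|}\log|\Lambda_n|$. If the minimizer is not unique, any minimizer may be chosen. "Eventually almost surely as $n\to\infty$" means: with probability 1 there is a threshold $n_0$ (depending on the infinite realization) such that the claim holds for all $n\ge n_0$. *)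

theory Defs
  imports "HOL-Probability.Probability"
begin

text \<open>
  The lattice is \<^typ>\<open>int ^ 'd\<close>, of dimension \<open>CARD('d)\<close>; the state space is the finite
  type \<^typ>\<open>'a\<close>.  A configuration on a region \<open>\<Delta>\<close> is represented by a function
  \<open>a\<close> on the whole lattice of which only the values on \<open>\<Delta>\<close> are used.
\<close>

definition max_norm :: "int ^ 'd \<Rightarrow> int" where
  "max_norm i = Max (range (\<lambda>k. \<bar>i $ k\<bar>))"

definition translate :: "(int ^ 'd) set \<Rightarrow> int ^ 'd \<Rightarrow> (int ^ 'd) set" where
  "translate \<Delta> i = (\<lambda>j. i + j) ` \<Delta>"

definition block_prob ::
  "'w measure \<Rightarrow> (int ^ 'd \<Rightarrow> 'w \<Rightarrow> 'a) \<Rightarrow> (int ^ 'd) set \<Rightarrow> (int ^ 'd \<Rightarrow> 'a) \<Rightarrow> real" where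
  "block_prob M X \<Delta> a = \<P>(\<omega> in M. \<forall>j\<in>\<Delta>. X j \<omega> = a j)"

definition cond_block_prob ::
  "'w measure \<Rightarrow> (int ^ 'd \<Rightarrow> 'w \<Rightarrow> 'a) \<Rightarrow> (int ^ 'd) set \<Rightarrow> (int ^ 'd) set \<Rightarrow> (int ^ 'd \<Rightarrow> 'a) \<Rightarrow> real" where
  "cond_block_prob M X \<Delta> \<Phi> a =
     \<P>(\<omega> in M. (\<forall>j\<in>\<Delta>. X j \<omega> = a j) \<bar> (\<forall>j\<in>\<Phi>. X j \<omega> = a j))"

definition neighborhood :: "(int ^ 'd) set \<Rightarrow> bool" where
  "neighborhood \<Gamma> \<longleftrightarrow> finite \<Gamma> \<and> uminus ` \<Gamma> = \<Gamma> \<and> 0 \<notin> \<Gamma>"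

definition radius :: "(int ^ 'd) set \<Rightarrow> int" where
  "radius \<Gamma> = (if \<Gamma> = {} then 0 else Max (max_norm ` \<Gamma>))"

text \<open>
  The last conjunct is translation invariance of the one-point conditional probabilities: the
  configuration \<open>a\<close> moved by \<open>i\<close> is \<open>\<lambda>j. a (j - i)\<close>.
\<close>

definition markov_neighborhood ::
  "'w measure \<Rightarrow> (int ^ 'd \<Rightarrow> 'w \<Rightarrow> 'a) \<Rightarrow> (int ^ 'd) set \<Rightarrow> bool" where
  "markov_neighborhood M X \<Gamma> \<longleftrightarrow>
     neighborhood \<Gamma> \<and>
     (\<forall>i \<Delta> a. finite \<Delta> \<longrightarrow> \<Gamma> \<subset> \<Delta> \<longrightarrow> 0 \<notin> \<Delta> \<longrightarrow>
        cond_block_prob M X {i} (translate \<Delta> i) a = cond_block_prob M X {i} (translate \<Gamma> i) a) \<and>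
     (\<forall>i a. cond_block_prob M X {i} (translate \<Gamma> i) (\<lambda>j. a (j - i)) = cond_block_prob M X {0} \<Gamma> a)"

definition markov_random_field :: "'w measure \<Rightarrow> (int ^ 'd \<Rightarrow> 'w \<Rightarrow> 'a) \<Rightarrow> bool" where
  "markov_random_field M X \<longleftrightarrow> (\<exists>\<Gamma>. markov_neighborhood M X \<Gamma>)"

definition basic_neighborhood ::
  "'w measure \<Rightarrow> (int ^ 'd \<Rightarrow> 'w \<Rightarrow> 'a) \<Rightarrow> (int ^ 'd) set \<Rightarrow> bool" where
  "basic_neighborhood M X \<Gamma>\<^sub>0 \<longleftrightarrow>
     markov_neighborhood M X \<Gamma>\<^sub>0 \<and> (\<forall>\<Gamma>. markov_neighborhood M X \<Gamma> \<longrightarrow> \<Gamma>\<^sub>0 \<subseteq> \<Gamma>)"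

text \<open>\<open>log_scale \<Lambda>\<close> is $\log^{1/(2d)} |\Lambda|$.\<close>

definition log_scale :: "(int ^ 'd) set \<Rightarrow> real" where
  "log_scale \<Lambda> = ln (real (card \<Lambda>)) powr (1 / (2 * real CARD('d)))"

definition inner_region :: "(int ^ 'd) set \<Rightarrow> (int ^ 'd) set" where
  "inner_region \<Lambda> = {i \<in> \<Lambda>. {j. real_of_int (max_norm (i - j)) \<le> log_scale \<Lambda>} \<subseteq> \<Lambda>}"

text \<open>
  In what follows \<open>x\<close> is a realization on the whole lattice, of which only the values on the
  sample region \<open>\<Lambda>\<close> are used.  The two counts below are $N_n(a(\Gamma))$ and
  $N_n(a(\Gamma,0))$; both require the translate of \<open>\<Gamma>\<close> to lie in \<open>\<Lambda>\<close>.
\<close>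

definition block_count ::
  "(int ^ 'd) set \<Rightarrow> (int ^ 'd \<Rightarrow> 'a) \<Rightarrow> (int ^ 'd) set \<Rightarrow> (int ^ 'd \<Rightarrow> 'a) \<Rightarrow> nat" where
  "block_count \<Lambda> x \<Gamma> a =
     card {i \<in> inner_region \<Lambda>. translate \<Gamma> i \<subseteq> \<Lambda> \<and> (\<forall>j\<in>\<Gamma>. x (i + j) = a j)}"

definition centered_block_count ::
  "(int ^ 'd) set \<Rightarrow> (int ^ 'd \<Rightarrow> 'a) \<Rightarrow> (int ^ 'd) set \<Rightarrow> (int ^ 'd \<Rightarrow> 'a) \<Rightarrow> nat" where
  "centered_block_count \<Lambda> x \<Gamma> a =
     card {i \<in> inner_region \<Lambda>. translate \<Gamma> i \<subseteq> \<Lambda> \<and> (\<forall>j\<in>insert 0 \<Gamma>. x (i + j) = a j)}"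

definition log_MPL ::
  "(int ^ 'd) set \<Rightarrow> (int ^ 'd \<Rightarrow> 'a::finite) \<Rightarrow> (int ^ 'd) set \<Rightarrow> real" where
  "log_MPL \<Lambda> x \<Gamma> =
     (\<Sum>a \<in> {a \<in> insert 0 \<Gamma> \<rightarrow>\<^sub>E UNIV. centered_block_count \<Lambda> x \<Gamma> a \<ge> 1}.
        real (centered_block_count \<Lambda> x \<Gamma> a) *
        ln (real (centered_block_count \<Lambda> x \<Gamma> a) / real (block_count \<Lambda> x \<Gamma> a)))"

definition PIC ::
  "(int ^ 'd) set \<Rightarrow> (int ^ 'd \<Rightarrow> 'a::finite) \<Rightarrow> (int ^ 'd) set \<Rightarrow> real" where
  "PIC \<Lambda> x \<Gamma> = - log_MPL \<Lambda> x \<Gamma> + real (CARD('a) ^ card \<Gamma>) * ln (real (card \<Lambda>))"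

text \<open>
  The minimizer need not be unique and any of them may be used as the estimate, so the estimator
  is represented by the set of all minimizers.
\<close>

definition PIC_minimizers ::
  "(int ^ 'd) set \<Rightarrow> (int ^ 'd \<Rightarrow> 'a::finite) \<Rightarrow> real \<Rightarrow> (int ^ 'd) set set" where
  "PIC_minimizers \<Lambda> x R =
     {\<Gamma>. is_arg_min (PIC \<Lambda> x) (\<lambda>\<Gamma>. neighborhood \<Gamma> \<and> real_of_int (radius \<Gamma>) \<le> R) \<Gamma>}"

end

theory Submission
  imports Defs "HOL-Real_Asymp.Real_Asymp"
begin

text \<open>
  The log pseudo-likelihood of a neighborhood \<open>\<Gamma>\<close> is the sum, over the sites \<open>i\<close> of the inner region,
  of the logarithm of the empirical conditional probability of the symbol at \<open>i\<close> given the block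
  around \<open>i\<close> (\<open>log_MPL_eq_sum\<close>).  All neighborhoods are thus compared on the same set of sites, and
  each is compared with the sum of the true values \<open>ln (site_kernel \<dots>)\<close>, where \<open>site_kernel\<close> is the
  one-point conditional probability of the field given the basic neighborhood.

  Almost surely, for large samples and simultaneously for all neighborhoods \<open>\<Gamma> \<supseteq> \<Gamma>\<^sub>0\<close> of the
  admissible radius and all blocks, the empirical transition counts deviate from their conditional
  expectations by at most \<open>3 * sqrt (\<tau> * N)\<close>, where \<open>N\<close> is the number of occurrences of the block and
  \<open>\<tau>\<close> is a small multiple of \<open>ln (card \<Lambda>)\<close>.  Two sites whose windows are disjoint do not interfere:
  conditionally on the rest of the field the symbol at a site follows \<open>site_kernel\<close>.  Hence along each
  residue class of sites modulo the diameter of the window, an exponential process is a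
  supermartingale and Ville's inequality controls it uniformly in the sample size (\<open>ville\<close>).  Adding up
  the residue classes costs a factor equal to their number, which is
  below any multiple of \<open>sqrt (ln (card \<Lambda>))\<close> by the growth condition on the radius.  The sample
  regions are grouped into epochs, on which the integer part \<open>k\<close> of the logarithmic scale is constant.  Within an epoch the
  inner regions increase, so that one maximal inequality serves the whole epoch, and with at most
  \<open>exp (C * k ^ d)\<close> statistics to control and failure probabilities below \<open>exp (- C' * k ^ d)\<close>, with
  \<open>C'\<close> as large as desired, the Borel-Cantelli lemma over \<open>k\<close> applies (\<open>AE_eventually_typical\<close>).

  On a typical realization everything is deterministic.  If \<open>\<Gamma>\<close> strictly contains \<open>\<Gamma>\<^sub>0\<close>, the gain in
  log pseudo-likelihood is at most a chi-square sum with one term of size \<open>O(\<tau>)\<close> per block, hence at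
  most a quarter of the penalty of \<open>\<Gamma>\<close>, while the penalty of \<open>\<Gamma>\<^sub>0\<close> is at most half of it
  (\<open>PIC_overfit\<close>).  If \<open>\<Gamma>\<close> misses a site of \<open>\<Gamma>\<^sub>0\<close>, it also misses a site \<open>j\<close> on which \<open>site_kernel\<close>
  really depends.  The empirical conditional probabilities of \<open>\<Gamma>\<close> are blind to the symbol at \<open>j\<close>, so
  they are bounded away in Hellinger distance from \<open>site_kernel\<close> at one of two contexts that differ
  only at \<open>j\<close>.  Among the sites that see a given block off \<open>\<Gamma>\<^sub>0\<close>, each of these contexts occurs at a
  positive fraction, because every pattern on \<open>\<Gamma>\<^sub>0\<close> has conditional probability bounded below.  The loss is therefore linear in
  the number of sites and beats the penalty (\<open>PIC_underfit\<close>).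
\<close>

section \<open>Cubes, residue classes and local functions\<close>

definition cube :: "nat \<Rightarrow> (int ^ 'd) set" where
  "cube R = {v. max_norm v \<le> int R}"

definition recentre :: "int ^ 'd \<Rightarrow> (int ^ 'd \<Rightarrow> 'a) \<Rightarrow> int ^ 'd \<Rightarrow> 'a" where
  "recentre i x = (\<lambda>j. x (i + j))"

text \<open>
  Distinct sites with the same residue modulo \<open>2 * R + 1\<close> have disjoint surrounding cubes of radius \<open>R\<close>.
\<close>

definition residue :: "int \<Rightarrow> int ^ 'd \<Rightarrow> int ^ 'd" where
  "residue m v = (\<chi> k. v $ k mod m)"

text \<open>
  Local functions of the configuration have finite sums as expectations, which makes all the
  conditioning below elementary.
\<close>

definition local_on :: "'i set \<Rightarrow> (('i \<Rightarrow> 'a) \<Rightarrow> 'b) \<Rightarrow> bool" where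
  "local_on V W \<longleftrightarrow> (\<forall>x y. (\<forall>j\<in>V. x j = y j) \<longrightarrow> W x = W y)"

lemma max_norm_le_iff: "max_norm v \<le> r \<longleftrightarrow> (\<forall>k. \<bar>v $ k\<bar> \<le> r)"
  unfolding max_norm_def by (subst Max_le_iff) auto

lemma max_norm_uminus: "max_norm (- v) = max_norm v"
  by (simp add: max_norm_def)

lemma card_vec_all_in:
  fixes S :: "int set"
  shows "finite S \<Longrightarrow> finite {v :: int ^ 'd. \<forall>k. v $ k \<in> S}"
    and "card {v :: int ^ 'd. \<forall>k. v $ k \<in> S} = card S ^ CARD('d)"
proof -
  have *: "bij_betw vec_nth {v :: int ^ 'd. \<forall>k. v $ k \<in> S} (UNIV \<rightarrow>\<^sub>E S)"
    by (rule bij_betwI[where g = vec_lambda]) auto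
  show "card {v :: int ^ 'd. \<forall>k. v $ k \<in> S} = card S ^ CARD('d)"
    using bij_betw_same_card[OF *] by (simp add: card_PiE)
  show "finite S \<Longrightarrow> finite {v :: int ^ 'd. \<forall>k. v $ k \<in> S}"
    using bij_betw_finite[OF *] by (simp add: finite_PiE)
qed

lemma cube_eq: "cube R = {v. \<forall>k. v $ k \<in> {- int R..int R}}"
  by (auto simp: cube_def max_norm_le_iff abs_le_iff) (smt (verit))+

lemma finite_cube [simp]: "finite (cube R)"
  unfolding cube_eq by (rule card_vec_all_in) simp

lemma card_cube: "card (cube R :: (int ^ 'd) set) = (2 * R + 1) ^ CARD('d)"
  unfolding cube_eq by (subst card_vec_all_in) (simp add: nat_add_distrib nat_mult_distrib)

lemma zero_in_cube [simp]: "0 \<in> cube R"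
  by (simp add: cube_def max_norm_le_iff)

lemma cube_mono: "R \<le> R' \<Longrightarrow> cube R \<subseteq> cube R'"
  by (auto simp: cube_def)

lemma residue_range:
  assumes "m > 0"
  shows "finite (range (residue m :: int ^ 'd \<Rightarrow> _))"
    and "card (range (residue m :: int ^ 'd \<Rightarrow> _)) \<le> nat m ^ CARD('d)"
proof -
  let ?C = "{v :: int ^ 'd. \<forall>k. v $ k \<in> {0..<m}}"
  have sub: "range (residue m :: int ^ 'd \<Rightarrow> _) \<subseteq> ?C"
    using assms by (auto simp: residue_def)
  have fin: "finite ?C" by (rule card_vec_all_in) simp
  show "finite (range (residue m :: int ^ 'd \<Rightarrow> _))" using sub fin by (rule finite_subset)
  have "card ?C = nat m ^ CARD('d)" by (subst card_vec_all_in) simp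
  then show "card (range (residue m :: int ^ 'd \<Rightarrow> _)) \<le> nat m ^ CARD('d)"
    using card_mono[OF fin sub] by simp
qed

lemma residue_class_separated:
  assumes "residue (2 * int R + 1) i = residue (2 * int R + 1) i'" "i \<noteq> i'"
  shows "translate (cube R) i \<inter> translate (cube R) i' = {}"
proof (rule ccontr)
  assume "translate (cube R) i \<inter> translate (cube R) i' \<noteq> {}"
  then obtain u v where uv: "u \<in> cube R" "v \<in> cube R" "i + u = i' + v"
    by (auto simp: translate_def)
  have "i $ k = i' $ k" for k
  proof -
    have "i $ k mod (2 * int R + 1) = i' $ k mod (2 * int R + 1)"
      using assms(1) by (simp add: residue_def vec_eq_iff)
    then have dvd: "(2 * int R + 1) dvd (i $ k - i' $ k)"
      by (simp add: mod_eq_dvd_iff)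
    have "i $ k + u $ k = i' $ k + v $ k"
      using uv(3) by (metis vector_add_component)
    moreover have "\<bar>u $ k\<bar> \<le> int R" "\<bar>v $ k\<bar> \<le> int R"
      using uv(1,2) by (auto simp: cube_def max_norm_le_iff)
    ultimately have "\<bar>i $ k - i' $ k\<bar> < 2 * int R + 1" by linarith
    then show ?thesis using dvd by (metis eq_iff_diff_eq_0 dvd_imp_le_int linorder_not_le abs_of_nonneg of_nat_0_le_iff add_nonneg_nonneg mult_nonneg_nonneg zero_le_numeral zero_le_one)
  qed
  then show False using assms(2) by (simp add: vec_eq_iff)
qed

lemma local_onD: "local_on V W \<Longrightarrow> (\<And>j. j \<in> V \<Longrightarrow> x j = y j) \<Longrightarrow> W x = W y"
  by (auto simp: local_on_def)

lemma local_on_mono: "local_on V W \<Longrightarrow> V \<subseteq> V' \<Longrightarrow> local_on V' W"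
  unfolding local_on_def by blast

lemma local_on_comp: "local_on V P \<Longrightarrow> local_on V (\<lambda>x. f (P x))"
  unfolding local_on_def by (intro allI impI arg_cong[where f = f]) blast

lemma local_on_comp2:
  "local_on V P \<Longrightarrow> local_on V P' \<Longrightarrow> local_on V (\<lambda>x. f (P x) (P' x))"
  unfolding local_on_def by (intro allI impI arg_cong2[where f = f]) blast+

lemma local_on_if:
  "local_on V P \<Longrightarrow> local_on V W \<Longrightarrow> local_on V W' \<Longrightarrow> local_on V (\<lambda>x. if P x then W x else W' x)"
  unfolding local_on_def by metis

lemmas local_on_add = local_on_comp2[where f = "(+)"]
lemmas local_on_diff = local_on_comp2[where f = "(-)"]
lemmas local_on_mult = local_on_comp2[where f = "(*)"]
lemmas local_on_cmult = local_on_comp[where f = "(*) c" for c]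
lemmas local_on_exp = local_on_comp[where f = exp]

lemma local_on_const: "local_on V (\<lambda>x. c)"
  by (simp add: local_on_def)

lemma local_on_sum:
  "(\<And>i. i \<in> T \<Longrightarrow> local_on V (F i)) \<Longrightarrow> local_on V (\<lambda>x. \<Sum>i\<in>T. F i x)"
  unfolding local_on_def by (intro allI impI sum.cong[OF refl]) blast

lemma local_on_recentre: "local_on V W \<Longrightarrow> local_on (translate V i) (\<lambda>x. W (recentre i x))"
  unfolding local_on_def translate_def recentre_def by auto

section \<open>Expectations of local functions\<close>

locale finite_valued_field = prob_space M for M :: "'w measure" +
  fixes X :: "int ^ 'd \<Rightarrow> 'w \<Rightarrow> 'a::finite"
  assumes measurable_X: "\<And>i. X i \<in> M \<rightarrow>\<^sub>M count_space UNIV"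
begin

abbreviation realization :: "'w \<Rightarrow> int ^ 'd \<Rightarrow> 'a" where
  "realization \<omega> \<equiv> (\<lambda>i. X i \<omega>)"

definition mean :: "((int ^ 'd \<Rightarrow> 'a) \<Rightarrow> real) \<Rightarrow> real" where
  "mean W = expectation (\<lambda>\<omega>. W (realization \<omega>))"

lemma block_event [measurable]:
  "finite V \<Longrightarrow> {\<omega> \<in> space M. \<forall>j\<in>V. X j \<omega> = a j} \<in> sets M"
  using measurable_X by measurable

lemma local_expansion:
  fixes W :: "(int ^ 'd \<Rightarrow> 'a) \<Rightarrow> real"
  assumes "finite V" "local_on V W" "\<omega> \<in> space M"
  shows "W (realization \<omega>) =
    (\<Sum>a \<in> V \<rightarrow>\<^sub>E UNIV. W a * indicator {\<omega> \<in> space M. \<forall>j\<in>V. X j \<omega> = a j} \<omega>)"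
    (is "_ = (\<Sum>a\<in>_. W a * indicator (?E a) \<omega>)")
proof -
  let ?r = "restrict (realization \<omega>) V"
  have "(\<Sum>a \<in> V \<rightarrow>\<^sub>E UNIV. W a * indicator (?E a) \<omega>) =
      (\<Sum>a \<in> V \<rightarrow>\<^sub>E UNIV. if a = ?r then W ?r else 0)"
  proof (rule sum.cong[OF refl])
    fix a :: "int ^ 'd \<Rightarrow> 'a" assume a: "a \<in> V \<rightarrow>\<^sub>E UNIV"
    have "(\<forall>j\<in>V. X j \<omega> = a j) \<longleftrightarrow> a = ?r"
      using a by (auto simp: PiE_def extensional_def restrict_def fun_eq_iff)
    then show "W a * indicator (?E a) \<omega> = (if a = ?r then W ?r else 0)"
      using assms(3) by (auto simp: indicator_def)
  qed
  also have "\<dots> = W ?r" using assms(1) by (simp add: finite_PiE)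
  also have "\<dots> = W (realization \<omega>)" by (rule local_onD[OF assms(2)]) simp
  finally show ?thesis by simp
qed

lemma mean_local:
  assumes "finite V" "local_on V W"
  shows "integrable M (\<lambda>\<omega>. W (realization \<omega>))"
    and "mean W = (\<Sum>a \<in> V \<rightarrow>\<^sub>E UNIV. block_prob M X V a * W a)"
proof -
  let ?E = "\<lambda>a. {\<omega> \<in> space M. \<forall>j\<in>V. X j \<omega> = a j}"
  let ?S = "\<lambda>\<omega>. \<Sum>a \<in> V \<rightarrow>\<^sub>E UNIV. W a * indicator (?E a) \<omega>"
  have int: "integrable M (\<lambda>\<omega>. W a * indicator (?E a) \<omega> :: real)" for a
    using block_event[OF assms(1)] by (intro integrable_mult_right) (simp add: integrable_indicator_iff less_top[symmetric])
  have eq: "\<And>\<omega>. \<omega> \<in> space M \<Longrightarrow> W (realization \<omega>) = ?S \<omega>"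
    by (rule local_expansion[OF assms])
  show "integrable M (\<lambda>\<omega>. W (realization \<omega>))"
    by (subst Bochner_Integration.integrable_cong[OF refl eq]) (auto intro: int)
  have "mean W = expectation ?S"
    unfolding mean_def by (rule Bochner_Integration.integral_cong[OF refl eq])
  also have "\<dots> = (\<Sum>a \<in> V \<rightarrow>\<^sub>E UNIV. W a * measure M (?E a))"
    using int block_event[OF assms(1)] by (subst Bochner_Integration.integral_sum) (auto simp: Int_absorb2)
  finally show "mean W = (\<Sum>a \<in> V \<rightarrow>\<^sub>E UNIV. block_prob M X V a * W a)"
    by (simp add: block_prob_def mult.commute)
qed

lemma mean_mono:
  assumes "finite V" "local_on V W" "local_on V W'" "\<And>x. W x \<le> W' x"
  shows "mean W \<le> mean W'"
  unfolding mean_def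
  by (intro integral_mono mean_local[OF assms(1)] assms)

lemma mean_add:
  assumes "finite V" "local_on V W" "local_on V W'"
  shows "mean (\<lambda>x. W x + W' x) = mean W + mean W'"
  unfolding mean_def
  by (intro Bochner_Integration.integral_add mean_local[OF assms(1)] assms)

lemma mean_cmult: "mean (\<lambda>x. c * W x) = c * mean W"
  by (simp add: mean_def)

lemma local_event:
  assumes "finite V" "local_on V P"
  shows "{\<omega> \<in> space M. P (realization \<omega>)} \<in> sets M"
    and "prob {\<omega> \<in> space M. P (realization \<omega>)} = mean (\<lambda>x. of_bool (P x))"
proof -
  have l: "local_on V (\<lambda>x. of_bool (P x) :: real)"
    using assms(2) by (rule local_on_comp)
  have "(\<lambda>\<omega>. of_bool (P (realization \<omega>)) :: real) \<in> borel_measurable M"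
    using mean_local(1)[OF assms(1) l] by simp
  then have "{\<omega> \<in> space M. of_bool (P (realization \<omega>)) = (1::real)} \<in> sets M"
    by measurable
  then show s: "{\<omega> \<in> space M. P (realization \<omega>)} \<in> sets M" by simp
  have "mean (\<lambda>x. of_bool (P x)) = expectation (indicator {\<omega> \<in> space M. P (realization \<omega>)})"
    unfolding mean_def by (rule Bochner_Integration.integral_cong) (auto simp: indicator_def)
  then show "prob {\<omega> \<in> space M. P (realization \<omega>)} = mean (\<lambda>x. of_bool (P x))"
    using s by (simp add: Int_absorb2)
qed

lemma mean_const [simp]: "mean (\<lambda>x. c) = c"
  by (simp add: mean_def prob_space)

lemma block_prob_local: "(\<And>j. j \<in> V \<Longrightarrow> a j = b j) \<Longrightarrow> block_prob M X V a = block_prob M X V b"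
  by (simp add: block_prob_def)

end

lemma sum_PiE_insert:
  assumes "i \<notin> V" "finite V"
  shows "(\<Sum>y \<in> insert i V \<rightarrow>\<^sub>E (UNIV :: 'a::finite set). F y) =
    (\<Sum>b\<in>UNIV. \<Sum>z \<in> V \<rightarrow>\<^sub>E UNIV. F (z(i := b)))"
proof -
  have "(\<Sum>y \<in> insert i V \<rightarrow>\<^sub>E (UNIV :: 'a set). F y) =
      (\<Sum>p \<in> UNIV \<times> (V \<rightarrow>\<^sub>E UNIV). F ((\<lambda>(b, z). z(i := b)) p))"
    unfolding PiE_insert_eq
    by (rule sum.reindex[OF inj_combinator[OF assms(1)], unfolded o_def])
  also have "\<dots> = (\<Sum>b\<in>UNIV. \<Sum>z \<in> V \<rightarrow>\<^sub>E UNIV. F (z(i := b)))"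
    by (simp add: sum.cartesian_product case_prod_unfold)
  finally show ?thesis .
qed

section \<open>The one-point specification of a positive Markov field\<close>

lemma translate_insert: "translate (insert j V) i = insert (i + j) (translate V i)"
  by (simp add: translate_def)

lemma finite_translate [simp]: "finite V \<Longrightarrow> finite (translate V i)"
  by (simp add: translate_def)

lemma mem_translate_iff: "j \<in> translate V i \<longleftrightarrow> j - i \<in> V"
  by (force simp: translate_def image_iff)

lemma translate_mono: "V \<subseteq> V' \<Longrightarrow> translate V i \<subseteq> translate V' i"
  by (auto simp: translate_def)

locale positive_markov_field = finite_valued_field M X
  for M :: "'w measure" and X :: "int ^ 'd \<Rightarrow> 'w \<Rightarrow> 'a::finite" +
  fixes \<Gamma>\<^sub>0 :: "(int ^ 'd) set"
  assumes positive: "\<And>\<Delta> a. finite \<Delta> \<Longrightarrow> block_prob M X \<Delta> a > 0"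
    and markov: "markov_neighborhood M X \<Gamma>\<^sub>0"
begin

text \<open>
  A configuration \<open>y\<close> carries both the conditioning block (on \<open>\<Gamma>\<^sub>0\<close>) and the symbol whose conditional
  probability is taken (at the origin).
\<close>

definition site_kernel :: "(int ^ 'd \<Rightarrow> 'a) \<Rightarrow> real" where
  "site_kernel y = cond_block_prob M X {0} \<Gamma>\<^sub>0 y"

lemma finite_\<Gamma>\<^sub>0 [simp]: "finite \<Gamma>\<^sub>0" and zero_notin_\<Gamma>\<^sub>0 [simp]: "0 \<notin> \<Gamma>\<^sub>0"
  using markov by (auto simp: markov_neighborhood_def neighborhood_def)

lemma cond_block_prob_eq:
  "cond_block_prob M X {i} V y = block_prob M X (insert i V) y / block_prob M X V y"
  by (simp add: cond_block_prob_def block_prob_def cond_prob_def)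

lemma site_kernel_local: "local_on (insert 0 \<Gamma>\<^sub>0) site_kernel"
  unfolding local_on_def site_kernel_def cond_block_prob_eq
  by (auto intro!: arg_cong2[where f = "(/)"] block_prob_local)

lemma site_kernel_pos: "site_kernel y > 0"
  unfolding site_kernel_def cond_block_prob_eq by (intro divide_pos_pos positive) auto

text \<open>
  The Markov property allows any finite conditioning set \<open>V\<close> that contains the translate of \<open>\<Gamma>\<^sub>0\<close>;
  translation invariance replaces the site \<open>i\<close> by the origin.
\<close>

lemma block_prob_insert:
  assumes "finite V" "i \<notin> V" "translate \<Gamma>\<^sub>0 i \<subseteq> V"
  shows "block_prob M X (insert i V) y = site_kernel (recentre i y) * block_prob M X V y"
proof -
  define \<Delta> where "\<Delta> = translate V (- i)"
  have V: "translate \<Delta> i = V" by (simp add: \<Delta>_def translate_def image_image)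
  have sub: "\<Gamma>\<^sub>0 \<subseteq> \<Delta>"
    using assms(3) by (auto simp: \<Delta>_def mem_translate_iff subset_iff)
  have "finite \<Delta>" "0 \<notin> \<Delta>"
    using assms by (auto simp: \<Delta>_def mem_translate_iff)
  then have "cond_block_prob M X {i} V y = cond_block_prob M X {i} (translate \<Gamma>\<^sub>0 i) y"
    using markov sub V unfolding markov_neighborhood_def by (metis psubsetI)
  also have "y = (\<lambda>j. recentre i y (j - i))" by (simp add: recentre_def)
  also have "cond_block_prob M X {i} (translate \<Gamma>\<^sub>0 i) \<dots> = site_kernel (recentre i y)"
    using markov unfolding markov_neighborhood_def site_kernel_def by blast
  finally have "cond_block_prob M X {i} V y = site_kernel (recentre i y)" by (simp add: recentre_def)
  then show ?thesis
    using positive[OF assms(1), of y] by (simp add: cond_block_prob_eq field_simps)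
qed

text \<open>
  The law of the field is invariant under replacing the symbol at one site by a fresh draw from the
  specification (one step of the Gibbs sampler).  This is the form in which conditional
  distributions are used below.
\<close>

lemma resampling:
  assumes "finite U" "local_on U G"
  shows "mean G = mean (\<lambda>x. \<Sum>b\<in>UNIV. site_kernel (recentre i (x(i := b))) * G (x(i := b)))"
proof -
  define V where "V = (U \<union> translate \<Gamma>\<^sub>0 i) - {i}"
  have V: "finite V" "i \<notin> V" "translate \<Gamma>\<^sub>0 i \<subseteq> V"
    using assms(1) by (auto simp: V_def mem_translate_iff)
  have lG: "local_on (insert i V) G" using assms(2) by (rule local_on_mono) (auto simp: V_def)
  have lk: "local_on (insert i V) (\<lambda>x. site_kernel (recentre i x))"
    by (rule local_on_mono[OF local_on_recentre[OF site_kernel_local, of i]]) (use V in \<open>auto simp: translate_insert\<close>)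
  let ?H = "\<lambda>x. \<Sum>b\<in>UNIV. site_kernel (recentre i (x(i := b))) * G (x(i := b))"
  have "mean G = (\<Sum>y \<in> insert i V \<rightarrow>\<^sub>E UNIV. block_prob M X (insert i V) y * G y)"
    using V lG by (intro mean_local) auto
  also have "\<dots> = (\<Sum>b\<in>UNIV. \<Sum>z \<in> V \<rightarrow>\<^sub>E UNIV.
      block_prob M X (insert i V) (z(i := b)) * G (z(i := b)))"
    using V by (intro sum_PiE_insert)
  also have "\<dots> = (\<Sum>b\<in>UNIV. \<Sum>z \<in> V \<rightarrow>\<^sub>E UNIV.
      block_prob M X V z * (site_kernel (recentre i (z(i := b))) * G (z(i := b))))"
  proof (intro sum.cong refl)
    fix b and z :: "int ^ 'd \<Rightarrow> 'a"
    have "block_prob M X V (z(i := b)) = block_prob M X V z"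
      using V(2) by (intro block_prob_local) auto
    then show "block_prob M X (insert i V) (z(i := b)) * G (z(i := b)) =
        block_prob M X V z * (site_kernel (recentre i (z(i := b))) * G (z(i := b)))"
      by (simp add: block_prob_insert[OF V])
  qed
  also have "\<dots> = (\<Sum>z \<in> V \<rightarrow>\<^sub>E UNIV. block_prob M X V z * ?H z)"
    by (subst sum.swap) (simp add: sum_distrib_left)
  also have "\<dots> = mean ?H"
  proof (rule mean_local(2)[symmetric, OF V(1)], unfold local_on_def, intro allI impI sum.cong refl)
    fix x y :: "int ^ 'd \<Rightarrow> 'a" and b assume "\<forall>j\<in>V. x j = y j"
    then have *: "\<And>j. j \<in> insert i V \<Longrightarrow> (x(i := b)) j = (y(i := b)) j" by auto
    show "site_kernel (recentre i (x(i := b))) * G (x(i := b)) = site_kernel (recentre i (y(i := b))) * G (y(i := b))"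
      by (intro arg_cong2[where f = "(*)"] local_onD[OF lG] local_onD[OF lk] *)
  qed
  finally show ?thesis .
qed

text \<open>
  The block on \<open>\<Gamma>\<^sub>0\<close> has positive probability, and resampling the origin does not change whether it
  occurs.
\<close>

lemma sum_site_kernel: "(\<Sum>b\<in>UNIV. site_kernel (z(0 := b))) = 1"
proof -
  let ?I = "\<lambda>x. of_bool (\<forall>j\<in>\<Gamma>\<^sub>0. x j = z j) :: real"
  have lI: "local_on \<Gamma>\<^sub>0 ?I" by (auto simp: local_on_def intro!: arg_cong[where f = of_bool])
  have pos: "mean ?I > 0"
    using local_event(2)[of \<Gamma>\<^sub>0 "\<lambda>x. \<forall>j\<in>\<Gamma>\<^sub>0. x j = z j"] positive[of \<Gamma>\<^sub>0 z]
    by (simp add: block_prob_def) (simp add: local_on_def)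
  have "mean ?I = mean (\<lambda>x. \<Sum>b\<in>UNIV. site_kernel (recentre 0 (x(0 := b))) * ?I (x(0 := b)))"
    by (rule resampling[OF _ lI]) simp
  also have "(\<lambda>x. \<Sum>b\<in>UNIV. site_kernel (recentre 0 (x(0 := b))) * ?I (x(0 := b))) =
      (\<lambda>x. (\<Sum>b\<in>UNIV. site_kernel (z(0 := b))) * ?I x)"
  proof
    fix x :: "int ^ 'd \<Rightarrow> 'a"
    have e: "(\<forall>j\<in>\<Gamma>\<^sub>0. (x(0 := b)) j = z j) = (\<forall>j\<in>\<Gamma>\<^sub>0. x j = z j)" for b
      by (intro ball_cong refl) (metis fun_upd_other zero_notin_\<Gamma>\<^sub>0)
    have "site_kernel (recentre 0 (x(0 := b))) = site_kernel (z(0 := b))" if "\<forall>j\<in>\<Gamma>\<^sub>0. x j = z j" for b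
      by (rule local_onD[OF site_kernel_local]) (use that in \<open>auto simp: recentre_def\<close>)
    then show "(\<Sum>b\<in>UNIV. site_kernel (recentre 0 (x(0 := b))) * ?I (x(0 := b))) =
        (\<Sum>b\<in>UNIV. site_kernel (z(0 := b))) * ?I x"
      unfolding e by (auto simp: sum_distrib_right)
  qed
  finally show ?thesis using pos by (simp add: mean_cmult)
qed

text \<open>
  The specification takes finitely many values, all positive.
\<close>

lemma site_kernel_lower_bound: obtains q where "0 < q" "q \<le> 1" "\<And>y. q \<le> site_kernel y"
proof -
  let ?S = "site_kernel ` (insert 0 \<Gamma>\<^sub>0 \<rightarrow>\<^sub>E UNIV)"
  have fin: "finite ?S" by (intro finite_imageI finite_PiE) auto
  have mem: "site_kernel y \<in> ?S" for y
  proof -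
    have "site_kernel y = site_kernel (restrict y (insert 0 \<Gamma>\<^sub>0))"
      by (rule local_onD[OF site_kernel_local]) simp
    then show ?thesis by auto
  qed
  have le: "Min ?S \<le> site_kernel y" for y using fin mem by simp
  have "Min ?S \<in> ?S" using fin mem by (intro Min_in) auto
  then have pos: "Min ?S > 0" using site_kernel_pos by auto
  show ?thesis using le pos by (intro that[of "min 1 (Min ?S)"]) (auto simp: min.coboundedI2)
qed

text \<open>
  Whatever the configuration off \<open>D\<close>, the sites of \<open>D\<close> can be resampled one after the other, and each
  takes the prescribed symbol with probability at least \<open>q\<close>.
\<close>

lemma mean_pattern_lower_bound:
  assumes q: "0 \<le> q" "\<And>y. q \<le> site_kernel y"
    and "finite D" "finite V" "V \<inter> D = {}" "local_on V W" "\<And>x. 0 \<le> W x"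
  shows "q ^ card D * mean W \<le> mean (\<lambda>x. W x * of_bool (\<forall>j\<in>D. x j = w j))"
  using assms(3-)
proof (induction D rule: finite_induct)
  case empty
  then show ?case by simp
next
  case (insert i D)
  let ?I = "\<lambda>D x. of_bool (\<forall>j\<in>D. x j = w j) :: real"
  have lI: "local_on D (?I D)" for D by (auto simp: local_on_def intro!: arg_cong[where f = of_bool])
  have lW: "local_on (V \<union> D) (\<lambda>x. W x * ?I D x)"
    by (intro local_on_comp2[where f = "(*)"] local_on_mono[OF lI] local_on_mono[OF insert.prems(3)]) auto
  have lW': "local_on (V \<union> insert i D) (\<lambda>x. W x * ?I (insert i D) x)"
    by (intro local_on_comp2[where f = "(*)"] local_on_mono[OF lI] local_on_mono[OF insert.prems(3)]) auto
  \<comment> \<open>A region large enough for all functions that occur when the site \<open>i\<close> is resampled.\<close>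
  let ?U = "V \<union> insert i D \<union> translate (insert 0 \<Gamma>\<^sub>0) i"
  have eq: "(\<Sum>b\<in>UNIV. site_kernel (recentre i (x(i := b))) * (W (x(i := b)) * ?I (insert i D) (x(i := b)))) =
      site_kernel (recentre i (x(i := w i))) * (W x * ?I D x)" for x
  proof -
    have "(x(i := b)) j = x j" if "j \<in> V \<union> D" for b j using that insert.prems(2) insert.hyps(2) by auto
    then have 1: "W (x(i := b)) * ?I D (x(i := b)) = W x * ?I D x" for b
      by (rule local_onD[OF lW])
    have "(\<Sum>b\<in>UNIV. site_kernel (recentre i (x(i := b))) * (W (x(i := b)) * ?I (insert i D) (x(i := b)))) =
        (\<Sum>b\<in>UNIV. if b = w i then site_kernel (recentre i (x(i := w i))) * (W x * ?I D x) else 0)"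
    proof (rule sum.cong[OF refl])
      fix b
      have "?I (insert i D) (x(i := b)) = of_bool (b = w i) * ?I D (x(i := b))" by simp
      then have "W (x(i := b)) * ?I (insert i D) (x(i := b)) =
          of_bool (b = w i) * (W (x(i := b)) * ?I D (x(i := b)))" by (simp only: ac_simps)
      also have "\<dots> = of_bool (b = w i) * (W x * ?I D x)" unfolding 1 ..
      finally show "site_kernel (recentre i (x(i := b))) * (W (x(i := b)) * ?I (insert i D) (x(i := b))) =
          (if b = w i then site_kernel (recentre i (x(i := w i))) * (W x * ?I D x) else 0)"
        by simp
    qed
    then show ?thesis by simp
  qed
  have "q ^ card (insert i D) * mean W = q * (q ^ card D * mean W)"
    using insert.hyps by simp
  also have "\<dots> \<le> q * mean (\<lambda>x. W x * ?I D x)"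
    using insert q(1) by (intro mult_left_mono) auto
  also have "\<dots> = mean (\<lambda>x. q * (W x * ?I D x))" by (simp add: mean_cmult)
  also have "\<dots> \<le> mean (\<lambda>x. site_kernel (recentre i (x(i := w i))) * (W x * ?I D x))"
  proof (rule mean_mono[of ?U])
    show "finite ?U" using insert by simp
    show "local_on ?U (\<lambda>x. q * (W x * ?I D x))"
      by (rule local_on_comp, rule local_on_mono[OF lW]) auto
    have "local_on ?U (\<lambda>x. site_kernel (recentre i (x(i := w i))))"
      unfolding local_on_def
    proof (intro allI impI local_onD[OF local_on_recentre[OF site_kernel_local, of i]])
      fix x y :: "int ^ 'd \<Rightarrow> 'a" and j
      assume "\<forall>j\<in>?U. x j = y j" "j \<in> translate (insert 0 \<Gamma>\<^sub>0) i"
      then show "(x(i := w i)) j = (y(i := w i)) j" by auto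
    qed
    then show "local_on ?U (\<lambda>x. site_kernel (recentre i (x(i := w i))) * (W x * ?I D x))"
      by (intro local_on_comp2[where f = "(*)"] local_on_mono[OF lW]) auto
    show "q * (W x * ?I D x) \<le> site_kernel (recentre i (x(i := w i))) * (W x * ?I D x)" for x
      using insert.prems(4) q(2) by (intro mult_right_mono) auto
  qed
  also have "\<dots> = mean (\<lambda>x. W x * ?I (insert i D) x)"
    using resampling[OF _ lW', of i] insert.prems(1) insert.hyps(1) unfolding eq by simp
  finally show ?case .
qed

end

section \<open>A maximal inequality along separated sites\<close>

lemma exp_le_quadratic:
  fixes x :: real
  assumes "\<bar>x\<bar> \<le> 1"
  shows "exp x \<le> 1 + x + x\<^sup>2"
proof (cases "0 \<le> x")
  case True
  then show ?thesis using exp_bound assms by simp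
next
  case False
  define y where "y = - x"
  have y: "0 \<le> y" "y \<le> 1" using False assms by (auto simp: y_def)
  have "1 \<le> 1 + y ^ 3" using y by simp
  also have "\<dots> = (1 - y + y\<^sup>2) * (1 + y)" by (simp add: algebra_simps power2_eq_square power3_eq_cube)
  also have "\<dots> \<le> (1 - y + y\<^sup>2) * exp y"
    using y exp_ge_add_one_self[of y] by (intro mult_left_mono) auto
  finally have "exp (- y) \<le> 1 - y + y\<^sup>2" by (simp add: exp_minus field_simps)
  then show ?thesis by (simp add: y_def)
qed

text \<open>
  The compensator \<open>l\<^sup>2 * g\<close> absorbs the quadratic term of the exponential, so that only a term linear
  in the increment \<open>f\<close> is left; its mean is not positive in the situation below.
\<close>

lemma exp_increment_le:
  fixes f g l :: real
  assumes "0 < l" "l \<le> 1" "g = 0 \<or> g = 1" "\<bar>f\<bar> \<le> g"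
  shows "exp (l * f - l\<^sup>2 * g) \<le> 1 + l * exp (- l\<^sup>2) * f"
proof (cases "g = 0")
  case True
  then show ?thesis using assms by simp
next
  case False
  then have g: "g = 1" "\<bar>f\<bar> \<le> 1" using assms by auto
  have "\<bar>l * f\<bar> \<le> 1 * 1"
    unfolding abs_mult using assms g by (intro mult_mono) auto
  then have "exp (l * f) \<le> 1 + l * f + (l * f)\<^sup>2" by (intro exp_le_quadratic) simp
  moreover have "(l * f)\<^sup>2 \<le> l\<^sup>2"
    using g assms(1) by (simp add: power_mult_distrib abs_square_le_1 mult_left_le)
  moreover have "1 + l\<^sup>2 \<le> exp (l\<^sup>2)" by (rule exp_ge_add_one_self)
  ultimately have "exp (l * f) \<le> exp (l\<^sup>2) + l * f" by linarith
  then have "exp (l * f) * exp (- l\<^sup>2) \<le> (exp (l\<^sup>2) + l * f) * exp (- l\<^sup>2)"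
    by (intro mult_right_mono) auto
  then show ?thesis
    using g by (simp add: exp_diff exp_minus field_simps)
qed

context finite_valued_field
begin

text \<open>
  The statistic \<open>f\<close>, evaluated around any site \<open>i\<close>, has nonpositive conditional expectation given all
  symbols outside the translate of \<open>D\<close>: the nonnegative weight \<open>W\<close> stands for the conditioning.
\<close>

definition unfavourable :: "(int ^ 'd) set \<Rightarrow> ((int ^ 'd \<Rightarrow> 'a) \<Rightarrow> real) \<Rightarrow> bool" where
  "unfavourable D f \<longleftrightarrow> (\<forall>i V W. finite V \<longrightarrow> V \<inter> translate D i = {} \<longrightarrow> local_on V W \<longrightarrow>
     (\<forall>x. 0 \<le> W x) \<longrightarrow> mean (\<lambda>x. W x * f (recentre i x)) \<le> 0)"

lemma unfavourableD:
  "unfavourable D f \<Longrightarrow> finite V \<Longrightarrow> V \<inter> translate D i = {} \<Longrightarrow> local_on V W \<Longrightarrow> (\<And>x. 0 \<le> W x) \<Longrightarrow>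
    mean (\<lambda>x. W x * f (recentre i x)) \<le> 0"
  by (simp add: unfavourable_def)

end

text \<open>
  Here \<open>g\<close> indicates that a site counts as a visit, \<open>f\<close> is the increment scored at a visit, \<open>S\<close> is the
  window that both may inspect, and \<open>D\<close> is the part of it that is random given the context.
\<close>

locale bounded_statistic = finite_valued_field M X
  for M :: "'w measure" and X :: "int ^ 'd \<Rightarrow> 'w \<Rightarrow> 'a::finite" +
  fixes S D :: "(int ^ 'd) set" and f g :: "(int ^ 'd \<Rightarrow> 'a) \<Rightarrow> real"
  assumes finite_S: "finite S" and D_sub: "D \<subseteq> S"
    and local_f: "local_on S f" and local_g: "local_on S g"
    and g_01: "\<And>x. g x = 0 \<or> g x = 1" and f_le: "\<And>x. \<bar>f x\<bar> \<le> g x"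
    and unfav: "unfavourable D f"
begin

definition total :: "(int ^ 'd) set \<Rightarrow> (int ^ 'd \<Rightarrow> 'a) \<Rightarrow> real" where
  "total T x = (\<Sum>i\<in>T. f (recentre i x))"

definition visits :: "(int ^ 'd) set \<Rightarrow> (int ^ 'd \<Rightarrow> 'a) \<Rightarrow> real" where
  "visits T x = (\<Sum>i\<in>T. g (recentre i x))"

definition exp_process :: "real \<Rightarrow> (int ^ 'd) set \<Rightarrow> (int ^ 'd \<Rightarrow> 'a) \<Rightarrow> real" where
  "exp_process l T x = exp (l * total T x - l\<^sup>2 * visits T x)"

definition separated :: "(int ^ 'd) set \<Rightarrow> bool" where
  "separated T \<longleftrightarrow> (\<forall>i\<in>T. \<forall>i'\<in>T. i \<noteq> i' \<longrightarrow> translate S i \<inter> translate S i' = {})"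

definition footprint :: "(int ^ 'd) set \<Rightarrow> (int ^ 'd) set" where
  "footprint T = (\<Union>i\<in>T. translate S i)"

lemma finite_footprint: "finite T \<Longrightarrow> finite (footprint T)"
  by (simp add: footprint_def finite_S)

lemma footprint_mono: "T \<subseteq> T' \<Longrightarrow> footprint T \<subseteq> footprint T'"
  by (auto simp: footprint_def)

lemma total_local: "local_on (footprint T) (total T)"
  unfolding total_def[abs_def]
  by (intro local_on_sum local_on_mono[OF local_on_recentre[OF local_f]]) (auto simp: footprint_def)

lemma visits_local: "local_on (footprint T) (visits T)"
  unfolding visits_def[abs_def]
  by (intro local_on_sum local_on_mono[OF local_on_recentre[OF local_g]]) (auto simp: footprint_def)

lemma exp_process_local: "local_on (footprint T) (exp_process l T)"
  unfolding exp_process_def[abs_def]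
  by (rule local_on_exp[OF local_on_diff[OF local_on_cmult[OF total_local] local_on_cmult[OF visits_local]]])

lemma exp_process_pos: "exp_process l T x > 0" by (simp add: exp_process_def)

lemma exp_process_insert:
  "finite T \<Longrightarrow> i \<notin> T \<Longrightarrow>
    exp_process l (insert i T) x = exp_process l T x * exp (l * f (recentre i x) - l\<^sup>2 * g (recentre i x))"
  by (simp add: exp_process_def total_def visits_def exp_add[symmetric] algebra_simps)

text \<open>
  The exponential process is a supermartingale when separated sites are added: the factors
  already present do not look at the random part of the window of a new site.
\<close>

lemma mean_exp_process_step:
  assumes l: "0 < l" "l \<le> 1"
    and "finite T'" "finite T" "T \<inter> T' = {}" "separated (T \<union> T')"
    and "local_on (footprint T) W" "\<And>x. 0 \<le> W x"
  shows "mean (\<lambda>x. W x * exp_process l T' x) \<le> mean W"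
  using assms(3-)
proof (induction T' rule: finite_induct)
  case empty
  then show ?case by (simp add: exp_process_def total_def visits_def)
next
  case (insert i T')
  let ?V = "footprint (T \<union> T')" and ?V' = "footprint (insert i (T \<union> T'))"
  have fin: "finite ?V" "finite ?V'" using insert.hyps(1) insert.prems(1) by (simp_all add: finite_footprint)
  define U where "U = (\<lambda>x. W x * exp_process l T' x)"
  have U0: "0 \<le> U x" for x by (simp add: U_def insert.prems(5) exp_process_pos less_imp_le)
  have lU: "local_on ?V U"
    unfolding U_def
    by (rule local_on_mult[OF local_on_mono[OF insert.prems(4) footprint_mono]
        local_on_mono[OF exp_process_local footprint_mono]]) auto
  have lU': "local_on ?V' U" by (rule local_on_mono[OF lU footprint_mono]) auto
  have lf: "local_on ?V' (\<lambda>x. f (recentre i x))"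
    by (rule local_on_mono[OF local_on_recentre[OF local_f, of i]]) (auto simp: footprint_def)
  have lg: "local_on ?V' (\<lambda>x. g (recentre i x))"
    by (rule local_on_mono[OF local_on_recentre[OF local_g, of i]]) (auto simp: footprint_def)
  have disj: "?V \<inter> translate D i = {}"
  proof -
    have "translate S i' \<inter> translate S i = {}" if "i' \<in> T \<union> T'" for i'
    proof -
      have "i' \<noteq> i" using insert.prems(2) insert.hyps(2) that by auto
      then show ?thesis using insert.prems(3) that by (simp add: separated_def)
    qed
    then have "?V \<inter> translate S i = {}" by (auto simp: footprint_def)
    then show ?thesis using translate_mono[OF D_sub, of i] by auto
  qed
  have "mean (\<lambda>x. W x * exp_process l (insert i T') x) =
      mean (\<lambda>x. U x * exp (l * f (recentre i x) - l\<^sup>2 * g (recentre i x)))"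
    using insert.hyps by (simp add: exp_process_insert U_def mult.assoc)
  also have "\<dots> \<le> mean (\<lambda>x. U x + l * exp (- l\<^sup>2) * (U x * f (recentre i x)))"
  proof (rule mean_mono[OF fin(2)])
    show "local_on ?V' (\<lambda>x. U x * exp (l * f (recentre i x) - l\<^sup>2 * g (recentre i x)))"
      by (rule local_on_mult[OF lU' local_on_exp[OF local_on_diff[OF local_on_cmult[OF lf] local_on_cmult[OF lg]]]])
    show "local_on ?V' (\<lambda>x. U x + l * exp (- l\<^sup>2) * (U x * f (recentre i x)))"
      by (rule local_on_add[OF lU' local_on_cmult[OF local_on_mult[OF lU' lf]]])
    fix x
    have "U x * exp (l * f (recentre i x) - l\<^sup>2 * g (recentre i x)) \<le> U x * (1 + l * exp (- l\<^sup>2) * f (recentre i x))"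
      by (intro mult_left_mono exp_increment_le l g_01 f_le U0)
    then show "U x * exp (l * f (recentre i x) - l\<^sup>2 * g (recentre i x)) \<le> U x + l * exp (- l\<^sup>2) * (U x * f (recentre i x))"
      by (simp add: algebra_simps)
  qed
  also have "\<dots> = mean U + l * exp (- l\<^sup>2) * mean (\<lambda>x. U x * f (recentre i x))"
    by (subst mean_add[OF fin(2) lU' local_on_cmult[OF local_on_mult[OF lU' lf]]]) (simp add: mean_cmult)
  also have "\<dots> \<le> mean U"
  proof -
    have "mean (\<lambda>x. U x * f (recentre i x)) \<le> 0"
      by (rule unfavourableD[OF unfav fin(1) disj lU U0])
    then show ?thesis using l by (simp add: mult_nonneg_nonpos)
  qed
  also have "\<dots> \<le> mean W"
    unfolding U_def
    by (rule insert.IH) (use insert.prems in \<open>simp_all add: separated_def\<close>)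
  finally show ?case .
qed

text \<open>
  Ville's inequality for the supermartingale.  By induction on \<open>n\<close>, the quantity
  \<open>K * prob (A n)\<close> plus the mean of the process off \<open>A n\<close> stays at most \<open>1\<close>, where \<open>A n\<close> is the event
  that the level \<open>K\<close> has been reached by time \<open>n\<close>: whatever newly enters \<open>A (Suc n)\<close> has a process
  value of at least \<open>K\<close>.
\<close>

lemma ville:
  fixes T :: "nat \<Rightarrow> (int ^ 'd) set"
  assumes l: "0 < l" "l \<le> 1"
    and T: "\<And>n. finite (T n)" "mono T" "\<And>n. separated (T n)"
  shows "{\<omega> \<in> space M. \<exists>n\<le>N. t \<le> l * total (T n) (realization \<omega>) - l\<^sup>2 * visits (T n) (realization \<omega>)} \<in> sets M"
    and "prob {\<omega> \<in> space M. \<exists>n\<le>N. t \<le> l * total (T n) (realization \<omega>) - l\<^sup>2 * visits (T n) (realization \<omega>)}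
    \<le> exp (- t)"
proof -
  define K where "K = exp t"
  define A where "A n x \<longleftrightarrow> (\<exists>m\<le>n. K \<le> exp_process l (T m) x)" for n x
  have Tm: "T m \<subseteq> T n" if "m \<le> n" for m n using T(2) that by (simp add: monoD)
  have lA: "local_on (footprint (T n)) (A n)" for n
    unfolding local_on_def A_def
  proof (intro allI impI ex_cong1 conj_cong refl)
    fix x y :: "int ^ 'd \<Rightarrow> 'a" and m assume xy: "\<forall>j\<in>footprint (T n). x j = y j" and "m \<le> n"
    have "exp_process l (T m) x = exp_process l (T m) y"
      by (rule local_onD[OF exp_process_local]) (use xy footprint_mono[OF Tm[OF \<open>m \<le> n\<close>]] in auto)
    then show "(K \<le> exp_process l (T m) x) = (K \<le> exp_process l (T m) y)" by simp
  qed
  \<comment> \<open>The process stopped at level \<open>K\<close>, with the overshoot cut off.\<close>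
  define G where "G n x = (if A n x then K else exp_process l (T n) x)" for n x
  have lG: "local_on (footprint (T n)) (G n)" for n
    unfolding G_def[abs_def] by (intro local_on_if lA local_on_const exp_process_local)
  have "mean (G n) \<le> 1" for n
  proof (induction n)
    case 0
    have "mean (G 0) \<le> mean (exp_process l (T 0))"
      by (rule mean_mono[OF finite_footprint[OF T(1)] lG exp_process_local]) (simp add: G_def A_def)
    also have "\<dots> = mean (\<lambda>x. 1 * exp_process l (T 0) x)" by simp
    also have "\<dots> \<le> mean (\<lambda>x. 1)"
      by (rule mean_exp_process_step[where T = "{}"]) (use l T in \<open>auto intro: local_on_const\<close>)
    finally show ?case by simp
  next
    case (Suc n)
    let ?V = "footprint (T (Suc n))" and ?T' = "T (Suc n) - T n"
    have sub: "footprint (T n) \<subseteq> ?V" by (intro footprint_mono Tm) simp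
    have finV: "finite ?V" using T finite_footprint by blast
    have lAn: "local_on ?V (A n)" by (rule local_on_mono[OF lA sub])
    have lW: "local_on (footprint (T n)) (\<lambda>x. of_bool (\<not> A n x) * exp_process l (T n) x)"
      by (rule local_on_mult[OF local_on_comp[OF lA] exp_process_local])
    have mult: "exp_process l (T (Suc n)) x = exp_process l (T n) x * exp_process l ?T' x" for x
    proof -
      have T': "T (Suc n) = T n \<union> ?T'" using Tm[of n "Suc n"] by auto
      have "sum h (T (Suc n)) = sum h (T n) + sum h ?T'" for h :: "int ^ 'd \<Rightarrow> real"
        by (subst T', rule sum.union_disjoint) (use T in auto)
      then show ?thesis by (simp add: exp_process_def total_def visits_def exp_add[symmetric] algebra_simps)
    qed
    have le: "G (Suc n) x \<le> K * of_bool (A n x) + of_bool (\<not> A n x) * exp_process l (T n) x * exp_process l ?T' x" for x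
    proof -
      have "A (Suc n) x \<longleftrightarrow> A n x \<or> K \<le> exp_process l (T (Suc n)) x"
        unfolding A_def by (auto simp: le_Suc_eq)
      then show ?thesis unfolding G_def mult by (cases "A n x") auto
    qed
    have lR: "local_on ?V (\<lambda>x. of_bool (\<not> A n x) * exp_process l (T n) x * exp_process l ?T' x)"
      by (rule local_on_mult[OF local_on_mono[OF lW sub] local_on_mono[OF exp_process_local footprint_mono]]) auto
    have lK: "local_on ?V (\<lambda>x. K * of_bool (A n x))"
      by (rule local_on_comp[OF lAn])
    have "mean (G (Suc n)) \<le> mean (\<lambda>x. K * of_bool (A n x) + of_bool (\<not> A n x) * exp_process l (T n) x * exp_process l ?T' x)"
      by (rule mean_mono[OF finV lG _ le]) (rule local_on_add[OF lK lR])
    also have "\<dots> = mean (\<lambda>x. K * of_bool (A n x)) + mean (\<lambda>x. of_bool (\<not> A n x) * exp_process l (T n) x * exp_process l ?T' x)"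
      by (rule mean_add[OF finV lK lR])
    also have "\<dots> \<le> mean (\<lambda>x. K * of_bool (A n x)) + mean (\<lambda>x. of_bool (\<not> A n x) * exp_process l (T n) x)"
    proof (intro add_left_mono mean_exp_process_step[OF l, where T = "T n"] lW)
      have "T n \<union> ?T' = T (Suc n)" using Tm[of n "Suc n"] by auto
      then show "separated (T n \<union> ?T')" using T by simp
    qed (use T in \<open>auto simp: exp_process_pos less_imp_le\<close>)
    also have "\<dots> = mean (\<lambda>x. K * of_bool (A n x) + of_bool (\<not> A n x) * exp_process l (T n) x)"
      by (rule mean_add[symmetric, OF finV lK local_on_mono[OF lW sub]])
    also have "(\<lambda>x. K * of_bool (A n x) + of_bool (\<not> A n x) * exp_process l (T n) x) = G n"
      by (auto simp: G_def fun_eq_iff)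
    also note Suc
    finally show ?case .
  qed
  note G1 = this[of N]
  have "K * mean (\<lambda>x. of_bool (A N x)) = mean (\<lambda>x. K * of_bool (A N x))" by (simp add: mean_cmult)
  also have "\<dots> \<le> mean (G N)"
    by (rule mean_mono[OF finite_footprint[OF T(1)] local_on_comp[OF lA] lG])
      (simp add: G_def exp_process_pos less_imp_le)
  finally have "K * mean (\<lambda>x. of_bool (A N x)) \<le> 1" using G1 by simp
  then have "mean (\<lambda>x. of_bool (A N x)) \<le> exp (- t)"
    by (simp add: K_def exp_minus field_simps)
  moreover have "prob {\<omega> \<in> space M. A N (realization \<omega>)} = mean (\<lambda>x. of_bool (A N x))"
    by (rule local_event(2)[OF finite_footprint[OF T(1)[of N]] lA])
  moreover have "{\<omega> \<in> space M. A N (realization \<omega>)} =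
      {\<omega> \<in> space M. \<exists>n\<le>N. t \<le> l * total (T n) (realization \<omega>) - l\<^sup>2 * visits (T n) (realization \<omega>)}"
      (is "?L = ?R")
    by (simp add: A_def K_def exp_process_def)
  moreover have "?L \<in> sets M"
    by (rule local_event(1)[OF finite_footprint[OF T(1)[of N]] lA])
  ultimately show "?R \<in> sets M" "prob ?R \<le> exp (- t)"
    by (simp_all only:)
qed

end

section \<open>Deviation bounds uniform in the sample size\<close>

text \<open>
  The best slope in \<open>l * s \<le> \<tau> + l\<^sup>2 * v\<close> is \<open>sqrt (\<tau> / v)\<close>, which is not known in advance.  A dyadic
  slope within a factor \<open>2\<close> of it gives \<open>2 * sqrt (\<tau> * v) + sqrt (\<tau> * v)\<close>.
\<close>

lemma sqrt_bound_from_dyadic_linear_bounds: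
  fixes s v \<tau> :: real
  assumes \<tau>: "1 \<le> \<tau>" and v: "0 \<le> v" "v \<le> 4 ^ J" and s: "s \<le> v"
    and lin: "\<And>j. j \<le> J \<Longrightarrow> s / 2 ^ j \<le> \<tau> + v / 4 ^ j"
  shows "s \<le> 3 * sqrt (\<tau> * v)"
proof (cases "v \<le> \<tau>")
  case True
  have "v * v \<le> \<tau> * v" using True v by (intro mult_right_mono) auto
  then have "v \<le> sqrt (\<tau> * v)" using v by (intro real_le_rsqrt) (simp add: power2_eq_square)
  moreover have "0 \<le> sqrt (\<tau> * v)" using \<tau> v by simp
  ultimately show ?thesis using s by linarith
next
  case False
  \<comment> \<open>The reciprocal of the optimal slope; \<open>2 ^ j\<close> is the least power of two above it.\<close>
  define y where "y = sqrt (v / \<tau>)"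
  have y1: "1 \<le> y" using False \<tau> by (simp add: y_def)
  have "v / \<tau> \<le> v" using \<tau> v by (simp add: divide_le_eq mult_left_le_one_le mult_le_cancel_left1)
  then have "y \<le> sqrt v" by (simp add: y_def)
  also have "\<dots> \<le> sqrt ((2 ^ J)\<^sup>2)"
    using v(2) by (intro real_sqrt_le_mono) (simp add: power_mult_distrib flip: power_mult power2_eq_square, simp add: power_mult mult.commute[of J])
  finally have yJ: "y \<le> 2 ^ J" by simp
  define j where "j = (LEAST j. y \<le> 2 ^ j)"
  have yj: "y \<le> 2 ^ j" unfolding j_def using yJ by (rule LeastI)
  have jJ: "j \<le> J" unfolding j_def using yJ by (rule Least_le)
  have j2: "2 ^ j \<le> 2 * y"
  proof (cases j)
    case 0
    then show ?thesis using y1 by simp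
  next
    case (Suc m)
    then have "\<not> y \<le> 2 ^ m" unfolding j_def using not_less_Least[of m "\<lambda>j. y \<le> 2 ^ j"] by simp
    then show ?thesis using Suc by simp
  qed
  have sq: "y * \<tau> = sqrt (\<tau> * v)" "v / y = sqrt (\<tau> * v)"
    using \<tau> v False by (auto simp: y_def real_sqrt_divide real_sqrt_mult field_simps)
  have four: "(4::real) ^ j = 2 ^ j * 2 ^ j" by (simp flip: power_mult_distrib)
  have "s = (s / 2 ^ j) * 2 ^ j" by simp
  also have "\<dots> \<le> (\<tau> + v / 4 ^ j) * 2 ^ j" using lin[OF jJ] by (intro mult_right_mono) auto
  also have "\<dots> = 2 ^ j * \<tau> + v / 2 ^ j" by (simp add: four field_simps)
  also have "\<dots> \<le> (2 * y) * \<tau> + v / y"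
    using j2 yj y1 \<tau> v by (intro add_mono mult_right_mono divide_left_mono) auto
  also have "\<dots> = 3 * sqrt (\<tau> * v)" using sq by simp
  finally show ?thesis .
qed

context bounded_statistic
begin

lemma visits_nonneg: "0 \<le> visits T x"
  unfolding visits_def using g_01 by (intro sum_nonneg) (metis order_refl zero_le_one)

lemma total_le_visits: "total T x \<le> visits T x"
  unfolding visits_def total_def using f_le by (intro sum_mono) (simp add: abs_le_iff)

text \<open>
  Ville's inequality is applied to each residue class and each dyadic slope.  Since the linear
  inequalities add up over the classes, \<open>\<tau>\<close> is the number of classes times \<open>t\<close>.
\<close>

lemma uniform_deviation:
  fixes T :: "nat \<Rightarrow> (int ^ 'd) set" and J N R :: nat and t :: real
  defines "\<tau> \<equiv> real ((2 * R + 1) ^ CARD('d)) * t"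
  assumes S: "S \<subseteq> cube R" and t: "1 \<le> \<tau>"
    and T: "\<And>n. finite (T n)" "mono T"
  shows "\<exists>E \<in> sets M. prob E \<le> real (J + 1) * real ((2 * R + 1) ^ CARD('d)) * exp (- t) \<and>
    (\<forall>\<omega> \<in> space M - E. \<forall>n\<le>N. visits (T n) (realization \<omega>) \<le> 4 ^ J \<longrightarrow>
      total (T n) (realization \<omega>) \<le> 3 * sqrt (\<tau> * visits (T n) (realization \<omega>)))"
proof -
  let ?res = "residue (2 * int R + 1) :: int ^ 'd \<Rightarrow> int ^ 'd"
  define B where "B = (2 * R + 1) ^ CARD('d)"
  have \<tau>: "\<tau> = real B * t" by (simp add: \<tau>_def B_def)
  have "B > 0" by (simp add: B_def)
  then have t0: "t > 0" using t unfolding \<tau> by (smt (verit) mult_nonneg_nonpos of_nat_0_le_iff)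
  have fin_res: "finite (range ?res)" by (rule residue_range) simp
  have "card (range ?res) \<le> nat (2 * int R + 1) ^ CARD('d)" by (rule residue_range) simp
  then have card_res: "card (range ?res) \<le> B" by (simp add: B_def nat_add_distrib nat_mult_distrib)
  define C where "C c n = T n \<inter> {i. ?res i = c}" for c n
  have C: "finite (C c n)" "mono (C c)" "separated (C c n)" for c n
  proof -
    show "finite (C c n)" using T by (simp add: C_def)
    show "mono (C c)" using T(2) by (auto simp: mono_def C_def)
    show "separated (C c n)"
      unfolding separated_def
    proof (intro ballI impI)
      fix i i' assume "i \<in> C c n" "i' \<in> C c n" "i \<noteq> i'"
      then have "translate (cube R) i \<inter> translate (cube R) i' = {}"
        by (intro residue_class_separated) (auto simp: C_def)
      then show "translate S i \<inter> translate S i' = {}"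
        using translate_mono[OF S, of i] translate_mono[OF S, of i'] by blast
    qed
  qed
  define E where "E j c = {\<omega> \<in> space M. \<exists>n\<le>N. t \<le> (1 / 2 ^ j) * total (C c n) (realization \<omega>)
      - (1 / 2 ^ j)\<^sup>2 * visits (C c n) (realization \<omega>)}" for j :: nat and c
  have E: "E j c \<in> sets M" "prob (E j c) \<le> exp (- t)" for j c
    unfolding E_def by (rule ville; use C in simp)+
  define F where "F = (\<Union>p \<in> {..J} \<times> range ?res. E (fst p) (snd p))"
  have F: "F \<in> sets M" unfolding F_def using fin_res E by (intro sets.finite_UN) auto
  have "prob F \<le> (\<Sum>p \<in> {..J} \<times> range ?res. prob (E (fst p) (snd p)))"
    unfolding F_def using fin_res E by (intro finite_measure_subadditive_finite) auto
  also have "\<dots> \<le> (\<Sum>p \<in> {..J} \<times> range ?res. exp (- t))" using E by (intro sum_mono) auto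
  also have "\<dots> = real (J + 1) * real (card (range ?res)) * exp (- t)" by (simp add: card_cartesian_product algebra_simps)
  also have "\<dots> \<le> real (J + 1) * real B * exp (- t)" using card_res by (intro mult_mono) auto
  finally have prob_F: "prob F \<le> real (J + 1) * real B * exp (- t)" .
  have "total (T n) (realization \<omega>) \<le> 3 * sqrt (\<tau> * visits (T n) (realization \<omega>))"
    if \<omega>: "\<omega> \<in> space M - F" and n: "n \<le> N" and v: "visits (T n) (realization \<omega>) \<le> 4 ^ J" for \<omega> n
  proof (rule sqrt_bound_from_dyadic_linear_bounds[OF t visits_nonneg v total_le_visits])
    fix j :: nat assume j: "j \<le> J"
    let ?x = "realization \<omega>"
    have split: "(\<Sum>c \<in> range ?res. \<Sum>i \<in> C c n. h i) = (\<Sum>i \<in> T n. h i)" for h :: "int ^ 'd \<Rightarrow> real"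
    proof -
      have "C c n = {i \<in> T n. ?res i = c}" for c by (auto simp: C_def)
      then show ?thesis
        using sum.group[OF T(1)[of n] fin_res image_mono[OF subset_UNIV], of h] by simp
    qed
    have "total (T n) ?x / 2 ^ j - visits (T n) ?x / 4 ^ j =
        (\<Sum>c \<in> range ?res. (1 / 2 ^ j) * total (C c n) ?x - (1 / 2 ^ j)\<^sup>2 * visits (C c n) ?x)"
      by (simp add: sum_subtractf total_def visits_def split power_divide power2_eq_square
          flip: sum_divide_distrib power_mult_distrib)
    also have "\<dots> \<le> (\<Sum>c \<in> range ?res. t)"
    proof (rule sum_mono)
      fix c assume "c \<in> range ?res"
      then have "\<omega> \<notin> E j c" using \<omega> j unfolding F_def by force
      then show "(1 / 2 ^ j) * total (C c n) ?x - (1 / 2 ^ j)\<^sup>2 * visits (C c n) ?x \<le> t"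
        using \<omega> n unfolding E_def by (fastforce simp: not_le intro: less_imp_le)
    qed
    also have "\<dots> \<le> \<tau>" using card_res t0 by (simp add: \<tau> mult_right_mono)
    finally show "total (T n) ?x / 2 ^ j \<le> \<tau> + visits (T n) ?x / 4 ^ j" by simp
  qed
  then show ?thesis using F prob_F by (intro bexI[of _ F]) (auto simp: B_def)
qed

end

section \<open>Typical realizations\<close>

definition matches :: "(int ^ 'd) set \<Rightarrow> (int ^ 'd \<Rightarrow> 'a) \<Rightarrow> (int ^ 'd \<Rightarrow> 'a) \<Rightarrow> real" where
  "matches V y x = of_bool (\<forall>j\<in>V. x j = y j)"

definition occurrences :: "(int ^ 'd) set \<Rightarrow> (int ^ 'd) set \<Rightarrow> (int ^ 'd \<Rightarrow> 'a) \<Rightarrow> (int ^ 'd \<Rightarrow> 'a) \<Rightarrow> real" where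
  "occurrences T V y x = (\<Sum>i\<in>T. matches V y (recentre i x))"

lemma matches_01: "matches V y x = 0 \<or> matches V y x = 1"
  by (cases "\<forall>j\<in>V. x j = y j") (auto simp: matches_def)

lemma matches_local: "local_on V (matches V y)"
  by (auto simp: local_on_def matches_def)

lemma matches_Un: "matches (V \<union> V') y x = matches V y x * matches V' y x"
  by (auto simp: matches_def)

lemma matches_insert: "matches (insert i V) y x = matches V y x * of_bool (x i = y i)"
  by (auto simp: matches_def)

lemma matches_cong: "(\<And>j. j \<in> V \<Longrightarrow> y j = y' j) \<Longrightarrow> matches V y = matches V y'"
  by (auto simp: matches_def fun_eq_iff)

lemma occurrences_cong: "(\<And>j. j \<in> V \<Longrightarrow> y j = y' j) \<Longrightarrow> occurrences T V y x = occurrences T V y' x"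
  unfolding occurrences_def using matches_cong[of V y y'] by simp

lemma occurrences_nonneg: "0 \<le> occurrences T V y x"
  by (simp add: occurrences_def sum_nonneg matches_def)

lemma occurrences_le_card: "finite T \<Longrightarrow> occurrences T V y x \<le> real (card T)"
  unfolding occurrences_def using sum_bounded_above[of T "\<lambda>i. matches V y (recentre i x)" 1]
  by (simp add: matches_def)

lemma recentre_fun_upd: "recentre i (x(i := b)) = (recentre i x)(0 := b)"
  by (auto simp: recentre_def fun_eq_iff)

lemma (in prob_space) exceptional_event_Union:
  assumes "finite P" "\<And>p. p \<in> P \<Longrightarrow> \<exists>E\<in>sets M. prob E \<le> c \<and> (\<forall>\<omega>\<in>space M - E. Q p \<omega>)"
  shows "\<exists>E\<in>sets M. prob E \<le> real (card P) * c \<and> (\<forall>\<omega>\<in>space M - E. \<forall>p\<in>P. Q p \<omega>)"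
proof -
  obtain E where E: "\<And>p. p \<in> P \<Longrightarrow> E p \<in> sets M \<and> prob (E p) \<le> c \<and> (\<forall>\<omega>\<in>space M - E p. Q p \<omega>)"
    using assms(2) by metis
  have "prob (\<Union>p\<in>P. E p) \<le> (\<Sum>p\<in>P. prob (E p))"
    using assms(1) E by (intro finite_measure_subadditive_finite) auto
  also have "\<dots> \<le> real (card P) * c" using E sum_bounded_above[of P "\<lambda>p. prob (E p)" c] by simp
  finally show ?thesis
    using assms(1) E by (intro bexI[of _ "\<Union>p\<in>P. E p"]) (auto intro: sets.finite_UN)
qed

context positive_markov_field
begin

text \<open>
  A visit is an occurrence of the context on \<open>\<Gamma>\<close>; its score compares the indicator of the symbol at
  the centre with its conditional probability, with either sign \<open>s\<close>.
\<close>

lemma transition_statistic: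
  assumes \<Gamma>: "\<Gamma>\<^sub>0 \<subseteq> \<Gamma>" "0 \<notin> \<Gamma>" "finite \<Gamma>" and s: "\<bar>s\<bar> = 1"
  shows "bounded_statistic M X (insert 0 \<Gamma>) {0}
    (\<lambda>x. s * (matches (insert 0 \<Gamma>) y x - site_kernel y * matches \<Gamma> y x)) (matches \<Gamma> y)"
    (is "bounded_statistic M X _ _ ?f _")
proof
  show "finite (insert 0 \<Gamma>)" using \<Gamma> by simp
  show l: "local_on (insert 0 \<Gamma>) ?f"
    by (intro local_on_cmult local_on_diff matches_local local_on_mono[OF matches_local]) auto
  show "local_on (insert 0 \<Gamma>) (matches \<Gamma> y)" by (rule local_on_mono[OF matches_local]) auto
  fix x
  show "matches \<Gamma> y x = 0 \<or> matches \<Gamma> y x = 1" by (rule matches_01)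
  have "site_kernel y \<le> (\<Sum>b\<in>UNIV. site_kernel (y(0 := b)))"
    using member_le_sum[of "y 0" UNIV "\<lambda>b. site_kernel (y(0 := b))"] site_kernel_pos by (simp add: less_imp_le)
  then have k: "site_kernel y \<le> 1" by (simp add: sum_site_kernel)
  show "\<bar>?f x\<bar> \<le> matches \<Gamma> y x"
    using s k site_kernel_pos[of y] by (auto simp: abs_mult matches_insert) (auto simp: matches_def)
next
  show "unfavourable {0} ?f"
    unfolding unfavourable_def
  proof (intro allI impI)
    fix i :: "int ^ 'd" and V and W :: "(int ^ 'd \<Rightarrow> 'a) \<Rightarrow> real"
    assume V: "finite V" "V \<inter> translate {0} i = {}" "local_on V W"
    have iV: "i \<notin> V" using V(2) by (auto simp: translate_def)
    let ?U = "V \<union> translate (insert 0 \<Gamma>) i"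
    let ?G = "\<lambda>x. W x * ?f (recentre i x)"
    have l: "local_on (insert 0 \<Gamma>) ?f"
      by (intro local_on_cmult local_on_diff matches_local local_on_mono[OF matches_local]) auto
    have lG: "local_on ?U ?G"
      by (rule local_on_mult[OF local_on_mono[OF V(3)] local_on_mono[OF local_on_recentre[OF l]]]) auto
    have "(\<Sum>b\<in>UNIV. site_kernel (recentre i (x(i := b))) * ?G (x(i := b))) = 0" for x
    proof -
      define z where "z = recentre i x"
      have W: "W (x(i := b)) = W x" for b by (rule local_onD[OF V(3)]) (use iV in auto)
      have m: "matches \<Gamma> y (z(0 := b)) = matches \<Gamma> y z" for b
        by (rule local_onD[OF matches_local]) (use \<Gamma> in auto)
      have k: "matches \<Gamma> y z * site_kernel (z(0 := y 0)) = matches \<Gamma> y z * site_kernel y"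
      proof (cases "\<forall>j\<in>\<Gamma>. z j = y j")
        case True
        have "site_kernel (z(0 := y 0)) = site_kernel y"
          by (rule local_onD[OF site_kernel_local]) (use True \<Gamma> in auto)
        then show ?thesis by simp
      qed (auto simp: matches_def)
      have "(\<Sum>b\<in>UNIV. site_kernel (recentre i (x(i := b))) * ?G (x(i := b))) =
          (\<Sum>b\<in>UNIV. s * W x * (matches \<Gamma> y z * site_kernel (z(0 := b)) * of_bool (b = y 0))
              - s * W x * matches \<Gamma> y z * site_kernel y * site_kernel (z(0 := b)))"
        by (rule sum.cong) (auto simp: recentre_fun_upd W matches_insert m simp flip: z_def, auto simp: algebra_simps)
      also have "\<dots> = s * W x * (\<Sum>b\<in>UNIV. matches \<Gamma> y z * site_kernel (z(0 := b)) * of_bool (b = y 0))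
              - s * W x * matches \<Gamma> y z * site_kernel y * (\<Sum>b\<in>UNIV. site_kernel (z(0 := b)))"
        by (simp only: sum_subtractf sum_distrib_left)
      also have "(\<Sum>b\<in>UNIV. matches \<Gamma> y z * site_kernel (z(0 := b)) * of_bool (b = y 0)) =
          (\<Sum>b\<in>UNIV. if b = y 0 then matches \<Gamma> y z * site_kernel (z(0 := y 0)) else 0)"
        by (rule sum.cong) auto
      also have "\<dots> = matches \<Gamma> y z * site_kernel y" using k by simp
      finally show ?thesis by (simp only: sum_site_kernel mult_1_right mult.assoc diff_self)
    qed
    then show "mean ?G \<le> 0"
      using resampling[OF _ lG, of i] V(1) \<Gamma>(3) by simp
  qed
qed simp

text \<open>
  A visit is an occurrence of the context on \<open>\<Phi>\<close>, disjoint from \<open>\<Gamma>\<^sub>0\<close>; the pattern on \<open>\<Gamma>\<^sub>0\<close> then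
  follows with conditional probability at least \<open>q ^ card \<Gamma>\<^sub>0\<close>.
\<close>

lemma pattern_statistic:
  assumes \<Phi>: "\<Phi> \<inter> \<Gamma>\<^sub>0 = {}" "finite \<Phi>" and q: "0 \<le> q" "q \<le> 1" "\<And>y. q \<le> site_kernel y"
  shows "bounded_statistic M X (\<Phi> \<union> \<Gamma>\<^sub>0) \<Gamma>\<^sub>0
    (\<lambda>x. q ^ card \<Gamma>\<^sub>0 * matches \<Phi> y x - matches (\<Phi> \<union> \<Gamma>\<^sub>0) y x) (matches \<Phi> y)"
    (is "bounded_statistic M X _ _ ?f _")
proof
  show "finite (\<Phi> \<union> \<Gamma>\<^sub>0)" using \<Phi> by simp
  show "local_on (\<Phi> \<union> \<Gamma>\<^sub>0) ?f"
    by (intro local_on_cmult local_on_diff matches_local local_on_mono[OF matches_local]) auto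
  show "local_on (\<Phi> \<union> \<Gamma>\<^sub>0) (matches \<Phi> y)" by (rule local_on_mono[OF matches_local]) auto
  fix x
  show "matches \<Phi> y x = 0 \<or> matches \<Phi> y x = 1" by (rule matches_01)
  have "0 \<le> q ^ card \<Gamma>\<^sub>0" "q ^ card \<Gamma>\<^sub>0 \<le> 1" using q by (auto intro: power_le_one)
  then show "\<bar>?f x\<bar> \<le> matches \<Phi> y x"
    by (auto simp: matches_Un) (auto simp: matches_def)
next
  show "unfavourable \<Gamma>\<^sub>0 ?f"
    unfolding unfavourable_def
  proof (intro allI impI)
    fix i :: "int ^ 'd" and V and W :: "(int ^ 'd \<Rightarrow> 'a) \<Rightarrow> real"
    assume V: "finite V" "V \<inter> translate \<Gamma>\<^sub>0 i = {}" "local_on V W" "\<forall>x. (0::real) \<le> W x"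
    define W' where "W' = (\<lambda>x. W x * matches \<Phi> y (recentre i x))"
    let ?V' = "V \<union> translate \<Phi> i" and ?D = "translate \<Gamma>\<^sub>0 i"
    let ?w = "\<lambda>j. y (j - i)"
    have lW: "local_on ?V' W'" unfolding W'_def
      by (rule local_on_mult[OF local_on_mono[OF V(3)] local_on_mono[OF local_on_recentre[OF matches_local]]]) auto
    have disj: "?V' \<inter> ?D = {}" using V(2) \<Phi>(1) by (auto simp: mem_translate_iff)
    have W0: "0 \<le> W' x" for x using V(4) by (simp add: W'_def matches_def)
    have m: "of_bool (\<forall>j\<in>?D. x j = ?w j) = matches \<Gamma>\<^sub>0 y (recentre i x)" for x
      by (auto simp: matches_def translate_def recentre_def)
    have card: "card ?D = card \<Gamma>\<^sub>0" unfolding translate_def by (intro card_image) (simp add: inj_on_def)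
    have "q ^ card ?D * mean W' \<le> mean (\<lambda>x. W' x * of_bool (\<forall>j\<in>?D. x j = ?w j))"
      by (rule mean_pattern_lower_bound[OF q(1,3) _ _ disj lW W0]) (use V \<Phi> in auto)
    then have le: "q ^ card \<Gamma>\<^sub>0 * mean W' \<le> mean (\<lambda>x. W' x * matches \<Gamma>\<^sub>0 y (recentre i x))"
      by (simp only: m card)
    let ?U = "?V' \<union> ?D"
    have l1: "local_on ?U (\<lambda>x. q ^ card \<Gamma>\<^sub>0 * W' x)"
      by (rule local_on_cmult[OF local_on_mono[OF lW]]) auto
    have l2: "local_on ?U (\<lambda>x. - 1 * (W' x * matches \<Gamma>\<^sub>0 y (recentre i x)))"
      by (rule local_on_cmult[OF local_on_mult[OF local_on_mono[OF lW]
            local_on_mono[OF local_on_recentre[OF matches_local]]]]) auto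
    have "mean (\<lambda>x. W x * ?f (recentre i x)) =
        mean (\<lambda>x. q ^ card \<Gamma>\<^sub>0 * W' x + - 1 * (W' x * matches \<Gamma>\<^sub>0 y (recentre i x)))"
      by (simp add: W'_def matches_Un algebra_simps)
    also have "\<dots> = q ^ card \<Gamma>\<^sub>0 * mean W' + - 1 * mean (\<lambda>x. W' x * matches \<Gamma>\<^sub>0 y (recentre i x))"
      by (subst mean_add[OF _ l1 l2]) (use V \<Phi> in \<open>simp_all only: mean_cmult, auto\<close>)
    also have "\<dots> \<le> 0" using le by simp
    finally show "mean (\<lambda>x. W x * ?f (recentre i x)) \<le> 0" .
  qed
qed auto

text \<open>
  The first clause makes transition counts follow the specification; it drives both error
  estimates.  The second clause says that no pattern on \<open>\<Gamma>\<^sub>0\<close> is rare within the occurrences of any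
  block on the remaining sites of the cube; it is needed against neighborhoods that miss part of \<open>\<Gamma>\<^sub>0\<close>.
\<close>

definition typical :: "real \<Rightarrow> real \<Rightarrow> nat \<Rightarrow> (int ^ 'd) set \<Rightarrow> (int ^ 'd \<Rightarrow> 'a) \<Rightarrow> bool" where
  "typical \<eta> \<tau> R T x \<longleftrightarrow>
    (\<forall>\<Gamma> y. \<Gamma>\<^sub>0 \<subseteq> \<Gamma> \<longrightarrow> \<Gamma> \<subseteq> cube R - {0} \<longrightarrow>
      \<bar>occurrences T (insert 0 \<Gamma>) y x - site_kernel y * occurrences T \<Gamma> y x\<bar>
        \<le> 3 * sqrt (\<tau> * occurrences T \<Gamma> y x)) \<and>
    (\<forall>y. \<eta> * occurrences T (cube R - insert 0 \<Gamma>\<^sub>0) y x - occurrences T (cube R - {0}) y x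
        \<le> 3 * sqrt (\<tau> * occurrences T (cube R - insert 0 \<Gamma>\<^sub>0) y x))"

text \<open>
  Union bound over at most \<open>2 ^ B\<close> neighborhoods in the cube and \<open>CARD('a) ^ B\<close> configurations on it,
  with three statistics for each pair.
\<close>

lemma typical_outside_exceptional_event:
  fixes T :: "nat \<Rightarrow> (int ^ 'd) set" and J N R :: nat and t q :: real
  defines "B \<equiv> (2 * R + 1) ^ CARD('d)"
  assumes q: "0 \<le> q" "q \<le> 1" "\<And>y. q \<le> site_kernel y"
    and R: "\<Gamma>\<^sub>0 \<subseteq> cube R" and t: "1 \<le> real B * t"
    and T: "\<And>n. finite (T n)" "mono T"
  shows "\<exists>E \<in> sets M. prob E \<le> (2 * real CARD('a)) ^ B * (3 * (real (J + 1) * real B * exp (- t))) \<and>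
    (\<forall>\<omega> \<in> space M - E. \<forall>n\<le>N. card (T n) \<le> 4 ^ J \<longrightarrow>
      typical (q ^ card \<Gamma>\<^sub>0) (real B * t) R (T n) (realization \<omega>))"
proof -
  define c where "c = real (J + 1) * real B * exp (- t)"
  define \<tau> where "\<tau> = real B * t"
  let ?\<Phi> = "cube R - insert 0 \<Gamma>\<^sub>0 :: (int ^ 'd) set"
  define G where "G = {\<Gamma>. \<Gamma>\<^sub>0 \<subseteq> \<Gamma> \<and> \<Gamma> \<subseteq> cube R - {0}}"
  define P where "P = G \<times> ((cube R :: (int ^ 'd) set) \<rightarrow>\<^sub>E (UNIV :: 'a set))"
  have \<Phi>: "?\<Phi> \<union> \<Gamma>\<^sub>0 = cube R - {0}" using R by auto
  have GP: "G \<subseteq> Pow (cube R)" by (auto simp: G_def)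
  then have finG: "finite G" by (rule finite_subset) simp
  have finP: "finite P" using finG by (simp add: P_def finite_PiE)
  have "card G \<le> 2 ^ B" using card_mono[OF _ GP] by (simp add: card_Pow card_cube B_def)
  then have "real (card P) \<le> 2 ^ B * real CARD('a) ^ B"
    by (simp add: P_def card_cartesian_product card_PiE card_cube B_def mult_right_mono
        numeral_power_le_of_nat_cancel_iff of_nat_le_numeral_power_cancel_iff)
  then have cardP: "real (card P) \<le> (2 * real CARD('a)) ^ B" by (simp add: power_mult_distrib)
  let ?Q = "\<lambda>\<Gamma> y x n. card (T n) \<le> 4 ^ J \<longrightarrow>
      \<bar>occurrences (T n) (insert 0 \<Gamma>) y x - site_kernel y * occurrences (T n) \<Gamma> y x\<bar>
        \<le> 3 * sqrt (\<tau> * occurrences (T n) \<Gamma> y x) \<and>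
      q ^ card \<Gamma>\<^sub>0 * occurrences (T n) ?\<Phi> y x - occurrences (T n) (cube R - {0}) y x
        \<le> 3 * sqrt (\<tau> * occurrences (T n) ?\<Phi> y x)"
  have card_le: "occurrences (T n) V y x \<le> 4 ^ J" if "card (T n) \<le> 4 ^ J" for n V y and x :: "int ^ 'd \<Rightarrow> 'a"
  proof -
    have "occurrences (T n) V y x \<le> real (card (T n))" by (rule occurrences_le_card[OF T(1)])
    also have "\<dots> \<le> real (4 ^ J)" using that by (simp only: of_nat_le_iff)
    finally show ?thesis by simp
  qed
  have step: "\<exists>E\<in>sets M. prob E \<le> 3 * c \<and> (\<forall>\<omega>\<in>space M - E. \<forall>n\<le>N. ?Q (fst p) (snd p) (realization \<omega>) n)"
    if p: "p \<in> P" for p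
  proof -
    obtain \<Gamma> y where py: "p = (\<Gamma>, y)" by (cases p)
    have \<Gamma>: "\<Gamma>\<^sub>0 \<subseteq> \<Gamma>" "0 \<notin> \<Gamma>" "\<Gamma> \<subseteq> cube R" using p by (auto simp: py P_def G_def)
    have fin\<Gamma>: "finite \<Gamma>" using finite_subset[OF \<Gamma>(3)] by simp
    have *: "\<exists>E\<in>sets M. prob E \<le> c \<and> (\<forall>\<omega>\<in>space M - E. \<forall>n\<le>N. card (T n) \<le> 4 ^ J \<longrightarrow>
        s * (occurrences (T n) (insert 0 \<Gamma>) y (realization \<omega>) - site_kernel y * occurrences (T n) \<Gamma> y (realization \<omega>))
          \<le> 3 * sqrt (\<tau> * occurrences (T n) \<Gamma> y (realization \<omega>)))" if "\<bar>s\<bar> = 1" for s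
    proof -
      interpret b: bounded_statistic M X "insert 0 \<Gamma>" "{0}"
        "\<lambda>x. s * (matches (insert 0 \<Gamma>) y x - site_kernel y * matches \<Gamma> y x)" "matches \<Gamma> y"
        by (rule transition_statistic[OF \<Gamma>(1,2) fin\<Gamma> that])
      have tot: "b.total U x = s * (occurrences U (insert 0 \<Gamma>) y x - site_kernel y * occurrences U \<Gamma> y x)" for U x
        unfolding b.total_def occurrences_def
        by (simp only: sum_distrib_left sum_subtractf right_diff_distrib)
      have vis: "b.visits U x = occurrences U \<Gamma> y x" for U x
        by (simp add: b.visits_def occurrences_def)
      have "insert 0 \<Gamma> \<subseteq> cube R" using \<Gamma> by auto
      from b.uniform_deviation[OF this t[unfolded B_def] T, of J N]
      obtain E where "E \<in> sets M" "prob E \<le> c"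
        "\<And>\<omega> n. \<omega> \<in> space M - E \<Longrightarrow> n \<le> N \<Longrightarrow> b.visits (T n) (realization \<omega>) \<le> 4 ^ J \<Longrightarrow>
          b.total (T n) (realization \<omega>) \<le> 3 * sqrt (\<tau> * b.visits (T n) (realization \<omega>))"
        unfolding c_def \<tau>_def B_def by blast
      then show ?thesis unfolding tot vis using card_le by (intro bexI[of _ E]) auto
    qed
    have **: "\<exists>E\<in>sets M. prob E \<le> c \<and> (\<forall>\<omega>\<in>space M - E. \<forall>n\<le>N. card (T n) \<le> 4 ^ J \<longrightarrow>
        q ^ card \<Gamma>\<^sub>0 * occurrences (T n) ?\<Phi> y (realization \<omega>) - occurrences (T n) (cube R - {0}) y (realization \<omega>)
        \<le> 3 * sqrt (\<tau> * occurrences (T n) ?\<Phi> y (realization \<omega>)))"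
    proof -
      interpret b: bounded_statistic M X "?\<Phi> \<union> \<Gamma>\<^sub>0" "\<Gamma>\<^sub>0"
        "\<lambda>x. q ^ card \<Gamma>\<^sub>0 * matches ?\<Phi> y x - matches (?\<Phi> \<union> \<Gamma>\<^sub>0) y x" "matches ?\<Phi> y"
        by (rule pattern_statistic) (use q in auto)
      have tot: "b.total U x = q ^ card \<Gamma>\<^sub>0 * occurrences U ?\<Phi> y x - occurrences U (cube R - {0}) y x" for U x
        unfolding b.total_def occurrences_def
        by (simp only: \<Phi> sum_distrib_left sum_subtractf)
      have vis: "b.visits U x = occurrences U ?\<Phi> y x" for U x
        by (simp add: b.visits_def occurrences_def)
      have "?\<Phi> \<union> \<Gamma>\<^sub>0 \<subseteq> cube R" using R by auto
      from b.uniform_deviation[OF this t[unfolded B_def] T, of J N]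
      obtain E where "E \<in> sets M" "prob E \<le> c"
        "\<And>\<omega> n. \<omega> \<in> space M - E \<Longrightarrow> n \<le> N \<Longrightarrow> b.visits (T n) (realization \<omega>) \<le> 4 ^ J \<Longrightarrow>
          b.total (T n) (realization \<omega>) \<le> 3 * sqrt (\<tau> * b.visits (T n) (realization \<omega>))"
        unfolding c_def \<tau>_def B_def by blast
      then show ?thesis unfolding tot vis using card_le by (intro bexI[of _ E]) auto
    qed
    obtain E1 where E1: "E1 \<in> sets M" "prob E1 \<le> c" "\<And>\<omega> n. \<omega> \<in> space M - E1 \<Longrightarrow> n \<le> N \<Longrightarrow> card (T n) \<le> 4 ^ J \<Longrightarrow>
        occurrences (T n) (insert 0 \<Gamma>) y (realization \<omega>) - site_kernel y * occurrences (T n) \<Gamma> y (realization \<omega>)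
          \<le> 3 * sqrt (\<tau> * occurrences (T n) \<Gamma> y (realization \<omega>))"
      using *[of 1] by auto
    obtain E2 where E2: "E2 \<in> sets M" "prob E2 \<le> c" "\<And>\<omega> n. \<omega> \<in> space M - E2 \<Longrightarrow> n \<le> N \<Longrightarrow> card (T n) \<le> 4 ^ J \<Longrightarrow>
        - (occurrences (T n) (insert 0 \<Gamma>) y (realization \<omega>) - site_kernel y * occurrences (T n) \<Gamma> y (realization \<omega>))
          \<le> 3 * sqrt (\<tau> * occurrences (T n) \<Gamma> y (realization \<omega>))"
      using *[of "- 1"] by auto
    obtain E3 where E3: "E3 \<in> sets M" "prob E3 \<le> c" "\<And>\<omega> n. \<omega> \<in> space M - E3 \<Longrightarrow> n \<le> N \<Longrightarrow> card (T n) \<le> 4 ^ J \<Longrightarrow>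
        q ^ card \<Gamma>\<^sub>0 * occurrences (T n) ?\<Phi> y (realization \<omega>) - occurrences (T n) (cube R - {0}) y (realization \<omega>)
        \<le> 3 * sqrt (\<tau> * occurrences (T n) ?\<Phi> y (realization \<omega>))"
      using ** by auto
    have "prob (E1 \<union> E2 \<union> E3) \<le> prob E1 + prob E2 + prob E3"
      using measure_Un_le[OF sets.Un[OF E1(1) E2(1)] E3(1)] measure_Un_le[OF E1(1) E2(1)] by linarith
    also have "\<dots> \<le> 3 * c" using E1(2) E2(2) E3(2) by simp
    finally have pr: "prob (E1 \<union> E2 \<union> E3) \<le> 3 * c" .
    have Q: "?Q \<Gamma> y (realization \<omega>) n" if \<omega>: "\<omega> \<in> space M - (E1 \<union> E2 \<union> E3)" and n: "n \<le> N" for \<omega> n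
    proof (rule impI)
      assume card: "card (T n) \<le> 4 ^ J"
      have "\<omega> \<in> space M - E1" "\<omega> \<in> space M - E2" "\<omega> \<in> space M - E3" using \<omega> by blast+
      note E1(3)[OF this(1) n card] E2(3)[OF this(2) n card] E3(3)[OF this(3) n card]
      then show "\<bar>occurrences (T n) (insert 0 \<Gamma>) y (realization \<omega>) - site_kernel y * occurrences (T n) \<Gamma> y (realization \<omega>)\<bar>
          \<le> 3 * sqrt (\<tau> * occurrences (T n) \<Gamma> y (realization \<omega>)) \<and>
        q ^ card \<Gamma>\<^sub>0 * occurrences (T n) ?\<Phi> y (realization \<omega>) - occurrences (T n) (cube R - {0}) y (realization \<omega>)
          \<le> 3 * sqrt (\<tau> * occurrences (T n) ?\<Phi> y (realization \<omega>))"
        by (intro conjI abs_leI)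
    qed
    show ?thesis
    proof (rule bexI[of _ "E1 \<union> E2 \<union> E3"], intro conjI ballI allI impI[of "_ \<le> N"])
      show "prob (E1 \<union> E2 \<union> E3) \<le> 3 * c" by (rule pr)
      show "E1 \<union> E2 \<union> E3 \<in> sets M" using E1(1) E2(1) E3(1) by (intro sets.Un)
    qed (unfold py fst_conv snd_conv, rule Q)
  qed
  have "\<exists>E\<in>sets M. prob E \<le> real (card P) * (3 * c) \<and>
      (\<forall>\<omega>\<in>space M - E. \<forall>p\<in>P. \<forall>n\<le>N. ?Q (fst p) (snd p) (realization \<omega>) n)"
    by (rule exceptional_event_Union[OF finP step])
  then obtain E where E: "E \<in> sets M" and Eb: "prob E \<le> real (card P) * (3 * c) \<and>
      (\<forall>\<omega>\<in>space M - E. \<forall>p\<in>P. \<forall>n\<le>N. ?Q (fst p) (snd p) (realization \<omega>) n)"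
    by (rule bexE)
  have prE: "prob E \<le> real (card P) * (3 * c)" by (rule conjunct1[OF Eb])
  have EQ: "\<forall>\<omega>\<in>space M - E. \<forall>p\<in>P. \<forall>n\<le>N. ?Q (fst p) (snd p) (realization \<omega>) n"
    by (rule conjunct2[OF Eb])
  have "prob E \<le> (2 * real CARD('a)) ^ B * (3 * c)"
    by (rule order_trans[OF prE], rule mult_right_mono[OF cardP]) (simp add: c_def)
  moreover have "typical (q ^ card \<Gamma>\<^sub>0) \<tau> R (T n) (realization \<omega>)"
    if \<omega>: "\<omega> \<in> space M - E" and n: "n \<le> N" "card (T n) \<le> 4 ^ J" for \<omega> n
  proof -
    have Q: "?Q \<Gamma> y (realization \<omega>) n" if \<Gamma>: "\<Gamma> \<in> G" for \<Gamma> y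
    proof -
      let ?y = "restrict y (cube R)"
      have P: "(\<Gamma>, ?y) \<in> P" using \<Gamma> by (auto simp: P_def)
      have "?Q \<Gamma> ?y (realization \<omega>) n"
        using EQ[THEN bspec, OF \<omega>, THEN bspec, OF P, THEN spec, THEN mp, OF n(1)] by (simp only: fst_conv snd_conv)
      moreover have "site_kernel ?y = site_kernel y"
        by (rule local_onD[OF site_kernel_local]) (use R in auto)
      moreover have "occurrences (T n) V ?y (realization \<omega>) = occurrences (T n) V y (realization \<omega>)"
        if "V \<subseteq> cube R" for V
        by (rule occurrences_cong) (use that in auto)
      moreover have "insert 0 \<Gamma> \<subseteq> cube R" "\<Gamma> \<subseteq> cube R" "cube R - {0} \<subseteq> cube R" "?\<Phi> \<subseteq> cube R"
        using \<Gamma> by (auto simp: G_def)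
      ultimately show ?thesis by (simp only: Diff_subset)
    qed
    have \<Gamma>\<^sub>0: "\<Gamma>\<^sub>0 \<in> G" using R by (auto simp: G_def)
    show ?thesis unfolding typical_def
    proof (intro conjI allI impI)
      fix \<Gamma> y assume "\<Gamma>\<^sub>0 \<subseteq> \<Gamma>" "\<Gamma> \<subseteq> cube R - {0}"
      then have "\<Gamma> \<in> G" by (simp add: G_def)
      from Q[OF this, of y, THEN mp, OF n(2)]
      show "\<bar>occurrences (T n) (insert 0 \<Gamma>) y (realization \<omega>) - site_kernel y * occurrences (T n) \<Gamma> y (realization \<omega>)\<bar>
        \<le> 3 * sqrt (\<tau> * occurrences (T n) \<Gamma> y (realization \<omega>))" by (rule conjunct1)
    next
      fix y
      from Q[OF \<Gamma>\<^sub>0, of y, THEN mp, OF n(2)]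
      show "q ^ card \<Gamma>\<^sub>0 * occurrences (T n) ?\<Phi> y (realization \<omega>) - occurrences (T n) (cube R - {0}) y (realization \<omega>)
        \<le> 3 * sqrt (\<tau> * occurrences (T n) ?\<Phi> y (realization \<omega>))" by (rule conjunct2)
    qed
  qed
  ultimately show ?thesis
    using E unfolding c_def[symmetric] \<tau>_def[symmetric] by (intro bexI[of _ E] conjI ballI allI impI)
qed

end

section \<open>Epochs of the sample sequence\<close>

text \<open>
  The inner region depends on the sample through the integer part of its logarithmic scale.  With
  that integer frozen to \<open>k\<close> it becomes monotone in the region, which the inner regions themselves
  need not be.
\<close>

definition core :: "nat \<Rightarrow> (int ^ 'd) set \<Rightarrow> (int ^ 'd) set" where
  "core k \<Lambda> = {i \<in> \<Lambda>. {j. max_norm (i - j) \<le> int k} \<subseteq> \<Lambda>}"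

definition epoch :: "(int ^ 'd) set \<Rightarrow> nat" where
  "epoch \<Lambda> = nat \<lfloor>log_scale \<Lambda>\<rfloor>"

lemma core_subset: "core k \<Lambda> \<subseteq> \<Lambda>"
  by (auto simp: core_def)

lemma core_mono: "\<Lambda> \<subseteq> \<Lambda>' \<Longrightarrow> core k \<Lambda> \<subseteq> core k \<Lambda>'"
  by (auto simp: core_def)

lemma log_scale_nonneg: "0 \<le> log_scale \<Lambda>"
  by (simp add: log_scale_def)

lemma inner_region_eq_core: "inner_region \<Lambda> = core (epoch \<Lambda>) \<Lambda>"
proof -
  have "real_of_int m \<le> log_scale \<Lambda> \<longleftrightarrow> m \<le> int (epoch \<Lambda>)" for m
    using log_scale_nonneg[of \<Lambda>] by (simp add: epoch_def le_floor_iff)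
  then show ?thesis by (simp add: inner_region_def core_def)
qed

lemma log_scale_power:
  fixes \<Lambda> :: "(int ^ 'd) set"
  assumes "0 < ln (real (card \<Lambda>))"
  shows "log_scale \<Lambda> ^ (2 * CARD('d)) = ln (real (card \<Lambda>))"
proof -
  have "log_scale \<Lambda> ^ (2 * CARD('d)) = log_scale \<Lambda> powr real (2 * CARD('d))"
    using assms by (intro powr_realpow[symmetric]) (simp add: log_scale_def)
  then show ?thesis using assms by (simp add: log_scale_def powr_powr)
qed

lemma epoch_bounds:
  fixes \<Lambda> :: "(int ^ 'd) set"
  shows "1 \<le> epoch \<Lambda> \<Longrightarrow> real (epoch \<Lambda>) ^ (2 * CARD('d)) \<le> ln (real (card \<Lambda>))"
    and "ln (real (card \<Lambda>)) < real (epoch \<Lambda> + 1) ^ (2 * CARD('d))"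
    and "real (epoch \<Lambda>) \<le> log_scale \<Lambda>" "log_scale \<Lambda> < real (epoch \<Lambda>) + 1"
proof -
  have nn: "0 \<le> \<lfloor>log_scale \<Lambda>\<rfloor>" using log_scale_nonneg[of \<Lambda>] by simp
  show 1: "real (epoch \<Lambda>) \<le> log_scale \<Lambda>" and 2: "log_scale \<Lambda> < real (epoch \<Lambda>) + 1"
    using nn by (auto simp: epoch_def)
  show "real (epoch \<Lambda>) ^ (2 * CARD('d)) \<le> ln (real (card \<Lambda>))" if "1 \<le> epoch \<Lambda>"
  proof -
    have "log_scale \<Lambda> \<ge> 1" using 1 that by linarith
    then have "ln (real (card \<Lambda>)) \<noteq> 0" by (auto simp: log_scale_def)
    moreover have "ln (real (card \<Lambda>)) \<ge> 0" by (cases "card \<Lambda> = 0") auto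
    ultimately have "log_scale \<Lambda> ^ (2 * CARD('d)) = ln (real (card \<Lambda>))" by (intro log_scale_power) simp
    then show ?thesis using power_mono[OF 1, of "2 * CARD('d)"] by simp
  qed
  show "ln (real (card \<Lambda>)) < real (epoch \<Lambda> + 1) ^ (2 * CARD('d))"
  proof (cases "0 < ln (real (card \<Lambda>))")
    case True
    show ?thesis
      using power_strict_mono[OF 2 log_scale_nonneg, of "2 * CARD('d)"] log_scale_power[OF True] by (simp add: add.commute)
  next
    case False
    moreover have "0 < real (epoch \<Lambda> + 1) ^ (2 * CARD('d))" by simp
    ultimately show ?thesis by linarith
  qed
qed

lemma finite_subset_chain_card:
  assumes "\<And>n. finite (\<Lambda> n)" "\<And>n. \<Lambda> n \<subset> \<Lambda> (Suc n)"
  shows "n \<le> card (\<Lambda> n)"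
proof (induction n)
  case (Suc n)
  then show ?case using psubset_card_mono[OF assms(1,2), of n] by simp
qed simp

text \<open>
  The bound comes as a power of \<open>4\<close> because the dyadic slopes \<open>1 / 2 ^ j\<close> with \<open>j \<le> J\<close> serve visit
  numbers up to \<open>4 ^ J\<close>.
\<close>

lemma card_le_4_power:
  fixes \<Lambda> :: "(int ^ 'd) set"
  assumes "epoch \<Lambda> = k"
  shows "card \<Lambda> \<le> 4 ^ ((k + 1) ^ (2 * CARD('d)))"
proof (cases "card \<Lambda> = 0")
  case False
  let ?J = "(k + 1) ^ (2 * CARD('d))"
  have "ln (real (card \<Lambda>)) < real ?J" using epoch_bounds(2)[of \<Lambda>] assms by simp
  then have "real (card \<Lambda>) < exp (real ?J)" using False by (metis exp_less_mono exp_ln of_nat_0_less_iff neq0_conv)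
  also have "\<dots> = exp 1 ^ ?J" by (simp flip: exp_of_nat_mult)
  also have "\<dots> \<le> 4 ^ ?J" using exp_le by (intro power_mono) auto
  finally have "real (card \<Lambda>) < real (4 ^ ?J)" by simp
  then show ?thesis by (simp only: of_nat_less_iff less_imp_le)
qed simp

lemma epoch_filterlim:
  fixes \<Lambda> :: "nat \<Rightarrow> (int ^ 'd) set"
  assumes "\<And>n. n \<le> card (\<Lambda> n)"
  shows "filterlim (\<lambda>n. epoch (\<Lambda> n)) at_top sequentially"
  unfolding filterlim_at_top
proof
  fix Z
  let ?J = "real (Z + 1) ^ (2 * CARD('d))"
  show "\<forall>\<^sub>F n in sequentially. Z \<le> epoch (\<Lambda> n)"
    using eventually_ge_at_top[of "nat \<lceil>exp ?J\<rceil>"]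
  proof eventually_elim
    case (elim n)
    show ?case
    proof (rule ccontr)
      assume "\<not> Z \<le> epoch (\<Lambda> n)"
      then have "real (epoch (\<Lambda> n) + 1) ^ (2 * CARD('d)) \<le> ?J" by (intro power_mono) auto
      then have lt: "ln (real (card (\<Lambda> n))) < ?J" using epoch_bounds(2)[of "\<Lambda> n"] by linarith
      have "exp ?J \<le> real n" using elim by linarith
      also have "\<dots> \<le> real (card (\<Lambda> n))" using assms by simp
      finally have ge: "exp ?J \<le> real (card (\<Lambda> n))" .
      then have "0 < real (card (\<Lambda> n))" by (rule less_le_trans[rotated]) simp
      then have "?J \<le> ln (real (card (\<Lambda> n)))" using ge by (simp add: ln_ge_iff)
      then show False using lt by simp
    qed
  qed
qed

text \<open>
  In epoch \<open>k\<close> the cube has \<open>B k\<close> sites, at most \<open>3 * \<epsilon> * k ^ d\<close>.  The number of statistics is exponential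
  in \<open>k ^ d\<close>, and so is the reciprocal of the failure probability of each, but the latter has a factor
  \<open>1 / \<epsilon>\<close> in the exponent.  A small \<open>\<epsilon>\<close> therefore makes the product summable.
\<close>

lemma exceptional_probability_bound:
  fixes a c \<epsilon> :: real and d :: nat
  assumes a: "2 \<le> a" and c: "0 < c" and d: "1 \<le> d"
    and \<epsilon>: "0 < \<epsilon>" "3 * \<epsilon> \<le> 1" "3 * \<epsilon> * (ln (2 * a) + 6) \<le> c"
  defines "B \<equiv> \<lambda>k. (2 * nat \<lfloor>\<epsilon> * real k\<rfloor> + 1) ^ d"
  shows "\<forall>\<^sub>F k in sequentially. real (B k) \<le> real k ^ d \<and>
    (2 * a) ^ B k * (3 * (real ((k + 1) ^ (2 * d) + 1) * real (B k) * exp (- (c * real k ^ (2 * d) / real (B k)))))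
      \<le> exp (- real k)"
proof -
  have "\<forall>\<^sub>F k in sequentially. (real k + 1) ^ (2 * d) + 1 \<le> exp (real k)"
    by real_asymp
  moreover have "\<forall>\<^sub>F k in sequentially. real k \<ge> 2" "\<forall>\<^sub>F k in sequentially. real k \<ge> 1 / \<epsilon>"
    by real_asymp+
  ultimately show ?thesis
  proof eventually_elim
    case (elim k)
    define K where "K = real k ^ d"
    have k2: "2 \<le> real k" by (rule elim(2))
    have ke: "1 \<le> \<epsilon> * real k" using elim(3) \<epsilon>(1) by (simp add: field_simps)
    have kK: "real k \<le> K" unfolding K_def using k2 d by (intro self_le_power) auto
    have "real (2 * nat \<lfloor>\<epsilon> * real k\<rfloor> + 1) \<le> 3 * (\<epsilon> * real k)" using ke by linarith
    then have "real (2 * nat \<lfloor>\<epsilon> * real k\<rfloor> + 1) ^ d \<le> (3 * (\<epsilon> * real k)) ^ d" by (intro power_mono) auto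
    then have B1: "real (B k) \<le> (3 * \<epsilon>) ^ d * K"
      by (simp add: B_def K_def power_mult_distrib)
    have "(3 * \<epsilon>) ^ d \<le> 3 * \<epsilon>" using \<epsilon> d power_decreasing[of 1 d "3 * \<epsilon>"] by simp
    then have B2: "real (B k) \<le> 3 * \<epsilon> * K"
      using B1 kK k2 by (meson mult_right_mono order_trans zero_le_numeral)
    have BK: "real (B k) \<le> K"
      using B2 \<epsilon>(2) kK k2 by (smt (verit) mult_left_le_one_le \<epsilon>(1))
    have B0: "0 < real (B k)" by (simp add: B_def)
    have "(ln (2 * a) + 6) * K * real (B k) \<le> (ln (2 * a) + 6) * K * (3 * \<epsilon> * K)"
      using B2 a kK k2 by (intro mult_left_mono) auto
    also have "\<dots> = (3 * \<epsilon> * (ln (2 * a) + 6)) * K\<^sup>2" by (simp add: power2_eq_square)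
    also have "\<dots> \<le> c * K\<^sup>2" using \<epsilon>(3) by (intro mult_right_mono) auto
    finally have t: "(ln (2 * a) + 6) * K \<le> c * real k ^ (2 * d) / real (B k)"
      using B0 by (simp add: field_simps K_def power_mult[symmetric] mult.commute flip: power_mult)
    have "(2 * a) ^ B k = exp (ln (2 * a) * real (B k))"
      using a by (simp add: exp_of_nat2_mult)
    also have "\<dots> \<le> exp (ln (2 * a) * K)" using a BK by (simp add: mult_left_mono)
    finally have p1: "(2 * a) ^ B k \<le> exp (ln (2 * a) * K)" .
    have p2: "3 \<le> exp (real k)" using exp_ge_add_one_self[of "real k"] k2 by linarith
    have p3: "real ((k + 1) ^ (2 * d) + 1) \<le> exp (real k)" using elim by (simp add: add.commute)
    have p4: "real (B k) \<le> exp K" using BK exp_ge_add_one_self[of K] by linarith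
    have p5: "exp (- (c * real k ^ (2 * d) / real (B k))) \<le> exp (- ((ln (2 * a) + 6) * K))" using t by simp
    have "(2 * a) ^ B k * (3 * (real ((k + 1) ^ (2 * d) + 1) * real (B k) * exp (- (c * real k ^ (2 * d) / real (B k)))))
      \<le> exp (ln (2 * a) * K) * (exp (real k) * (exp (real k) * exp K * exp (- ((ln (2 * a) + 6) * K))))"
      using a by (intro mult_mono p1 p2 p3 p4 p5) auto
    also have "\<dots> = exp (2 * real k - 5 * K)"
      by (simp add: algebra_simps flip: exp_add)
    also have "\<dots> \<le> exp (- real k)" using kK k2 by simp
    finally show ?case using BK by (simp add: K_def)
  qed
qed

lemma finite_subset_cube:
  assumes "finite V"
  obtains r where "V \<subseteq> cube r"
proof
  show "V \<subseteq> cube (nat (\<Sum>v\<in>V. \<bar>max_norm v\<bar>))"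
  proof
    fix v assume "v \<in> V"
    then have "\<bar>max_norm v\<bar> \<le> (\<Sum>v\<in>V. \<bar>max_norm v\<bar>)" using assms by (intro member_le_sum) auto
    then show "v \<in> cube (nat (\<Sum>v\<in>V. \<bar>max_norm v\<bar>))" by (simp add: cube_def)
  qed
qed

context positive_markov_field
begin

text \<open>
  The factor \<open>\<epsilon>\<close> bounds the radius relative to the scale.  Any fixed positive value is good enough
  later, because admissible radii are of smaller order than the scale.
\<close>

lemma AE_eventually_typical:
  fixes \<Lambda> :: "nat \<Rightarrow> (int ^ 'd) set" and c q :: real
  assumes q: "0 \<le> q" "q \<le> 1" "\<And>y. q \<le> site_kernel y" and c: "0 < c" and A: "CARD('a) \<ge> 2"
    and \<Lambda>: "\<And>n. finite (\<Lambda> n)" "\<And>n. \<Lambda> n \<subset> \<Lambda> (Suc n)"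
  obtains \<epsilon> :: real where "0 < \<epsilon>" "\<epsilon> \<le> 1"
    "\<forall>\<^sub>F k in sequentially. real ((2 * nat \<lfloor>\<epsilon> * real k\<rfloor> + 1) ^ CARD('d)) \<le> real k ^ CARD('d)"
    "AE \<omega> in M. \<forall>\<^sub>F k in sequentially. \<forall>n. epoch (\<Lambda> n) = k \<longrightarrow>
      typical (q ^ card \<Gamma>\<^sub>0) (c * real k ^ (2 * CARD('d))) (nat \<lfloor>\<epsilon> * real k\<rfloor>) (inner_region (\<Lambda> n)) (realization \<omega>)"
proof -
  define a where "a = real CARD('a)"
  have a: "2 \<le> a" using A by (simp add: a_def)
  define L where "L = ln (2 * a) + 6"
  have L: "0 < L" using a by (simp add: L_def add_nonneg_pos)
  \<comment> \<open>The constant \<open>6\<close> in \<open>L\<close> leaves room for the polynomial factors of the union bound.\<close>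
  define \<epsilon> where "\<epsilon> = min (1 / 3) (c / (3 * L))"
  have \<epsilon>: "0 < \<epsilon>" "3 * \<epsilon> \<le> 1" using c L by (auto simp: \<epsilon>_def)
  have "\<epsilon> \<le> c / (3 * L)" by (simp add: \<epsilon>_def)
  then have \<epsilon>c: "3 * \<epsilon> * L \<le> c" using L by (simp add: field_simps)
  define R where "R k = nat \<lfloor>\<epsilon> * real k\<rfloor>" for k
  define B where "B k = (2 * R k + 1) ^ CARD('d)" for k
  define t where "t k = c * real k ^ (2 * CARD('d)) / real (B k)" for k
  define J where "J k = (k + 1) ^ (2 * CARD('d))" for k :: nat
  have B0: "0 < real (B k)" for k by (simp add: B_def)
  have Bt: "real (B k) * t k = c * real k ^ (2 * CARD('d))" for k using B0[of k] by (simp add: t_def)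
  have chain: "\<Lambda> m \<subseteq> \<Lambda> n" if "m \<le> n" for m n
    by (rule lift_Suc_mono_le[OF _ that]) (use \<Lambda>(2) in auto)
  define Good where "Good k \<omega> \<longleftrightarrow> (\<forall>n\<le>4 ^ J k. card (core k (\<Lambda> n)) \<le> 4 ^ J k \<longrightarrow>
      typical (q ^ card \<Gamma>\<^sub>0) (c * real k ^ (2 * CARD('d))) (R k) (core k (\<Lambda> n)) (realization \<omega>))" for k \<omega>
  have bounds: "\<forall>\<^sub>F k in sequentially. real (B k) \<le> real k ^ CARD('d) \<and>
      (2 * a) ^ B k * (3 * (real (J k + 1) * real (B k) * exp (- t k))) \<le> exp (- real k)"
    unfolding B_def R_def t_def J_def
    by (rule exceptional_probability_bound[OF a c _ \<epsilon>]) (use \<epsilon>c in \<open>auto simp: L_def Suc_le_eq\<close>)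
  obtain r where r: "\<Gamma>\<^sub>0 \<subseteq> cube r" using finite_subset_cube[OF finite_\<Gamma>\<^sub>0] by blast
  have ev: "\<forall>\<^sub>F k in sequentially. real k \<ge> b" for b
    using filterlim_real_sequentially by (simp add: filterlim_at_top)
  have "\<forall>\<^sub>F k in sequentially. 1 \<le> c * real k ^ (2 * CARD('d))"
    using ev[of "1 / c"] ev[of 1]
  proof eventually_elim
    case (elim k)
    have "1 \<le> c * real k" using elim(1) c by (simp add: field_simps)
    also have "real k \<le> real k ^ (2 * CARD('d))" using elim(2) by (intro self_le_power) auto
    finally show ?case using c by simp
  qed
  moreover have "\<forall>\<^sub>F k in sequentially. real r + 1 \<le> \<epsilon> * real k"
    using ev[of "(real r + 1) / \<epsilon>"]
  proof eventually_elim
    case (elim k)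
    then show ?case using \<epsilon>(1) by (simp add: field_simps)
  qed
  ultimately have "\<forall>\<^sub>F k in sequentially. \<exists>E\<in>sets M. prob E \<le> exp (- real k) \<and>
      (\<forall>\<omega>\<in>space M - E. Good k \<omega>)"
    using bounds
  proof eventually_elim
    case (elim k)
    have "r \<le> R k" using elim(2) unfolding R_def by linarith
    then have sub: "\<Gamma>\<^sub>0 \<subseteq> cube (R k)" using r cube_mono by blast
    have one: "1 \<le> real ((2 * R k + 1) ^ CARD('d)) * t k"
      using elim(1) Bt[of k] by (simp add: B_def)
    have fin: "\<And>n. finite (core k (\<Lambda> n))" by (rule finite_subset[OF core_subset \<Lambda>(1)])
    have mono: "mono (\<lambda>n. core k (\<Lambda> n))" by (intro monoI core_mono chain)
    have "\<exists>E\<in>sets M. prob E \<le> (2 * a) ^ B k * (3 * (real (J k + 1) * real (B k) * exp (- t k))) \<and>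
        (\<forall>\<omega>\<in>space M - E. Good k \<omega>)"
      unfolding Good_def a_def Bt[symmetric] unfolding B_def
      by (rule typical_outside_exceptional_event[OF q sub one fin mono])
    then obtain E where E: "E \<in> sets M" "\<forall>\<omega>\<in>space M - E. Good k \<omega>"
      "prob E \<le> (2 * a) ^ B k * (3 * (real (J k + 1) * real (B k) * exp (- t k)))" by blast
    have "prob E \<le> exp (- real k)" by (rule order_trans[OF E(3) conjunct2[OF elim(3)]])
    with E(1,2) show ?case by blast
  qed
  then obtain k0 where "\<forall>k\<ge>k0. \<exists>E\<in>sets M. prob E \<le> exp (- real k) \<and> (\<forall>\<omega>\<in>space M - E. Good k \<omega>)"
    unfolding eventually_sequentially by blast
  then obtain E where E: "\<And>k. k \<ge> k0 \<Longrightarrow> E k \<in> sets M" "\<And>k. k \<ge> k0 \<Longrightarrow> prob (E k) \<le> exp (- real k)"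
    "\<And>k \<omega>. k \<ge> k0 \<Longrightarrow> \<omega> \<in> space M - E k \<Longrightarrow> Good k \<omega>"
    by metis
  have "AE \<omega> in M. \<forall>\<^sub>F k in sequentially. \<omega> \<in> space M - E (k + k0)"
  proof (rule borel_cantelli_AE1)
    show "E (k + k0) \<in> sets M" for k by (rule E(1)) simp
    show "emeasure M (E (k + k0)) < \<infinity>" for k by (simp add: emeasure_eq_measure)
    have "summable (\<lambda>k. exp (- 1) ^ k :: real)" by (rule summable_geometric) simp
    then have "summable (\<lambda>k. exp (- real k))" by (simp flip: exp_of_nat_mult)
    then show "summable (\<lambda>k. measure M (E (k + k0)))"
    proof (rule summable_comparison_test'[where N = 0])
      fix k
      have "prob (E (k + k0)) \<le> exp (- real (k + k0))" by (rule E(2)) simp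
      also have "\<dots> \<le> exp (- real k)" by simp
      finally show "norm (prob (E (k + k0))) \<le> exp (- real k)" by simp
    qed
  qed
  then have "AE \<omega> in M. \<forall>\<^sub>F k in sequentially. \<forall>n. epoch (\<Lambda> n) = k \<longrightarrow>
      typical (q ^ card \<Gamma>\<^sub>0) (c * real k ^ (2 * CARD('d))) (R k) (inner_region (\<Lambda> n)) (realization \<omega>)"
  proof eventually_elim
    case (elim \<omega>)
    then have "\<forall>\<^sub>F k in sequentially. \<omega> \<in> space M - E k"
      by (simp only: eventually_sequentially_seg[of "\<lambda>k. \<omega> \<in> space M - E k" k0])
    then show ?case using eventually_ge_at_top[of k0]
    proof eventually_elim
      case (elim k)
      show ?case
      proof (intro allI impI)
        fix n assume n: "epoch (\<Lambda> n) = k"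
        have card: "card (\<Lambda> n) \<le> 4 ^ J k" using card_le_4_power[OF n] by (simp add: J_def)
        have "n \<le> card (\<Lambda> n)" by (rule finite_subset_chain_card[where \<Lambda> = \<Lambda>, OF \<Lambda>])
        then have "n \<le> 4 ^ J k" using card by simp
        moreover have "card (core k (\<Lambda> n)) \<le> 4 ^ J k"
          using card card_mono[OF \<Lambda>(1) core_subset] by (rule order_trans[rotated])
        ultimately show "typical (q ^ card \<Gamma>\<^sub>0) (c * real k ^ (2 * CARD('d))) (R k) (inner_region (\<Lambda> n)) (realization \<omega>)"
          unfolding inner_region_eq_core n using E(3)[OF elim(2,1)] by (simp add: Good_def)
      qed
    qed
  qed
  moreover have "\<forall>\<^sub>F k in sequentially. real ((2 * nat \<lfloor>\<epsilon> * real k\<rfloor> + 1) ^ CARD('d)) \<le> real k ^ CARD('d)"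
    using bounds unfolding B_def R_def by (rule eventually_mono) blast
  ultimately show ?thesis using that[of \<epsilon>] \<epsilon> unfolding R_def by simp
qed

end

section \<open>Pseudo-likelihood as a sum over sites\<close>

lemma finite_configurations [simp]:
  "finite V \<Longrightarrow> finite (V \<rightarrow>\<^sub>E (UNIV :: 'a::finite set))"
  by (simp add: finite_PiE)

text \<open>
  Sites are grouped by the block \<open>u\<close> seen on \<open>V\<close>, among those that see the pattern \<open>w\<close> on \<open>W\<close>.
\<close>

lemma sum_over_sites_by_pattern:
  fixes x :: "int ^ 'd \<Rightarrow> 'a::finite" and F :: "(int ^ 'd \<Rightarrow> 'a) \<Rightarrow> real"
  assumes V: "finite V" "local_on V F" and disj: "V \<inter> W = {}"
  shows "(\<Sum>i\<in>T. matches W w (recentre i x) * F (recentre i x)) =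
    (\<Sum>u \<in> V \<rightarrow>\<^sub>E UNIV. occurrences T (V \<union> W) (override_on u w W) x * F u)"
proof -
  have pt: "matches W w z * F z = (\<Sum>u \<in> V \<rightarrow>\<^sub>E UNIV. matches (V \<union> W) (override_on u w W) z * F u)" for z
  proof -
    let ?r = "restrict z V"
    have "matches (V \<union> W) (override_on u w W) z * F u = (if u = ?r then matches W w z * F ?r else 0)"
      if u: "u \<in> V \<rightarrow>\<^sub>E UNIV" for u
    proof -
      have "(\<forall>j\<in>V. z j = override_on u w W j) \<longleftrightarrow> (\<forall>j\<in>V. z j = u j)"
        using disj by (intro ball_cong) (auto simp: override_on_def)
      also have "\<dots> \<longleftrightarrow> u = ?r" using u by (auto simp: PiE_def extensional_def restrict_def fun_eq_iff)
      finally have "matches V (override_on u w W) z = of_bool (u = ?r)" by (simp add: matches_def)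
      moreover have "matches W (override_on u w W) z = matches W w z"
        by (simp add: matches_def override_on_def)
      ultimately show ?thesis by (simp add: matches_Un)
    qed
    then have "(\<Sum>u \<in> V \<rightarrow>\<^sub>E UNIV. matches (V \<union> W) (override_on u w W) z * F u) =
        (\<Sum>u \<in> V \<rightarrow>\<^sub>E UNIV. if u = ?r then matches W w z * F ?r else 0)"
      by (rule sum.cong[OF refl])
    also have "\<dots> = matches W w z * F ?r" using V(1) by simp
    also have "F ?r = F z" by (rule local_onD[OF V(2)]) simp
    finally show ?thesis by simp
  qed
  show ?thesis unfolding pt occurrences_def by (subst sum.swap) (simp add: sum_distrib_right)
qed

lemma sum_over_sites_by_block:
  fixes x :: "int ^ 'd \<Rightarrow> 'a::finite" and F :: "(int ^ 'd \<Rightarrow> 'a) \<Rightarrow> real"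
  assumes V: "finite V" "local_on V F"
  shows "(\<Sum>i\<in>T. F (recentre i x)) = (\<Sum>u \<in> V \<rightarrow>\<^sub>E UNIV. occurrences T V u x * F u)"
  using sum_over_sites_by_pattern[OF V, where W = "{}" and w = undefined and T = T and x = x] by (simp add: matches_def)

lemma sum_occurrences:
  fixes x :: "int ^ 'd \<Rightarrow> 'a::finite"
  assumes "finite V"
  shows "(\<Sum>u \<in> V \<rightarrow>\<^sub>E UNIV. occurrences T V u x) = real (card T)"
  using sum_over_sites_by_block[OF assms local_on_const[of V "1::real"], of T x] by simp

lemma occurrences_eq_card:
  "finite T \<Longrightarrow> real (card {i \<in> T. \<forall>j\<in>V. x (i + j) = y j}) = occurrences T V y x"
  by (simp add: occurrences_def matches_def recentre_def sum.If_cases Int_def flip: of_nat_sum)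

lemma occurrences_local: "local_on V (\<lambda>y. occurrences T V y x)"
  unfolding local_on_def by (auto intro: occurrences_cong)

lemma occurrences_antimono: "V \<subseteq> V' \<Longrightarrow> occurrences T V' y x \<le> occurrences T V y x"
  unfolding occurrences_def matches_def by (intro sum_mono) auto

lemma occurrences_self:
  assumes "finite T" "i \<in> T"
  shows "1 \<le> occurrences T V (recentre i x) x"
proof -
  have "matches V (recentre i x) (recentre i x) \<le> occurrences T V (recentre i x) x"
    unfolding occurrences_def using assms by (intro member_le_sum) (auto simp: matches_def)
  then show ?thesis by (simp add: matches_def)
qed

definition empirical_kernel :: "(int ^ 'd) set \<Rightarrow> (int ^ 'd \<Rightarrow> 'a) \<Rightarrow> (int ^ 'd) set \<Rightarrow> (int ^ 'd \<Rightarrow> 'a) \<Rightarrow> real" where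
  "empirical_kernel T x \<Gamma> y = occurrences T (insert 0 \<Gamma>) y x / occurrences T \<Gamma> y x"

lemma empirical_kernel_local: "local_on (insert 0 \<Gamma>) (empirical_kernel T x \<Gamma>)"
  unfolding empirical_kernel_def[abs_def]
  by (rule local_on_comp2[where f = "(/)", OF occurrences_local local_on_mono[OF occurrences_local]]) auto

lemma empirical_kernel_nonneg: "0 \<le> empirical_kernel T x \<Gamma> y"
  by (simp add: empirical_kernel_def occurrences_nonneg)

lemma empirical_kernel_pos:
  "finite T \<Longrightarrow> i \<in> T \<Longrightarrow> 0 < empirical_kernel T x \<Gamma> (recentre i x)"
  unfolding empirical_kernel_def
  by (intro divide_pos_pos less_le_trans[OF zero_less_one occurrences_self])

lemma sum_empirical_kernel:
  fixes x :: "int ^ 'd \<Rightarrow> 'a::finite"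
  assumes "0 \<notin> \<Gamma>"
  shows "(\<Sum>b\<in>UNIV. empirical_kernel T x \<Gamma> (y(0 := b))) \<le> 1"
proof -
  have \<Gamma>: "occurrences T \<Gamma> (y(0 := b)) x = occurrences T \<Gamma> y x" for b
    using assms by (intro occurrences_cong) auto
  have "(\<Sum>b\<in>UNIV. matches (insert 0 \<Gamma>) (y(0 := b)) z) = matches \<Gamma> y z" for z
  proof -
    have "matches \<Gamma> (y(0 := b)) z = matches \<Gamma> y z" for b
      using assms matches_cong[of \<Gamma> "y(0 := b)" y] by (metis fun_upd_other)
    then show ?thesis by (simp add: matches_insert of_bool_def flip: sum_distrib_left)
  qed
  then have "(\<Sum>b\<in>UNIV. occurrences T (insert 0 \<Gamma>) (y(0 := b)) x) = occurrences T \<Gamma> y x"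
    unfolding occurrences_def by (subst sum.swap) simp
  then show ?thesis
    by (simp add: empirical_kernel_def \<Gamma> flip: sum_divide_distrib)
qed

text \<open>
  Blocks that do not occur contribute nothing to the pseudo-likelihood, so the sum over blocks is a
  sum over the sites at which they occur.
\<close>

lemma log_MPL_eq_sum:
  fixes x :: "int ^ 'd \<Rightarrow> 'a::finite"
  assumes "finite \<Lambda>" "finite \<Gamma>" "\<And>i. i \<in> inner_region \<Lambda> \<Longrightarrow> translate \<Gamma> i \<subseteq> \<Lambda>"
  shows "log_MPL \<Lambda> x \<Gamma> = (\<Sum>i \<in> inner_region \<Lambda>. ln (empirical_kernel (inner_region \<Lambda>) x \<Gamma> (recentre i x)))"
proof -
  let ?T = "inner_region \<Lambda>"
  have finT: "finite ?T" using assms(1) by (auto simp: inner_region_def intro: finite_subset)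
  have c: "real (centered_block_count \<Lambda> x \<Gamma> a) = occurrences ?T (insert 0 \<Gamma>) a x"
    and b: "real (block_count \<Lambda> x \<Gamma> a) = occurrences ?T \<Gamma> a x" for a
    unfolding centered_block_count_def block_count_def occurrences_eq_card[OF finT, symmetric]
    using assms(3) by (auto intro!: arg_cong[where f = card])
  have "log_MPL \<Lambda> x \<Gamma> = (\<Sum>a \<in> insert 0 \<Gamma> \<rightarrow>\<^sub>E UNIV.
      real (centered_block_count \<Lambda> x \<Gamma> a) * ln (real (centered_block_count \<Lambda> x \<Gamma> a) / real (block_count \<Lambda> x \<Gamma> a)))"
    unfolding log_MPL_def using assms(2) by (intro sum.mono_neutral_left) (auto simp: not_le)
  also have "\<dots> = (\<Sum>a \<in> insert 0 \<Gamma> \<rightarrow>\<^sub>E UNIV.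
      occurrences ?T (insert 0 \<Gamma>) a x * ln (empirical_kernel ?T x \<Gamma> a))"
    unfolding c b empirical_kernel_def ..
  also have "\<dots> = (\<Sum>i \<in> ?T. ln (empirical_kernel ?T x \<Gamma> (recentre i x)))"
    using assms(2)
    by (intro sum_over_sites_by_block[symmetric] local_on_comp[where f = ln] empirical_kernel_local) simp
  finally show ?thesis .
qed

context positive_markov_field
begin

section \<open>Neighborhoods that are too large\<close>

lemma site_kernel_weighted_sum:
  assumes \<Gamma>: "\<Gamma>\<^sub>0 \<subseteq> \<Gamma>" "0 \<notin> \<Gamma>" "finite \<Gamma>" and w: "local_on (insert 0 \<Gamma>) w"
  shows "(\<Sum>a \<in> insert 0 \<Gamma> \<rightarrow>\<^sub>E UNIV. site_kernel a * occurrences T \<Gamma> a x * w a) =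
    (\<Sum>i\<in>T. \<Sum>b\<in>UNIV. site_kernel ((recentre i x)(0 := b)) * w ((recentre i x)(0 := b)))"
proof -
  have occ: "occurrences T \<Gamma> (z(0 := b)) x = occurrences T \<Gamma> z x" for z b
    using \<Gamma> by (intro occurrences_cong) auto
  have lk: "local_on (insert 0 \<Gamma>) (\<lambda>z. site_kernel z * w z)"
    by (rule local_on_mult[OF local_on_mono[OF site_kernel_local] w]) (use \<Gamma> in auto)
  have l: "local_on \<Gamma> (\<lambda>z. \<Sum>b\<in>UNIV. site_kernel (z(0 := b)) * w (z(0 := b)))"
  proof (rule local_on_sum, unfold local_on_def, intro allI impI)
    fix b and z z' :: "int ^ 'd \<Rightarrow> 'a" assume "\<forall>j\<in>\<Gamma>. z j = z' j"
    then show "site_kernel (z(0 := b)) * w (z(0 := b)) = site_kernel (z'(0 := b)) * w (z'(0 := b))"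
      by (intro local_onD[OF lk]) auto
  qed
  have "(\<Sum>a \<in> insert 0 \<Gamma> \<rightarrow>\<^sub>E UNIV. site_kernel a * occurrences T \<Gamma> a x * w a) =
      (\<Sum>b\<in>UNIV. \<Sum>z \<in> \<Gamma> \<rightarrow>\<^sub>E UNIV. site_kernel (z(0 := b)) * occurrences T \<Gamma> (z(0 := b)) x * w (z(0 := b)))"
    by (rule sum_PiE_insert[OF \<Gamma>(2,3)])
  also have "\<dots> = (\<Sum>z \<in> \<Gamma> \<rightarrow>\<^sub>E UNIV. occurrences T \<Gamma> z x * (\<Sum>b\<in>UNIV. site_kernel (z(0 := b)) * w (z(0 := b))))"
    unfolding occ by (subst sum.swap) (simp add: sum_distrib_left ac_simps)
  also have "\<dots> = (\<Sum>i\<in>T. \<Sum>b\<in>UNIV. site_kernel ((recentre i x)(0 := b)) * w ((recentre i x)(0 := b)))"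
    by (rule sum_over_sites_by_block[OF \<Gamma>(3) l, symmetric])
  finally show ?thesis .
qed

text \<open>
  The empirical conditional probabilities maximize the likelihood: Gibbs' inequality, from
  \<open>ln z \<le> z - 1\<close>.
\<close>

lemma maximum_likelihood_lower:
  assumes T: "finite T"
  shows "(\<Sum>i\<in>T. ln (site_kernel (recentre i x))) \<le> (\<Sum>i\<in>T. ln (empirical_kernel T x \<Gamma>\<^sub>0 (recentre i x)))"
proof -
  let ?p = "empirical_kernel T x \<Gamma>\<^sub>0" and ?N = "occurrences T \<Gamma>\<^sub>0" and ?M = "occurrences T (insert 0 \<Gamma>\<^sub>0)"
  have "(\<Sum>i\<in>T. site_kernel (recentre i x) / ?p (recentre i x)) =
      (\<Sum>a \<in> insert 0 \<Gamma>\<^sub>0 \<rightarrow>\<^sub>E UNIV. ?M a x * (site_kernel a / ?p a))"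
    by (rule sum_over_sites_by_block)
      (auto intro: local_on_comp2[where f = "(/)"] site_kernel_local empirical_kernel_local)
  also have "\<dots> \<le> (\<Sum>a \<in> insert 0 \<Gamma>\<^sub>0 \<rightarrow>\<^sub>E UNIV. site_kernel a * ?N a x * 1)"
    by (intro sum_mono) (simp add: empirical_kernel_def less_imp_le site_kernel_pos occurrences_nonneg)
  also have "\<dots> = (\<Sum>i\<in>T. \<Sum>b\<in>UNIV. site_kernel ((recentre i x)(0 := b)) * 1)"
    by (rule site_kernel_weighted_sum) (auto intro: local_on_const)
  also have "\<dots> = real (card T)" by (simp add: sum_site_kernel)
  finally have *: "(\<Sum>i\<in>T. site_kernel (recentre i x) / ?p (recentre i x)) \<le> real (card T)" .
  have "(\<Sum>i\<in>T. ln (site_kernel (recentre i x)) - ln (?p (recentre i x))) \<le> (\<Sum>i\<in>T. site_kernel (recentre i x) / ?p (recentre i x) - 1)"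
  proof (rule sum_mono)
    fix i assume "i \<in> T"
    then have "0 < ?p (recentre i x)" by (rule empirical_kernel_pos[OF T])
    then show "ln (site_kernel (recentre i x)) - ln (?p (recentre i x)) \<le> site_kernel (recentre i x) / ?p (recentre i x) - 1"
      using site_kernel_pos[of "recentre i x"] ln_le_minus_one[of "site_kernel (recentre i x) / ?p (recentre i x)"]
      by (simp add: ln_div)
  qed
  also have "\<dots> \<le> 0" using * by (simp add: sum_subtractf)
  finally show ?thesis by (simp add: sum_subtractf)
qed

text \<open>
  The gain is bounded by the chi-square statistic, whose term for a block with \<open>N\<close> occurrences is the
  squared deviation divided by \<open>N\<close> times the conditional probability.  Typicality bounds it by
  \<open>9 * \<tau> / q\<close>.
\<close>

lemma overfit_gain_le:
  assumes T: "finite T" and \<Gamma>: "\<Gamma>\<^sub>0 \<subseteq> \<Gamma>" "\<Gamma> \<subseteq> cube R - {0}" and q: "0 < q" "\<And>y. q \<le> site_kernel y"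
    and \<tau>: "0 \<le> \<tau>" and typical: "typical \<eta> \<tau> R T x"
  shows "(\<Sum>i\<in>T. ln (empirical_kernel T x \<Gamma> (recentre i x))) - (\<Sum>i\<in>T. ln (site_kernel (recentre i x)))
    \<le> real (CARD('a) ^ (card \<Gamma> + 1)) * (9 * \<tau> / q)"
proof -
  let ?p = "empirical_kernel T x \<Gamma>" and ?N = "\<lambda>a. occurrences T \<Gamma> a x" and ?M = "\<lambda>a. occurrences T (insert 0 \<Gamma>) a x"
  let ?P = "insert 0 \<Gamma> \<rightarrow>\<^sub>E (UNIV :: 'a set)"
  have fin\<Gamma>: "finite \<Gamma>" using \<Gamma>(2) finite_subset[OF _ finite_cube] by blast
  have \<Gamma>0: "0 \<notin> \<Gamma>" using \<Gamma> by auto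
  have total0: "(\<Sum>a\<in>?P. ?M a) = real (card T)" by (rule sum_occurrences) (simp add: fin\<Gamma>)
  have total: "(\<Sum>a\<in>?P. site_kernel a * ?N a) = real (card T)"
    using site_kernel_weighted_sum[OF \<Gamma>(1) \<Gamma>0 fin\<Gamma> local_on_const, of T x 1] by (simp add: sum_site_kernel)
  have "(\<Sum>i\<in>T. ln (?p (recentre i x)) - ln (site_kernel (recentre i x))) \<le> (\<Sum>i\<in>T. ?p (recentre i x) / site_kernel (recentre i x) - 1)"
  proof (rule sum_mono)
    fix i assume "i \<in> T"
    then have "0 < ?p (recentre i x)" by (rule empirical_kernel_pos[OF T])
    then show "ln (?p (recentre i x)) - ln (site_kernel (recentre i x)) \<le> ?p (recentre i x) / site_kernel (recentre i x) - 1"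
      using site_kernel_pos[of "recentre i x"] ln_le_minus_one[of "?p (recentre i x) / site_kernel (recentre i x)"]
      by (simp add: ln_div)
  qed
  also have "\<dots> = (\<Sum>a\<in>?P. ?M a * (?p a / site_kernel a - 1))"
    by (rule sum_over_sites_by_block)
      (auto simp: fin\<Gamma> intro!: local_on_diff local_on_const local_on_comp2[where f = "(/)"] empirical_kernel_local
        local_on_mono[OF site_kernel_local] subsetD[OF \<Gamma>(1)])
  also have "\<dots> = (\<Sum>a\<in>?P. ?M a * (?p a / site_kernel a - 1) - ?M a + site_kernel a * ?N a)"
    by (simp add: sum.distrib sum_subtractf total total0)
  also have "\<dots> \<le> (\<Sum>a\<in>?P. 9 * \<tau> / q)"
  proof (rule sum_mono)
    fix a
    have k: "0 < site_kernel a" by (rule site_kernel_pos)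
    have q9: "0 \<le> 9 * \<tau> / q" using \<tau> q by simp
    show "?M a * (?p a / site_kernel a - 1) - ?M a + site_kernel a * ?N a \<le> 9 * \<tau> / q"
    proof (cases "?N a = 0")
      case True
      then have "?M a = 0"
        using occurrences_antimono[of \<Gamma> "insert 0 \<Gamma>" T a x] occurrences_nonneg[of T "insert 0 \<Gamma>" a x] by auto
      then show ?thesis using True q9 by simp
    next
      case False
      then have N: "0 < ?N a" using occurrences_nonneg[of T \<Gamma> a x] by simp
      have "\<bar>?M a - site_kernel a * ?N a\<bar> \<le> 3 * sqrt (\<tau> * ?N a)"
        using typical \<Gamma> unfolding typical_def by blast
      then have "\<bar>?M a - site_kernel a * ?N a\<bar>\<^sup>2 \<le> (3 * sqrt (\<tau> * ?N a))\<^sup>2" by (intro power_mono) auto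
      then have sq: "(?M a - site_kernel a * ?N a)\<^sup>2 \<le> 9 * \<tau> * ?N a" using \<tau> N by (simp add: power_mult_distrib)
      have "?M a * (?p a / site_kernel a - 1) - ?M a + site_kernel a * ?N a = (?M a - site_kernel a * ?N a)\<^sup>2 / (site_kernel a * ?N a)"
        using k N by (simp add: empirical_kernel_def field_simps power2_eq_square)
      also have "\<dots> \<le> 9 * \<tau> * ?N a / (site_kernel a * ?N a)"
        using sq k N by (intro divide_right_mono) auto
      also have "\<dots> = 9 * \<tau> / site_kernel a" using N by simp
      also have "\<dots> \<le> 9 * \<tau> / q" using q \<tau> k by (intro divide_left_mono) auto
      finally show ?thesis .
    qed
  qed
  also have "\<dots> = real (CARD('a) ^ (card \<Gamma> + 1)) * (9 * \<tau> / q)"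
    using fin\<Gamma> \<Gamma>0 by (simp add: card_PiE)
  finally show ?thesis by (simp add: sum_subtractf)
qed

end

context positive_markov_field
begin

section \<open>Neighborhoods that miss a basic site\<close>

text \<open>
  If the specification depended neither on \<open>l\<close> nor on \<open>- l\<close>, both could be removed from \<open>\<Gamma>\<^sub>0\<close>
  and a smaller Markov neighborhood would remain.  Neighborhoods are symmetric, so only the pair can be
  removed, which is why the site found may be \<open>- l\<close>.
\<close>

lemma site_kernel_depends_on_basic_sites:
  assumes minimal: "\<And>\<Gamma>. markov_neighborhood M X \<Gamma> \<Longrightarrow> \<Gamma>\<^sub>0 \<subseteq> \<Gamma>" and l: "l \<in> \<Gamma>\<^sub>0"
  obtains j v s where "j = l \<or> j = - l" "site_kernel v \<noteq> site_kernel (v(j := s))"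
proof (rule ccontr)
  note witness = that
  assume not: "\<not> thesis"
  have upd: "site_kernel (v(j := s)) = site_kernel v" if "j = l \<or> j = - l" for j v s
    using not witness[of j v s] that by metis
  define \<Gamma> where "\<Gamma> = \<Gamma>\<^sub>0 - {l, - l}"
  have sym: "uminus ` \<Gamma>\<^sub>0 = \<Gamma>\<^sub>0" using markov by (simp add: markov_neighborhood_def neighborhood_def)
  have loc: "local_on (insert 0 \<Gamma>) site_kernel"
    unfolding local_on_def
  proof (intro allI impI)
    fix x y :: "int ^ 'd \<Rightarrow> 'a" assume "\<forall>j\<in>insert 0 \<Gamma>. x j = y j"
    then have "site_kernel (x(l := y l, - l := y (- l))) = site_kernel y"
      by (intro local_onD[OF site_kernel_local]) (auto simp: \<Gamma>_def)
    then show "site_kernel x = site_kernel y" by (simp add: upd)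
  qed
  have cond: "cond_block_prob M X {i} V y = site_kernel (recentre i y)"
    if V: "finite V" "i \<notin> V" "translate \<Gamma> i \<subseteq> V" for V i y
  proof -
    let ?I = "\<lambda>V x. of_bool (\<forall>j\<in>V. x j = y j) :: real"
    have lI: "local_on V (\<lambda>x. \<forall>j\<in>V. x j = y j)" for V
      unfolding local_on_def by auto
    have mean_I: "mean (?I V) = block_prob M X V y" if "finite V" for V
      using local_event(2)[OF that lI] by (simp add: block_prob_def)
    have "mean (?I (insert i V)) =
        mean (\<lambda>x. \<Sum>b\<in>UNIV. site_kernel (recentre i (x(i := b))) * ?I (insert i V) (x(i := b)))"
      by (rule resampling[OF _ local_on_comp[OF lI]]) (use V in auto)
    also have "(\<lambda>x. \<Sum>b\<in>UNIV. site_kernel (recentre i (x(i := b))) * ?I (insert i V) (x(i := b))) =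
        (\<lambda>x. site_kernel (recentre i y) * ?I V x)"
    proof
      fix x :: "int ^ 'd \<Rightarrow> 'a"
      have "?I (insert i V) (x(i := b)) = (if b = y i then ?I V x else 0)" for b
      proof -
        have "(\<forall>j\<in>V. (x(i := b)) j = y j) = (\<forall>j\<in>V. x j = y j)"
          using V(2) by (intro ball_cong) auto
        then show ?thesis by auto
      qed
      then have "(\<Sum>b\<in>UNIV. site_kernel (recentre i (x(i := b))) * ?I (insert i V) (x(i := b))) =
          (\<Sum>b\<in>UNIV. if b = y i then site_kernel (recentre i (x(i := y i))) * ?I V x else 0)"
        by (intro sum.cong) auto
      also have "\<dots> = site_kernel (recentre i (x(i := y i))) * ?I V x" by simp
      also have "\<dots> = site_kernel (recentre i y) * ?I V x"
      proof (cases "\<forall>j\<in>V. x j = y j")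
        case True
        have "site_kernel (recentre i (x(i := y i))) = site_kernel (recentre i y)"
          by (rule local_onD[OF loc]) (use True V(3) in \<open>auto simp: recentre_def translate_def\<close>)
        then show ?thesis by simp
      qed simp
      finally show "(\<Sum>b\<in>UNIV. site_kernel (recentre i (x(i := b))) * ?I (insert i V) (x(i := b))) =
          site_kernel (recentre i y) * ?I V x" .
    qed
    finally have "block_prob M X (insert i V) y = site_kernel (recentre i y) * block_prob M X V y"
      by (simp only: mean_I mean_cmult finite_insert V(1))
    then show ?thesis using positive[OF V(1), of y] by (simp add: cond_block_prob_eq)
  qed
  have fin: "finite \<Gamma>" and zero: "0 \<notin> \<Gamma>" by (auto simp: \<Gamma>_def)
  have nb: "neighborhood \<Gamma>"
    unfolding neighborhood_def
  proof (intro conjI fin zero)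
    have "uminus ` \<Gamma> = uminus ` \<Gamma>\<^sub>0 - uminus ` {l, - l}"
      unfolding \<Gamma>_def by (intro image_set_diff) (simp add: inj_def)
    then show "uminus ` \<Gamma> = \<Gamma>" by (simp add: sym \<Gamma>_def insert_commute)
  qed
  have notin: "i \<notin> translate \<Delta> i" if "0 \<notin> \<Delta>" for i and \<Delta> :: "(int ^ 'd) set"
    using that by (simp add: mem_translate_iff)
  have c\<Gamma>: "cond_block_prob M X {i} (translate \<Gamma> i) y = site_kernel (recentre i y)" for i y
    by (rule cond) (use fin zero notin in auto)
  have "markov_neighborhood M X \<Gamma>"
    unfolding markov_neighborhood_def
  proof (intro conjI nb allI impI)
    fix i \<Delta> a assume "finite \<Delta>" "\<Gamma> \<subset> \<Delta>" "0 \<notin> \<Delta>"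
    then show "cond_block_prob M X {i} (translate \<Delta> i) a = cond_block_prob M X {i} (translate \<Gamma> i) a"
      unfolding c\<Gamma> by (intro cond notin translate_mono) auto
  next
    fix i and a :: "int ^ 'd \<Rightarrow> 'a"
    have "recentre 0 a = a" "recentre i (\<lambda>j. a (j - i)) = a" by (auto simp: recentre_def)
    moreover have "translate \<Gamma> 0 = \<Gamma>" by (simp add: translate_def)
    ultimately show "cond_block_prob M X {i} (translate \<Gamma> i) (\<lambda>j. a (j - i)) = cond_block_prob M X {0} \<Gamma> a"
      using c\<Gamma>[of i "\<lambda>j. a (j - i)"] c\<Gamma>[of 0 a] by simp
  qed
  from minimal[OF this] l show False by (auto simp: \<Gamma>_def)
qed

text \<open>
  One minus the Hellinger affinity of the specification and \<open>p\<close> at the context \<open>z\<close>.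
\<close>

definition hellinger_gap :: "((int ^ 'd \<Rightarrow> 'a) \<Rightarrow> real) \<Rightarrow> (int ^ 'd \<Rightarrow> 'a) \<Rightarrow> real" where
  "hellinger_gap p z = (\<Sum>b\<in>UNIV. site_kernel (z(0 := b)) * (1 - sqrt (p (z(0 := b)) / site_kernel (z(0 := b)))))"

lemma hellinger_gap_bounds:
  assumes "\<And>y. 0 \<le> p y" "(\<Sum>b\<in>UNIV. p (z(0 := b))) \<le> 1"
  shows "(\<Sum>b\<in>UNIV. (sqrt (p (z(0 := b))) - sqrt (site_kernel (z(0 := b))))\<^sup>2) / 2 \<le> hellinger_gap p z"
    and "0 \<le> hellinger_gap p z" and "hellinger_gap p z \<le> 1"
proof -
  let ?k = "\<lambda>b. site_kernel (z(0 := b))" and ?p = "\<lambda>b. p (z(0 := b))"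
  have k: "0 < ?k b" for b by (rule site_kernel_pos)
  have t: "?k b * (1 - sqrt (?p b / ?k b)) = ?k b - sqrt (?p b) * sqrt (?k b)" for b
  proof -
    have "?k b * sqrt (?p b / ?k b) = sqrt (?p b) * (?k b / sqrt (?k b))"
      by (simp add: real_sqrt_divide)
    also have "?k b / sqrt (?k b) = sqrt (?k b)" using k[of b] by (simp add: real_div_sqrt)
    finally show ?thesis by (simp only: right_diff_distrib mult_1_right)
  qed
  have eq: "hellinger_gap p z = (\<Sum>b\<in>UNIV. ?k b - sqrt (?p b) * sqrt (?k b))"
    unfolding hellinger_gap_def t ..
  have "(\<Sum>b\<in>UNIV. (sqrt (?p b) - sqrt (?k b))\<^sup>2) = (\<Sum>b\<in>UNIV. ?p b + ?k b - 2 * (sqrt (?p b) * sqrt (?k b)))"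
    using k assms(1) by (intro sum.cong) (simp_all add: power2_diff less_imp_le)
  also have "\<dots> = (\<Sum>b\<in>UNIV. ?p b) - (\<Sum>b\<in>UNIV. ?k b) + 2 * hellinger_gap p z"
    by (simp add: eq sum.distrib sum_subtractf sum_distrib_left)
  also have "\<dots> \<le> 2 * hellinger_gap p z" using assms(2) by (simp add: sum_site_kernel)
  finally show 1: "(\<Sum>b\<in>UNIV. (sqrt (?p b) - sqrt (?k b))\<^sup>2) / 2 \<le> hellinger_gap p z" by simp
  have "0 \<le> (\<Sum>b\<in>UNIV. (sqrt (?p b) - sqrt (?k b))\<^sup>2)" by (intro sum_nonneg) simp
  then show "0 \<le> hellinger_gap p z" using 1 by simp
  have "hellinger_gap p z \<le> (\<Sum>b\<in>UNIV. ?k b)"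
    unfolding eq using assms(1) k by (intro sum_mono) (simp add: less_imp_le)
  then show "hellinger_gap p z \<le> 1" by (simp add: sum_site_kernel)
qed

text \<open>
  The bound \<open>ln z \<le> z - 1\<close> applied to \<open>z = sqrt (p / site_kernel)\<close> gives a bounded function of the
  observed blocks.  By typicality its sum over sites may be replaced by its sum of conditional
  expectations, the Hellinger gaps, with an error of order \<open>sqrt (\<tau> * card T)\<close> per block.
\<close>

lemma sum_log_ratio_ge_hellinger:
  assumes T: "finite T" and R: "\<Gamma>\<^sub>0 \<subseteq> cube R - {0}" and q: "0 < q" "q \<le> 1" "\<And>y. q \<le> site_kernel y"
    and \<tau>: "0 \<le> \<tau>" and typical: "typical \<eta> \<tau> R T x"
    and p: "local_on (cube R) p" "\<And>y. 0 \<le> p y" "\<And>y. p y \<le> 1" "\<And>i. i \<in> T \<Longrightarrow> 0 < p (recentre i x)"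
  shows "2 * (\<Sum>i\<in>T. hellinger_gap p (recentre i x))
      - real (CARD('a) ^ card (cube R :: (int ^ 'd) set)) * (6 * sqrt (\<tau> * real (card T)) / q)
    \<le> (\<Sum>i\<in>T. ln (site_kernel (recentre i x))) - (\<Sum>i\<in>T. ln (p (recentre i x)))"
proof -
  let ?\<Psi> = "cube R - {0} :: (int ^ 'd) set"
  let ?w = "\<lambda>z. 1 - sqrt (p z / site_kernel z)"
  let ?P = "(cube R :: (int ^ 'd) set) \<rightarrow>\<^sub>E (UNIV :: 'a set)"
  let ?e = "3 * sqrt (\<tau> * real (card T)) / q"
  have ins: "insert 0 ?\<Psi> = cube R" by (auto simp: insert_absorb)
  have "cube R \<supseteq> insert 0 \<Gamma>\<^sub>0" using R by auto
  then have lw: "local_on (cube R) ?w"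
    by (intro local_on_diff local_on_const local_on_comp[where f = sqrt] local_on_comp2[where f = "(/)"] p(1)
        local_on_mono[OF site_kernel_local])
  have w_le: "\<bar>?w z\<bar> \<le> 1 / q" for z
  proof -
    have "p z / site_kernel z \<le> 1 / q"
      using p(2,3)[of z] q site_kernel_pos[of z] by (intro frac_le) auto
    also have "\<dots> \<le> (1 / q)\<^sup>2" using q by (simp add: power2_eq_square field_simps)
    finally have "sqrt (p z / site_kernel z) \<le> 1 / q" using q by (intro real_le_lsqrt) auto
    moreover have "0 \<le> sqrt (p z / site_kernel z)" using p(2)[of z] site_kernel_pos[of z] by simp
    moreover have "1 \<le> 1 / q" using q by simp
    ultimately show ?thesis by linarith
  qed
  have "(\<Sum>i\<in>T. hellinger_gap p (recentre i x)) - (\<Sum>i\<in>T. ?w (recentre i x))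
      = (\<Sum>a\<in>?P. (site_kernel a * occurrences T ?\<Psi> a x - occurrences T (cube R) a x) * ?w a)"
    using site_kernel_weighted_sum[OF R, where w = ?w and T = T and x = x]
      sum_over_sites_by_block[OF _ lw, where T = T and x = x] lw
    unfolding ins by (simp add: hellinger_gap_def sum_subtractf left_diff_distrib)
  also have "\<dots> \<le> (\<Sum>a\<in>?P. ?e)"
  proof (rule sum_mono)
    fix a
    let ?D = "site_kernel a * occurrences T ?\<Psi> a x - occurrences T (cube R) a x"
    have "\<bar>?D\<bar> \<le> 3 * sqrt (\<tau> * occurrences T ?\<Psi> a x)"
      using typical R unfolding typical_def by (metis ins abs_minus_commute order_refl)
    also have "\<dots> \<le> 3 * sqrt (\<tau> * real (card T))"
      using mult_left_mono[OF occurrences_le_card[OF T] \<tau>] by simp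
    finally have D: "\<bar>?D\<bar> \<le> 3 * sqrt (\<tau> * real (card T))" .
    have "?D * ?w a \<le> \<bar>?D\<bar> * \<bar>?w a\<bar>" by (metis abs_ge_self abs_mult)
    also have "\<dots> \<le> 3 * sqrt (\<tau> * real (card T)) * (1 / q)"
      by (intro mult_mono D w_le) (use \<tau> in auto)
    finally show "?D * ?w a \<le> ?e" by simp
  qed
  also have "\<dots> = real (CARD('a) ^ card (cube R :: (int ^ 'd) set)) * ?e"
    by (simp add: card_PiE)
  finally have 1: "(\<Sum>i\<in>T. hellinger_gap p (recentre i x)) - (\<Sum>i\<in>T. ?w (recentre i x)) \<le>
      real (CARD('a) ^ card (cube R :: (int ^ 'd) set)) * ?e" .
  have "(\<Sum>i\<in>T. 2 * ?w (recentre i x)) \<le> (\<Sum>i\<in>T. ln (site_kernel (recentre i x)) - ln (p (recentre i x)))"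
  proof (rule sum_mono)
    fix i assume "i \<in> T"
    then have pp: "0 < p (recentre i x)" by (rule p(4))
    have "ln (sqrt (p (recentre i x) / site_kernel (recentre i x))) \<le> sqrt (p (recentre i x) / site_kernel (recentre i x)) - 1"
      using pp site_kernel_pos by (intro ln_le_minus_one) simp
    then show "2 * ?w (recentre i x) \<le> ln (site_kernel (recentre i x)) - ln (p (recentre i x))"
      using pp site_kernel_pos[of "recentre i x"] by (simp add: ln_sqrt ln_div)
  qed
  then have "2 * (\<Sum>i\<in>T. ?w (recentre i x)) \<le> (\<Sum>i\<in>T. ln (site_kernel (recentre i x))) - (\<Sum>i\<in>T. ln (p (recentre i x)))"
    by (simp add: sum_subtractf sum_distrib_left)
  then show ?thesis using 1 by simp
qed

text \<open>
  On each block \<open>u\<close> outside \<open>\<Gamma>\<^sub>0\<close>, completed by \<open>v\<close> or by the variant of \<open>v\<close> at \<open>j\<close>, the function \<open>p\<close>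
  takes the same values while the specification takes different ones.  The two gaps therefore
  cannot both be small, and by typicality both completions occur at a fraction \<open>\<eta>\<close> of
  the occurrences of \<open>u\<close>.
\<close>

lemma sum_hellinger_gap_ge:
  assumes T: "finite T" and R: "\<Gamma>\<^sub>0 \<subseteq> cube R - {0}" and \<eta>: "0 \<le> \<eta>"
    and \<tau>: "0 \<le> \<tau>" and typical: "typical \<eta> \<tau> R T x"
    and j: "j \<in> \<Gamma>\<^sub>0" and dep: "site_kernel v \<noteq> site_kernel (v(j := s))"
    and p: "local_on (cube R - {j}) p" "\<And>y. 0 \<le> p y" "\<And>y. (\<Sum>b\<in>UNIV. p (y(0 := b))) \<le> 1"
  shows "\<eta> * ((sqrt (site_kernel v) - sqrt (site_kernel (v(j := s))))\<^sup>2 / 4) * real (card T)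
      - real (CARD('a) ^ card (cube R :: (int ^ 'd) set)) * (6 * sqrt (\<tau> * real (card T)))
    \<le> (\<Sum>i\<in>T. hellinger_gap p (recentre i x))"
proof -
  let ?\<Phi> = "cube R - insert 0 \<Gamma>\<^sub>0 :: (int ^ 'd) set"
  define v' where "v' = v(j := s)"
  define \<delta> where "\<delta> = (sqrt (site_kernel v) - sqrt (site_kernel v'))\<^sup>2 / 4"
  define e where "e = 3 * sqrt (\<tau> * real (card T))"
  define h where "h w u = hellinger_gap p (override_on u w \<Gamma>\<^sub>0)" for w u
  have cube: "?\<Phi> \<union> \<Gamma>\<^sub>0 = cube R - {0}" "?\<Phi> \<inter> \<Gamma>\<^sub>0 = {}" using R by auto
  have j0: "j \<noteq> 0" using j zero_notin_\<Gamma>\<^sub>0 by blast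
  have "s \<noteq> v j" using dep by auto
  have gap: "0 \<le> hellinger_gap p z" "hellinger_gap p z \<le> 1" for z
    using hellinger_gap_bounds[OF p(2,3)] by auto
  have gap_local: "local_on (cube R - {0}) (hellinger_gap p)"
    unfolding hellinger_gap_def[abs_def]
  proof (rule local_on_sum, unfold local_on_def, intro allI impI)
    fix b and z z' :: "int ^ 'd \<Rightarrow> 'a" assume z: "\<forall>j\<in>cube R - {0}. z j = z' j"
    have "site_kernel (z(0 := b)) = site_kernel (z'(0 := b))"
      by (rule local_onD[OF site_kernel_local]) (use z R in auto)
    moreover have "p (z(0 := b)) = p (z'(0 := b))"
      by (rule local_onD[OF p(1)]) (use z in auto)
    ultimately show "site_kernel (z(0 := b)) * (1 - sqrt (p (z(0 := b)) / site_kernel (z(0 := b)))) =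
        site_kernel (z'(0 := b)) * (1 - sqrt (p (z'(0 := b)) / site_kernel (z'(0 := b))))" by simp
  qed
  have h_local: "local_on ?\<Phi> (h w)" for w
    unfolding local_on_def h_def
  proof (intro allI impI)
    fix u u' :: "int ^ 'd \<Rightarrow> 'a" assume "\<forall>l\<in>?\<Phi>. u l = u' l"
    then show "hellinger_gap p (override_on u w \<Gamma>\<^sub>0) = hellinger_gap p (override_on u' w \<Gamma>\<^sub>0)"
      by (intro local_onD[OF gap_local]) (auto simp: override_on_def)
  qed
  have two: "\<delta> \<le> h v u + h v' u" for u
  proof -
    let ?b = "v 0" and ?z = "override_on u v \<Gamma>\<^sub>0" and ?z' = "override_on u v' \<Gamma>\<^sub>0"
    have k: "site_kernel (?z(0 := ?b)) = site_kernel v" "site_kernel (?z'(0 := ?b)) = site_kernel v'"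
      using j0 by (auto intro!: local_onD[OF site_kernel_local] simp: override_on_def v'_def)
    have pp: "p (?z(0 := ?b)) = p (?z'(0 := ?b))"
      by (rule local_onD[OF p(1)]) (auto simp: override_on_def v'_def)
    let ?p = "sqrt (p (?z(0 := ?b)))"
    have le: "(sqrt (p (z(0 := ?b))) - sqrt (site_kernel (z(0 := ?b))))\<^sup>2 / 2 \<le> hellinger_gap p z" for z
    proof -
      have "(sqrt (p (z(0 := ?b))) - sqrt (site_kernel (z(0 := ?b))))\<^sup>2 \<le>
          (\<Sum>b\<in>UNIV. (sqrt (p (z(0 := b))) - sqrt (site_kernel (z(0 := b))))\<^sup>2)"
        by (rule member_le_sum[where f = "\<lambda>b. (sqrt (p (z(0 := b))) - sqrt (site_kernel (z(0 := b))))\<^sup>2"]) auto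
      then show ?thesis using hellinger_gap_bounds(1)[OF p(2,3), of z] by linarith
    qed
    have "\<delta> \<le> (?p - sqrt (site_kernel v))\<^sup>2 / 2 + (?p - sqrt (site_kernel v'))\<^sup>2 / 2"
    proof -
      \<comment> \<open>The value \<open>c\<close> of \<open>p\<close> cannot be close to both values of the specification.\<close>
      have "(a - b)\<^sup>2 / 4 \<le> (c - a)\<^sup>2 / 2 + (c - b)\<^sup>2 / 2" for a b c :: real
      proof -
        have "0 \<le> (2 * c - a - b)\<^sup>2" by simp
        also have "\<dots> = 2 * (c - a)\<^sup>2 + 2 * (c - b)\<^sup>2 - (a - b)\<^sup>2"
          by (simp add: power2_eq_square algebra_simps)
        finally show ?thesis by linarith
      qed
      then show ?thesis by (simp add: \<delta>_def)
    qed
    also have "\<dots> \<le> h v u + h v' u"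
      using le[of ?z] le[of ?z'] unfolding h_def k pp by (intro add_mono)
    finally show ?thesis .
  qed
  have pattern: "(\<Sum>i\<in>T. matches \<Gamma>\<^sub>0 w (recentre i x) * hellinger_gap p (recentre i x)) =
      (\<Sum>u \<in> ?\<Phi> \<rightarrow>\<^sub>E UNIV. occurrences T (cube R - {0}) (override_on u w \<Gamma>\<^sub>0) x * h w u)" for w
  proof -
    have "matches \<Gamma>\<^sub>0 w z * hellinger_gap p z = matches \<Gamma>\<^sub>0 w z * h w z" for z
    proof (cases "\<forall>j\<in>\<Gamma>\<^sub>0. z j = w j")
      case True
      have "override_on z w \<Gamma>\<^sub>0 = z" using True by (auto simp: override_on_def fun_eq_iff)
      then show ?thesis by (simp add: h_def)
    qed (auto simp: matches_def)
    then have "(\<Sum>i\<in>T. matches \<Gamma>\<^sub>0 w (recentre i x) * hellinger_gap p (recentre i x)) =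
        (\<Sum>i\<in>T. matches \<Gamma>\<^sub>0 w (recentre i x) * h w (recentre i x))" by (simp only:)
    then show ?thesis
      using sum_over_sites_by_pattern[OF _ h_local[of w] cube(2), where T = T and x = x and w = w] by (simp add: cube(1))
  qed
  have occ: "\<eta> * occurrences T ?\<Phi> u x - e \<le> occurrences T (cube R - {0}) (override_on u w \<Gamma>\<^sub>0) x" for u w
  proof -
    have "occurrences T ?\<Phi> (override_on u w \<Gamma>\<^sub>0) x = occurrences T ?\<Phi> u x"
      by (intro occurrences_cong) (auto simp: override_on_def)
    moreover have "3 * sqrt (\<tau> * occurrences T ?\<Phi> u x) \<le> e"
      unfolding e_def using mult_left_mono[OF occurrences_le_card[OF T] \<tau>] by simp
    ultimately show ?thesis
      using typical unfolding typical_def by (smt (verit))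
  qed
  have e0: "0 \<le> e" using \<tau> by (simp add: e_def)
  have "\<eta> * \<delta> * real (card T) - real (CARD('a) ^ card ?\<Phi>) * (2 * e) =
      (\<Sum>u \<in> ?\<Phi> \<rightarrow>\<^sub>E (UNIV :: 'a set). \<eta> * occurrences T ?\<Phi> u x * \<delta> - 2 * e)"
    using sum_occurrences[where V = ?\<Phi> and T = T and x = x]
    by (simp add: sum_subtractf card_PiE flip: sum_distrib_left sum_distrib_right)
  also have "\<dots> \<le> (\<Sum>u \<in> ?\<Phi> \<rightarrow>\<^sub>E UNIV.
      occurrences T (cube R - {0}) (override_on u v \<Gamma>\<^sub>0) x * h v u +
      occurrences T (cube R - {0}) (override_on u v' \<Gamma>\<^sub>0) x * h v' u)"
  proof (rule sum_mono)
    fix u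
    have hb: "0 \<le> h w u" "h w u \<le> 1" for w using gap by (auto simp: h_def)
    have "\<eta> * occurrences T ?\<Phi> u x * \<delta> \<le> \<eta> * occurrences T ?\<Phi> u x * (h v u + h v' u)"
      by (intro mult_left_mono two mult_nonneg_nonneg \<eta> occurrences_nonneg)
    moreover have "e * (h v u + h v' u) \<le> e * 2"
      using hb[of v] hb[of v'] e0 by (intro mult_left_mono) auto
    moreover have "(\<eta> * occurrences T ?\<Phi> u x - e) * h w u \<le> occurrences T (cube R - {0}) (override_on u w \<Gamma>\<^sub>0) x * h w u" for w
      by (intro mult_right_mono occ hb)
    from this[of v] this[of v'] calculation
    show "\<eta> * occurrences T ?\<Phi> u x * \<delta> - 2 * e \<le>
        occurrences T (cube R - {0}) (override_on u v \<Gamma>\<^sub>0) x * h v u +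
        occurrences T (cube R - {0}) (override_on u v' \<Gamma>\<^sub>0) x * h v' u"
      by (simp add: algebra_simps)
  qed
  also have "\<dots> = (\<Sum>i\<in>T. (matches \<Gamma>\<^sub>0 v (recentre i x) + matches \<Gamma>\<^sub>0 v' (recentre i x)) * hellinger_gap p (recentre i x))"
    by (simp add: sum.distrib distrib_right pattern)
  also have "\<dots> \<le> (\<Sum>i\<in>T. 1 * hellinger_gap p (recentre i x))"
  proof (intro sum_mono mult_right_mono gap)
    fix i
    show "matches \<Gamma>\<^sub>0 v (recentre i x) + matches \<Gamma>\<^sub>0 v' (recentre i x) \<le> 1"
      using j \<open>s \<noteq> v j\<close> by (auto simp: matches_def v'_def)
  qed
  finally have "\<eta> * \<delta> * real (card T) - real (CARD('a) ^ card ?\<Phi>) * (2 * e) \<le> (\<Sum>i\<in>T. hellinger_gap p (recentre i x))"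
    by simp
  moreover have "real (CARD('a) ^ card ?\<Phi>) * (2 * e) \<le> real (CARD('a) ^ card (cube R :: (int ^ 'd) set)) * (2 * e)"
  proof (rule mult_right_mono)
    have "card ?\<Phi> \<le> card (cube R :: (int ^ 'd) set)" by (intro card_mono) auto
    then show "real (CARD('a) ^ card ?\<Phi>) \<le> real (CARD('a) ^ card (cube R :: (int ^ 'd) set))"
      by (intro of_nat_mono power_increasing) (auto simp: Suc_le_eq)
  qed (use e0 in simp)
  ultimately show ?thesis unfolding \<delta>_def e_def v'_def by simp
qed

end

section \<open>Consistency of the PIC estimator\<close>

lemma neighborhood_subset_cube:
  assumes "neighborhood \<Gamma>" "radius \<Gamma> \<le> int R"
  shows "\<Gamma> \<subseteq> cube R - {0}"
proof
  fix v assume v: "v \<in> \<Gamma>"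
  have "finite \<Gamma>" "0 \<notin> \<Gamma>" using assms(1) by (auto simp: neighborhood_def)
  then have "max_norm v \<le> radius \<Gamma>" using v by (auto simp: radius_def)
  then show "v \<in> cube R - {0}" using assms(2) v \<open>0 \<notin> \<Gamma>\<close> by (auto simp: cube_def)
qed

lemma translate_subset_of_core:
  assumes "i \<in> core k \<Lambda>" "\<Gamma> \<subseteq> cube k"
  shows "translate \<Gamma> i \<subseteq> \<Lambda>"
proof
  fix v assume "v \<in> translate \<Gamma> i"
  then obtain j where j: "j \<in> \<Gamma>" "v = i + j" by (auto simp: translate_def)
  have "i - v = - j" using j(2) by simp
  moreover have "max_norm j \<le> int k" using j(1) assms(2) by (auto simp: cube_def)
  ultimately have "max_norm (i - v) \<le> int k" by (simp only: max_norm_uminus)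
  then show "v \<in> \<Lambda>" using assms(1) by (auto simp: core_def)
qed

lemma PIC_minimizers_eqI:
  assumes "neighborhood \<Gamma>\<^sub>0" "real_of_int (radius \<Gamma>\<^sub>0) \<le> r"
    and "\<And>\<Gamma>. neighborhood \<Gamma> \<Longrightarrow> real_of_int (radius \<Gamma>) \<le> r \<Longrightarrow> \<Gamma> \<noteq> \<Gamma>\<^sub>0 \<Longrightarrow> PIC \<Lambda> x \<Gamma>\<^sub>0 < PIC \<Lambda> x \<Gamma>"
  shows "PIC_minimizers \<Lambda> x r = {\<Gamma>\<^sub>0}"
  using assms unfolding PIC_minimizers_def is_arg_min_def
  by (auto simp: not_less_iff_gr_or_eq) (metis less_asym)+

text \<open>
  The number of blocks is \<open>exp (O(z))\<close> and the number of sites at least \<open>exp (z\<^sup>2) / 2\<close>, where \<open>z = k ^ d\<close> in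
  epoch \<open>k\<close>.  Hence the accumulated deviations and the logarithmic penalty of a fixed
  neighborhood are negligible against the number of sites.
\<close>

lemma entropy_dominates:
  fixes \<Lambda> T :: "nat \<Rightarrow> (int ^ 'd) set" and \<delta> a c C K :: real and b :: "nat \<Rightarrow> nat"
  assumes \<Lambda>: "\<And>n. n \<le> card (\<Lambda> n)"
    and T: "\<And>n. card (T n) \<le> card (\<Lambda> n)" "(\<lambda>n. real (card (\<Lambda> n)) / real (card (T n))) \<longlonglongrightarrow> 1"
    and pos: "0 < \<delta>" "1 \<le> a" "0 < c" "0 < C"
    and b: "\<forall>\<^sub>F k in sequentially. real (b k) \<le> real k ^ CARD('d)"
  shows "\<forall>\<^sub>F n in sequentially. K * ln (real (card (\<Lambda> n))) +
      a ^ b (epoch (\<Lambda> n)) * (C * sqrt (c * real (epoch (\<Lambda> n)) ^ (2 * CARD('d)) * real (card (T n))))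
    < \<delta> * real (card (T n))"
proof -
  have ep: "filterlim (\<lambda>n. epoch (\<Lambda> n)) at_top sequentially" by (rule epoch_filterlim[OF \<Lambda>])
  have cardl: "filterlim (\<lambda>n. real (card (\<Lambda> n))) at_top sequentially"
    by (rule filterlim_at_top_mono[OF filterlim_real_sequentially]) (simp add: \<Lambda>)
  define z where "z k = real k ^ CARD('d)" for k
  have "filterlim z at_top sequentially"
    unfolding z_def by (intro filterlim_pow_at_top filterlim_real_sequentially) simp
  then have zl: "filterlim (\<lambda>n. z (epoch (\<Lambda> n))) at_top sequentially" by (rule filterlim_compose[OF _ ep])
  \<comment> \<open>The summand \<open>1\<close> keeps the exponent positive when \<open>a = 1\<close>.\<close>
  define A where "A = ln a + 1"
  have A: "0 < A" using pos by (simp add: A_def add_nonneg_pos)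
  define D where "D = C * sqrt c"
  have D: "0 < D" using pos by (simp add: D_def)
  have e: "0 < \<delta> / 4" using pos by simp
  have "\<forall>\<^sub>F y in at_top. K * ln y < \<delta> / 4 * y" using e by real_asymp
  then have ev1: "\<forall>\<^sub>F n in sequentially. K * ln (real (card (\<Lambda> n))) < \<delta> / 4 * real (card (\<Lambda> n))"
    by (rule eventually_compose_filterlim[OF _ cardl])
  have "\<forall>\<^sub>F y in at_top. exp (A * y) * D * y < \<delta> / 4 * exp (y\<^sup>2 / 2)" using e D A by real_asymp
  then have ev2: "\<forall>\<^sub>F n in sequentially. exp (A * z (epoch (\<Lambda> n))) * D * z (epoch (\<Lambda> n))
      < \<delta> / 4 * exp ((z (epoch (\<Lambda> n)))\<^sup>2 / 2)"
    by (rule eventually_compose_filterlim[OF _ zl])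
  have ev3: "\<forall>\<^sub>F n in sequentially. real (b (epoch (\<Lambda> n))) \<le> z (epoch (\<Lambda> n))"
    unfolding z_def by (rule eventually_compose_filterlim[OF b ep])
  have ev4: "\<forall>\<^sub>F n in sequentially. real (card (\<Lambda> n)) / real (card (T n)) < 2"
    "\<forall>\<^sub>F n in sequentially. 1 / 2 < real (card (\<Lambda> n)) / real (card (T n))"
    by (rule order_tendstoD[OF T(2)]; simp)+
  have ev5: "\<forall>\<^sub>F n in sequentially. 1 \<le> epoch (\<Lambda> n)"
    using ep by (simp add: filterlim_at_top)
  show ?thesis
    using ev1 ev2 ev3 ev4 ev5
  proof eventually_elim
    case (elim n)
    let ?z = "z (epoch (\<Lambda> n))" and ?T = "real (card (T n))" and ?L = "real (card (\<Lambda> n))"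
    have T0: "0 < ?T" using elim(5) by (cases "card (T n) = 0") auto
    have L2: "?L \<le> 2 * ?T" using elim(4) T0 by (simp add: field_simps)
    have z0: "0 \<le> ?z" by (simp add: z_def)
    have z2: "real (epoch (\<Lambda> n)) ^ (2 * CARD('d)) = ?z\<^sup>2"
      by (simp add: z_def power_mult[symmetric] mult.commute)
    have L0: "0 < ?L" using T0 T(1)[of n] by simp
    have "?z\<^sup>2 \<le> ln ?L" using epoch_bounds(1)[OF elim(6)] by (simp add: z2)
    then have "exp (?z\<^sup>2) \<le> ?L" using L0 by (metis exp_le_cancel_iff exp_ln)
    then have "exp (?z\<^sup>2) \<le> 2 * ?T" using L2 by simp
    then have "(exp (?z\<^sup>2 / 2))\<^sup>2 \<le> (2 * sqrt ?T)\<^sup>2"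
      using T0 by (simp add: power_mult_distrib flip: exp_double)
    then have sq: "exp (?z\<^sup>2 / 2) \<le> 2 * sqrt ?T" by (rule power2_le_imp_le) simp
    have "a ^ b (epoch (\<Lambda> n)) = exp (ln a * real (b (epoch (\<Lambda> n))))"
      using pos by (simp add: exp_of_nat2_mult)
    also have "ln a * real (b (epoch (\<Lambda> n))) \<le> A * ?z"
      using elim(3) pos z0 by (intro mult_mono) (auto simp: A_def)
    then have "exp (ln a * real (b (epoch (\<Lambda> n)))) \<le> exp (A * ?z)" by simp
    finally have ab: "a ^ b (epoch (\<Lambda> n)) \<le> exp (A * ?z)" .
    have "C * sqrt (c * ?z\<^sup>2 * ?T) = D * ?z * sqrt ?T"
      using z0 by (simp add: D_def real_sqrt_mult)
    then have "a ^ b (epoch (\<Lambda> n)) * (C * sqrt (c * ?z\<^sup>2 * ?T)) \<le> exp (A * ?z) * (D * ?z * sqrt ?T)"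
      using ab D z0 by (simp add: mult_right_mono)
    also have "\<dots> = (exp (A * ?z) * D * ?z) * sqrt ?T" by simp
    also have "\<dots> \<le> (\<delta> / 4 * exp (?z\<^sup>2 / 2)) * sqrt ?T" using elim(2) by (intro mult_right_mono) auto
    also have "\<dots> \<le> (\<delta> / 4 * (2 * sqrt ?T)) * sqrt ?T"
      using sq pos by (intro mult_right_mono mult_left_mono) auto
    also have "\<dots> = \<delta> / 2 * ?T" by simp
    finally have 1: "a ^ b (epoch (\<Lambda> n)) * (C * sqrt (c * ?z\<^sup>2 * ?T)) \<le> \<delta> / 2 * ?T" .
    have "\<delta> / 4 * ?L \<le> \<delta> / 4 * (2 * ?T)" using L2 pos by (intro mult_left_mono) auto
    then have "K * ln ?L < \<delta> / 2 * ?T" using elim(1) by simp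
    with 1 show ?case unfolding z2 by simp
  qed
qed

context positive_markov_field
begin

text \<open>
  The constant in the bound on \<open>\<tau>\<close> makes the likelihood gain at most a quarter of the penalty of \<open>\<Gamma>\<close>.
  At least one site more in \<open>\<Gamma>\<close> means that the penalty of \<open>\<Gamma>\<^sub>0\<close> is at most half of it.
\<close>

lemma PIC_overfit:
  assumes \<Lambda>: "finite \<Lambda>" "1 < card \<Lambda>" and A: "CARD('a) \<ge> 2"
    and \<Gamma>: "\<Gamma>\<^sub>0 \<subset> \<Gamma>" "\<Gamma> \<subseteq> cube R - {0}" and q: "0 < q" "\<And>y. q \<le> site_kernel y"
    and inner: "\<And>i. i \<in> inner_region \<Lambda> \<Longrightarrow> translate (cube R) i \<subseteq> \<Lambda>"
    and typical: "typical \<eta> \<tau> R (inner_region \<Lambda>) x"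
    and \<tau>: "0 \<le> \<tau>" "\<tau> \<le> q / (36 * real CARD('a)) * ln (real (card \<Lambda>))"
  shows "PIC \<Lambda> x \<Gamma>\<^sub>0 < PIC \<Lambda> x \<Gamma>"
proof -
  let ?T = "inner_region \<Lambda>"
  have finT: "finite ?T" using \<Lambda>(1) by (auto simp: inner_region_def intro: finite_subset)
  have fin\<Gamma>: "finite \<Gamma>" using \<Gamma>(2) finite_subset[OF _ finite_cube] by blast
  have mpl: "log_MPL \<Lambda> x \<Gamma>' = (\<Sum>i\<in>?T. ln (empirical_kernel ?T x \<Gamma>' (recentre i x)))" if "\<Gamma>' \<subseteq> \<Gamma>" for \<Gamma>'
    using that \<Gamma>(2) inner translate_mono[of \<Gamma>' "cube R"] finite_subset[OF that fin\<Gamma>]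
    by (intro log_MPL_eq_sum \<Lambda>(1)) blast+
  define l where "l = ln (real (card \<Lambda>))"
  have l: "0 < l" using \<Lambda>(2) by (simp add: l_def)
  define P where "P = real (CARD('a) ^ card \<Gamma>)"
  have P: "0 < P" by (simp add: P_def)
  have "2 * CARD('a) ^ card \<Gamma>\<^sub>0 \<le> CARD('a) * CARD('a) ^ card \<Gamma>\<^sub>0" using A by (intro mult_right_mono) auto
  also have "\<dots> = CARD('a) ^ Suc (card \<Gamma>\<^sub>0)" by simp
  also have "\<dots> \<le> CARD('a) ^ card \<Gamma>"
    using psubset_card_mono[OF fin\<Gamma> \<Gamma>(1)] A by (intro power_increasing) auto
  finally have "real (2 * CARD('a) ^ card \<Gamma>\<^sub>0) \<le> P" unfolding P_def by (rule of_nat_mono)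
  then have P2: "real (CARD('a) ^ card \<Gamma>\<^sub>0) \<le> P / 2" by simp
  have "log_MPL \<Lambda> x \<Gamma> - log_MPL \<Lambda> x \<Gamma>\<^sub>0 \<le> real (CARD('a) ^ (card \<Gamma> + 1)) * (9 * \<tau> / q)"
    using overfit_gain_le[OF finT _ \<Gamma>(2) q \<tau>(1) typical] maximum_likelihood_lower[OF finT, of x] \<Gamma>(1)
    by (simp add: mpl psubset_imp_subset)
  also have "\<dots> \<le> P * real CARD('a) * (9 * (q / (36 * real CARD('a)) * l) / q)"
  proof -
    have "9 * \<tau> / q \<le> 9 * (q / (36 * real CARD('a)) * l) / q"
      using \<tau>(2) q by (intro divide_right_mono mult_left_mono) (auto simp: l_def)
    then have "P * real CARD('a) * (9 * \<tau> / q) \<le> P * real CARD('a) * (9 * (q / (36 * real CARD('a)) * l) / q)"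
      using P by (intro mult_left_mono) auto
    then show ?thesis by (simp add: P_def mult.commute)
  qed
  also have "\<dots> = P * l / 4" using q A by simp
  finally have gain: "log_MPL \<Lambda> x \<Gamma> - log_MPL \<Lambda> x \<Gamma>\<^sub>0 \<le> P * l / 4" .
  have "real (CARD('a) ^ card \<Gamma>\<^sub>0) * l \<le> P / 2 * l" using P2 l by (intro mult_right_mono) auto
  moreover have "0 < P * l" using P l by simp
  ultimately show ?thesis using gain unfolding PIC_def P_def[symmetric] l_def[symmetric] by linarith
qed

text \<open>
  The penalty of \<open>\<Gamma>\<close> is merely nonnegative here; the likelihood loss alone exceeds the penalty of \<open>\<Gamma>\<^sub>0\<close>.
\<close>

lemma PIC_underfit:
  assumes \<Lambda>: "finite \<Lambda>" "0 < card \<Lambda>"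
    and R: "\<Gamma>\<^sub>0 \<subseteq> cube R - {0}" and \<Gamma>: "\<Gamma> \<subseteq> cube R - {0}" "j \<in> \<Gamma>\<^sub>0" "j \<notin> \<Gamma>"
    and dep: "site_kernel v \<noteq> site_kernel (v(j := s))"
    and q: "0 < q" "q \<le> 1" "\<And>y. q \<le> site_kernel y" and \<eta>: "0 \<le> \<eta>"
    and inner: "\<And>i. i \<in> inner_region \<Lambda> \<Longrightarrow> translate (cube R) i \<subseteq> \<Lambda>"
    and \<tau>: "0 \<le> \<tau>" and typical: "typical \<eta> \<tau> R (inner_region \<Lambda>) x"
    and large: "real (CARD('a) ^ card \<Gamma>\<^sub>0) * ln (real (card \<Lambda>)) +
        real CARD('a) ^ card (cube R :: (int ^ 'd) set) * ((12 + 6 / q) * sqrt (\<tau> * real (card (inner_region \<Lambda>))))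
      < 2 * (\<eta> * ((sqrt (site_kernel v) - sqrt (site_kernel (v(j := s))))\<^sup>2 / 4)) * real (card (inner_region \<Lambda>))"
  shows "PIC \<Lambda> x \<Gamma>\<^sub>0 < PIC \<Lambda> x \<Gamma>"
proof -
  let ?T = "inner_region \<Lambda>"
  define p where "p = empirical_kernel ?T x \<Gamma>"
  define P where "P = real (CARD('a) ^ card (cube R :: (int ^ 'd) set))"
  define S where "S = sqrt (\<tau> * real (card ?T))"
  have finT: "finite ?T" using \<Lambda>(1) by (auto simp: inner_region_def intro: finite_subset)
  have mpl: "log_MPL \<Lambda> x \<Gamma>' = (\<Sum>i\<in>?T. ln (empirical_kernel ?T x \<Gamma>' (recentre i x)))" if "\<Gamma>' \<subseteq> cube R" for \<Gamma>'
    using that inner translate_mono[of \<Gamma>' "cube R"] finite_subset[OF that finite_cube]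
    by (intro log_MPL_eq_sum \<Lambda>(1)) blast+
  have \<Gamma>0: "0 \<notin> \<Gamma>" using \<Gamma>(1) by auto
  have j0: "j \<noteq> 0" using \<Gamma>(2) zero_notin_\<Gamma>\<^sub>0 by blast
  have lp: "local_on (cube R - {j}) p" unfolding p_def
    by (rule local_on_mono[OF empirical_kernel_local]) (use \<Gamma> j0 in auto)
  then have lp': "local_on (cube R) p" by (rule local_on_mono) auto
  have p0: "0 \<le> p y" for y by (simp add: p_def empirical_kernel_nonneg)
  have p1: "p y \<le> 1" for y
    unfolding p_def empirical_kernel_def
    using occurrences_antimono[of \<Gamma> "insert 0 \<Gamma>" ?T y x] occurrences_nonneg[of ?T \<Gamma> y x]
    by (auto simp: divide_le_eq_1)
  have sp: "(\<Sum>b\<in>UNIV. p (y(0 := b))) \<le> 1" for y unfolding p_def by (rule sum_empirical_kernel[OF \<Gamma>0])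
  have pp: "0 < p (recentre i x)" if "i \<in> ?T" for i unfolding p_def by (rule empirical_kernel_pos[OF finT that])
  have "2 * (\<Sum>i\<in>?T. hellinger_gap p (recentre i x)) - P * (6 * S / q)
      \<le> (\<Sum>i\<in>?T. ln (site_kernel (recentre i x))) - (\<Sum>i\<in>?T. ln (p (recentre i x)))"
    unfolding P_def S_def
    by (rule sum_log_ratio_ge_hellinger[OF finT R q \<tau> typical lp' p0 p1 pp])
  moreover have "\<eta> * ((sqrt (site_kernel v) - sqrt (site_kernel (v(j := s))))\<^sup>2 / 4) * real (card ?T) - P * (6 * S)
      \<le> (\<Sum>i\<in>?T. hellinger_gap p (recentre i x))"
    unfolding P_def S_def
    by (rule sum_hellinger_gap_ge[OF finT R \<eta> \<tau> typical \<Gamma>(2) dep lp p0 sp])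
  moreover have "log_MPL \<Lambda> x \<Gamma> = (\<Sum>i\<in>?T. ln (p (recentre i x)))"
    unfolding p_def by (rule mpl) (use \<Gamma> in auto)
  moreover have "(\<Sum>i\<in>?T. ln (site_kernel (recentre i x))) \<le> log_MPL \<Lambda> x \<Gamma>\<^sub>0"
    by (subst mpl) (use R maximum_likelihood_lower[OF finT, of x] in auto)
  moreover have "real (CARD('a) ^ card \<Gamma>\<^sub>0) * ln (real (card \<Lambda>)) + P * ((12 + 6 / q) * S)
      < 2 * (\<eta> * ((sqrt (site_kernel v) - sqrt (site_kernel (v(j := s))))\<^sup>2 / 4)) * real (card ?T)"
    using large by (simp add: P_def S_def)
  moreover have "P * ((12 + 6 / q) * S) = 2 * (P * (6 * S)) + P * (6 * S / q)"
    by (simp add: algebra_simps)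
  moreover have "0 \<le> real (CARD('a) ^ card \<Gamma>) * ln (real (card \<Lambda>))" using \<Lambda>(2) by simp
  ultimately show ?thesis unfolding PIC_def by argo
qed

end

theorem theorem2p1:
  fixes M :: "'w measure"
    and X :: "int ^ 'd \<Rightarrow> 'w \<Rightarrow> 'a::finite"
    and \<Gamma>\<^sub>0 :: "(int ^ 'd) set"
    and \<Lambda> :: "nat \<Rightarrow> (int ^ 'd) set"
    and r :: "nat \<Rightarrow> real"
  assumes "prob_space M"
    and "\<And>i. X i \<in> M \<rightarrow>\<^sub>M count_space UNIV"
    and "CARD('a) \<ge> 2"
    and "\<And>\<Delta> a. finite \<Delta> \<Longrightarrow> block_prob M X \<Delta> a > 0"
    and "markov_random_field M X"
    and "basic_neighborhood M X \<Gamma>\<^sub>0"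
    and "\<And>n. finite (\<Lambda> n)"
    and "\<And>n. \<Lambda> n \<subset> \<Lambda> (Suc n)"
    and "(\<lambda>n. real (card (\<Lambda> n)) / real (card (inner_region (\<Lambda> n)))) \<longlonglongrightarrow> 1"
    and "filterlim r at_top sequentially"
    and "r \<in> o(\<lambda>n. log_scale (\<Lambda> n))"
  shows "AE \<omega> in M. \<forall>\<^sub>F n in sequentially. PIC_minimizers (\<Lambda> n) (\<lambda>i. X i \<omega>) (r n) = {\<Gamma>\<^sub>0}"
proof -
  have markov: "markov_neighborhood M X \<Gamma>\<^sub>0"
    and minimal: "\<And>\<Gamma>. markov_neighborhood M X \<Gamma> \<Longrightarrow> \<Gamma>\<^sub>0 \<subseteq> \<Gamma>"
    using assms(6) by (auto simp: basic_neighborhood_def)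
  interpret prob_space M by (rule assms(1))
  interpret positive_markov_field M X \<Gamma>\<^sub>0
    by unfold_locales (use assms(2,4) markov in auto)
  have nb0: "neighborhood \<Gamma>\<^sub>0" using markov by (simp add: markov_neighborhood_def)
  obtain q where q: "0 < q" "q \<le> 1" "\<And>y. q \<le> site_kernel y" using site_kernel_lower_bound by blast
  define \<eta> where "\<eta> = q ^ card \<Gamma>\<^sub>0"
  have \<eta>: "0 < \<eta>" using q by (simp add: \<eta>_def)
  \<comment> \<open>With \<open>\<tau> = c * ln (card \<Lambda>)\<close> the chi-square bound \<open>9 * \<tau> / q\<close>, times \<open>CARD('a)\<close>, is \<open>ln (card \<Lambda>) / 4\<close>.\<close>
  define c where "c = q / (36 * real CARD('a))"
  have c: "0 < c" using q assms(3) by (simp add: c_def)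
  obtain \<epsilon> where \<epsilon>: "0 < \<epsilon>" "\<epsilon> \<le> 1"
    and cubees: "\<forall>\<^sub>F k in sequentially. real ((2 * nat \<lfloor>\<epsilon> * real k\<rfloor> + 1) ^ CARD('d)) \<le> real k ^ CARD('d)"
    and AE: "AE \<omega> in M. \<forall>\<^sub>F k in sequentially. \<forall>n. epoch (\<Lambda> n) = k \<longrightarrow>
      typical (q ^ card \<Gamma>\<^sub>0) (c * real k ^ (2 * CARD('d))) (nat \<lfloor>\<epsilon> * real k\<rfloor>) (inner_region (\<Lambda> n)) (realization \<omega>)"
    using AE_eventually_typical[where \<Lambda> = \<Lambda>, OF less_imp_le[OF q(1)] q(2,3) c assms(3,7,8)] by blast
  define k where "k n = epoch (\<Lambda> n)" for n
  define R where "R n = nat \<lfloor>\<epsilon> * real (k n)\<rfloor>" for n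
  define \<tau> where "\<tau> n = c * real (k n) ^ (2 * CARD('d))" for n
  have card_ge: "n \<le> card (\<Lambda> n)" for n by (rule finite_subset_chain_card[where \<Lambda> = \<Lambda>, OF assms(7,8)])
  have kl: "filterlim k at_top sequentially" unfolding k_def by (rule epoch_filterlim[OF card_ge])
  have inner_sub: "inner_region (\<Lambda> n) \<subseteq> \<Lambda> n" for n by (auto simp: inner_region_def)

  \<comment> \<open>A missed site may be any of the finitely many sites of \<open>\<Gamma>\<^sub>0\<close>; a witness of dependence is fixed for each
    in advance, so that one threshold serves all neighborhoods, whose number grows with the sample.\<close>
  have "\<exists>j v s. (j = l \<or> j = - l) \<and> site_kernel v \<noteq> site_kernel (v(j := s))" if "l \<in> \<Gamma>\<^sub>0" for l
    using site_kernel_depends_on_basic_sites[OF minimal that] by metis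
  then obtain J V S where dep: "\<And>l. l \<in> \<Gamma>\<^sub>0 \<Longrightarrow> J l = l \<or> J l = - l"
    "\<And>l. l \<in> \<Gamma>\<^sub>0 \<Longrightarrow> site_kernel (V l) \<noteq> site_kernel ((V l)(J l := S l))"
    by metis
  define \<delta> where "\<delta> l = 2 * (\<eta> * ((sqrt (site_kernel (V l)) - sqrt (site_kernel ((V l)(J l := S l))))\<^sup>2 / 4))" for l
  have \<delta>: "0 < \<delta> l" if "l \<in> \<Gamma>\<^sub>0" for l
  proof -
    have "sqrt (site_kernel (V l)) \<noteq> sqrt (site_kernel ((V l)(J l := S l)))" using dep(2)[OF that] by simp
    then show ?thesis using \<eta> by (simp add: \<delta>_def)
  qed
  have large: "\<forall>\<^sub>F n in sequentially. \<forall>l\<in>\<Gamma>\<^sub>0. real (CARD('a) ^ card \<Gamma>\<^sub>0) * ln (real (card (\<Lambda> n))) +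
        real CARD('a) ^ card (cube (R n) :: (int ^ 'd) set) * ((12 + 6 / q) * sqrt (\<tau> n * real (card (inner_region (\<Lambda> n)))))
      < \<delta> l * real (card (inner_region (\<Lambda> n)))"
  proof (rule eventually_ball_finite[OF finite_\<Gamma>\<^sub>0], rule ballI)
    fix l assume "l \<in> \<Gamma>\<^sub>0"
    have card_inner: "card (inner_region (\<Lambda> n)) \<le> card (\<Lambda> n)" for n
      by (rule card_mono[OF assms(7) inner_sub])
    have "1 \<le> real CARD('a)" "0 < 12 + 6 / q" using assms(3) q by (auto intro: add_pos_pos)
    from entropy_dominates[OF card_ge card_inner assms(9) \<delta>[OF \<open>l \<in> \<Gamma>\<^sub>0\<close>] this(1) c this(2) cubees]
    show "\<forall>\<^sub>F n in sequentially. real (CARD('a) ^ card \<Gamma>\<^sub>0) * ln (real (card (\<Lambda> n))) +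
        real CARD('a) ^ card (cube (R n) :: (int ^ 'd) set) * ((12 + 6 / q) * sqrt (\<tau> n * real (card (inner_region (\<Lambda> n)))))
      < \<delta> l * real (card (inner_region (\<Lambda> n)))"
      unfolding card_cube R_def \<tau>_def k_def .
  qed

  have r_small: "\<forall>\<^sub>F n in sequentially. \<bar>r n\<bar> \<le> \<epsilon> / 2 * \<bar>log_scale (\<Lambda> n)\<bar>"
    using landau_o.smallD[OF assms(11), of "\<epsilon> / 2"] \<epsilon> by simp
  have k1: "\<forall>\<^sub>F n in sequentially. 1 \<le> k n" using kl by (simp add: filterlim_at_top)
  have r0: "\<forall>\<^sub>F n in sequentially. real_of_int (radius \<Gamma>\<^sub>0) \<le> r n"
    using assms(10) by (simp add: filterlim_at_top)
  have nonrandom: "\<forall>\<^sub>F n in sequentially. 1 \<le> k n \<and> real_of_int (radius \<Gamma>\<^sub>0) \<le> r n \<and>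
      r n \<le> \<epsilon> * real (k n) \<and> (\<forall>l\<in>\<Gamma>\<^sub>0. real (CARD('a) ^ card \<Gamma>\<^sub>0) * ln (real (card (\<Lambda> n))) +
        real CARD('a) ^ card (cube (R n) :: (int ^ 'd) set) * ((12 + 6 / q) * sqrt (\<tau> n * real (card (inner_region (\<Lambda> n)))))
      < \<delta> l * real (card (inner_region (\<Lambda> n))))"
    using large r_small k1 r0
  proof eventually_elim
    case (elim n)
    have "log_scale (\<Lambda> n) \<le> real (k n) + 1" using epoch_bounds(4)[of "\<Lambda> n"] by (simp add: k_def)
    also have "\<dots> \<le> 2 * real (k n)" using elim(3) by simp
    finally have "\<epsilon> / 2 * log_scale (\<Lambda> n) \<le> \<epsilon> / 2 * (2 * real (k n))" using \<epsilon> by (intro mult_left_mono) auto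
    then have "r n \<le> \<epsilon> * real (k n)" using elim(2) log_scale_nonneg[of "\<Lambda> n"] by simp
    then show ?case using elim by blast
  qed

  from AE show ?thesis
  proof eventually_elim
    case (elim \<omega>)
    from eventually_compose_filterlim[OF elim kl] nonrandom show ?case
    proof eventually_elim
      case (elim n)
      let ?x = "realization \<omega>"
      have typical: "typical \<eta> (\<tau> n) (R n) (inner_region (\<Lambda> n)) ?x"
        using elim(1) by (simp add: \<eta>_def \<tau>_def R_def k_def)
      have k1: "1 \<le> k n" and r0: "real_of_int (radius \<Gamma>\<^sub>0) \<le> r n" and rk: "r n \<le> \<epsilon> * real (k n)"
        using elim(2) by auto
      have in_cube: "\<Gamma> \<subseteq> cube (R n) - {0}" if "neighborhood \<Gamma>" "real_of_int (radius \<Gamma>) \<le> r n" for \<Gamma> :: "(int ^ 'd) set"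
      proof (rule neighborhood_subset_cube[OF that(1)])
        have "radius \<Gamma> \<le> \<lfloor>\<epsilon> * real (k n)\<rfloor>" using that(2) rk by (simp add: le_floor_iff)
        then show "radius \<Gamma> \<le> int (R n)" using \<epsilon> by (simp add: R_def)
      qed
      have "\<epsilon> * real (k n) \<le> 1 * real (k n)" using \<epsilon> by (intro mult_right_mono) auto
      then have "R n \<le> k n" unfolding R_def by linarith
      then have inner: "translate (cube (R n)) i \<subseteq> \<Lambda> n" if "i \<in> inner_region (\<Lambda> n)" for i
        using that translate_subset_of_core[OF _ cube_mono] unfolding inner_region_eq_core k_def by blast
      have ln_ge: "real (k n) ^ (2 * CARD('d)) \<le> ln (real (card (\<Lambda> n)))"
        using epoch_bounds(1)[of "\<Lambda> n"] k1 by (simp add: k_def)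
      have "1 \<le> real (k n) ^ (2 * CARD('d))" using k1 by (intro one_le_power) simp
      then have ln_pos: "0 < ln (real (card (\<Lambda> n)))" using ln_ge by linarith
      then have card1: "1 < card (\<Lambda> n)" by (cases "card (\<Lambda> n) = 0") auto
      have "0 \<le> \<tau> n" using c by (simp add: \<tau>_def)
      moreover have "\<tau> n \<le> q / (36 * real CARD('a)) * ln (real (card (\<Lambda> n)))"
        unfolding \<tau>_def c_def[symmetric] using c by (intro mult_left_mono ln_ge) simp
      ultimately have \<tau>: "0 \<le> \<tau> n" "\<tau> n \<le> q / (36 * real CARD('a)) * ln (real (card (\<Lambda> n)))" .
      have R0: "\<Gamma>\<^sub>0 \<subseteq> cube (R n) - {0}" by (rule in_cube[OF nb0 r0])
      show "PIC_minimizers (\<Lambda> n) ?x (r n) = {\<Gamma>\<^sub>0}"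
      proof (rule PIC_minimizers_eqI[OF nb0 r0])
        fix \<Gamma> :: "(int ^ 'd) set"
        assume \<Gamma>: "neighborhood \<Gamma>" "real_of_int (radius \<Gamma>) \<le> r n" "\<Gamma> \<noteq> \<Gamma>\<^sub>0"
        note \<Gamma>_cube = in_cube[OF \<Gamma>(1,2)]
        show "PIC (\<Lambda> n) ?x \<Gamma>\<^sub>0 < PIC (\<Lambda> n) ?x \<Gamma>"
        proof (cases "\<Gamma>\<^sub>0 \<subseteq> \<Gamma>")
          case True
          then have "\<Gamma>\<^sub>0 \<subset> \<Gamma>" using \<Gamma>(3) by auto
          then show ?thesis
            by (rule PIC_overfit[OF assms(7) card1 assms(3) _ \<Gamma>_cube q(1,3) inner typical \<tau>])
        next
          case False
          then obtain l where l: "l \<in> \<Gamma>\<^sub>0" "l \<notin> \<Gamma>" by auto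
          have sym: "- l \<in> \<Gamma>' \<longleftrightarrow> l \<in> \<Gamma>'" if "neighborhood \<Gamma>'" for \<Gamma>'
            using that unfolding neighborhood_def by (metis (no_types, lifting) image_eqI minus_minus)
          have J: "J l \<in> \<Gamma>\<^sub>0" "J l \<notin> \<Gamma>" using dep(1)[OF l(1)] l sym nb0 \<Gamma>(1) by auto
          have card0: "0 < card (\<Lambda> n)" using card1 by simp
          show ?thesis
            by (rule PIC_underfit[OF assms(7) card0 R0 \<Gamma>_cube J dep(2)[OF l(1)] q less_imp_le[OF \<eta>] inner \<tau>(1) typical])
              (use elim(2) l(1) in \<open>auto simp: \<delta>_def\<close>)
        qed
      qed
    qed
  qed
qed

end
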